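(* (a) Let $\Omega\subset\mathbb{R}^n$ be open, let $f\colon\Omega\times\mathbb{R}\to\mathbb{R}$ be continuous, and let $u\in C(\Omega)$ be a viscosity solution of $-\Delta^N_\infty u = f(x,u)$ in $\Omega$, where $\Delta^N_\infty$ is the normalized infinity Laplacian. If $u$ is locally semiconcave in $\Omega$, then $u$ is everywhere differentiable in $\Omega$ (hence of class $C^1(\Omega)$). (b) In particular, if $\Omega$ is an open bounded convex subset of $\mathbb{R}^n$ and $u\in C(\overline\Omega)$ is the unique viscosity solution of the Dirichlet problem $$-\Delta^N_\infty u = 1 \ \text{ in } \Omega, \qquad u = 0 \ \text{ on } \partial\Omega,$$ then $u\in C^1(\Omega)$.
   Context: For functions $u, v\colon \Omega\to\mathbb{R}$ and $x\in\Omega$, $u \prec_x v$ means $u(x)=v(x)$ and $u(y)\le v(y)$ for every $y\in\Omega$. For a symmetric matrix $A$, $\lambda_{\min}(A)$ and $\lambda_{\max}(A)$ denote its minimum and maximum eigenvalues. For a $C^2$ function $\varphi$ near $x$, set $\Delta^+_\infty\varphi(x) = \Delta^-_\infty\varphi(x) = |\nabla\varphi(x)|^{-2}\langle \nabla^2\varphi(x)\nabla\varphi(x),\nabla\varphi(x)\rangle$ if $\nabla\varphi(x)\ne 0$, while $\Delta^+_\infty\varphi(x) = \lambda_{\max}(\nabla^2\varphi(x))$ and $\Delta^-_\infty\varphi(x)=\lambda_{\min}(\nabla^2\varphi(x))$ if $\nabla\varphi(x)=0$. A function $u\in C(\Omega)$ is a viscosity solution of $-\Delta^N_\infty u = f(x,u)$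 in $\Omega$ if for every $x\in\Omega$: (sub-solution property) $-\Delta^+_\infty\varphi(x)\le f(x,u(x))$ for every $\varphi\in C^2(\Omega)$ with $u\prec_x\varphi$; and (super-solution property) $-\Delta^-_\infty\varphi(x)\ge f(x,u(x))$ for every $\varphi\in C^2(\Omega)$ with $\varphi\prec_x u$. A viscosity solution of the Dirichlet problem is a function $u\in C(\overline\Omega)$ which is a viscosity solution of the equation in $\Omega$ (here with $f\equiv 1$) and vanishes on $\partial\Omega$; existence and uniqueness for the problem in (b) are known. A function $u$ is semiconcave with constant $C$ on a set $K$ if $u(\lambda x+(1-\lambda)y)\ge \lambda u(x)+(1-\lambda)u(y)-C\frac{\lambda(1-\lambda)}{2}|x-y|^2$ for every segment $[x,y]\subset K$ and every $\lambda\in[0,1]$. It is locally semiconcave in $\Omega$ if it is semiconcave (with some constant) on each compact subset of $\Omega$. *)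

theory Defs
  imports "HOL-Analysis.Analysis"
begin

(* The gradient and Hessian are meaningful only where the function is once, respectively twice,
   differentiable; they are used below only under such hypotheses and on open sets. *)

definition gradient :: "(real^'n \<Rightarrow> real) \<Rightarrow> real^'n \<Rightarrow> real^'n" where
  "gradient f x = (THE D. GDERIV f x :> D)"

definition hessian :: "(real^'n \<Rightarrow> real) \<Rightarrow> real^'n \<Rightarrow> real^'n^'n" where
  "hessian f x = jacobian (gradient f) (at x)"

lemma gradient_eqI: "gradient f x = D" if D: "GDERIV f x :> D"
proof -
  have "D' = D" if "GDERIV f x :> D'" for D'
  proof -
    have "(\<lambda>h. inner h D') = (\<lambda>h. inner h D)"
      using has_derivative_unique that D unfolding gderiv_def by blast
    then have "inner (D' - D) D' = inner (D' - D) D"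
      by (rule fun_cong)
    then have "inner (D' - D) (D' - D) = 0"
      by (simp add: inner_diff_right)
    then show ?thesis
      by simp
  qed
  with D show ?thesis
    unfolding gradient_def by (intro the_equality)
qed

lemma GDERIV_gradient: "GDERIV f x :> gradient f x" if "f differentiable (at x)"
proof -
  from that obtain F where F: "(f has_derivative F) (at x)"
    unfolding differentiable_def by blast
  have "F h = inner h (adjoint F 1)" for h
    using adjoint_works[OF has_derivative_linear[OF F], of h 1] by simp
  then have "F = (\<lambda>h. inner h (adjoint F 1))"
    by (rule ext)
  with F have "GDERIV f x :> adjoint F 1"
    unfolding gderiv_def by argo
  moreover from this have "gradient f x = adjoint F 1"
    by (rule gradient_eqI)
  ultimately show ?thesis
    by argo
qed

definition C1_on :: "(real^'n) set \<Rightarrow> (real^'n \<Rightarrow> real) \<Rightarrow> bool" where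
  "C1_on \<Omega> f \<longleftrightarrow> (\<forall>x\<in>\<Omega>. f differentiable (at x)) \<and> continuous_on \<Omega> (gradient f)"

definition C2_on :: "(real^'n) set \<Rightarrow> (real^'n \<Rightarrow> real) \<Rightarrow> bool" where
  "C2_on \<Omega> f \<longleftrightarrow> C1_on \<Omega> f \<and> (\<forall>x\<in>\<Omega>. gradient f differentiable (at x)) \<and>
     continuous_on \<Omega> (hessian f)"

(* The set of real eigenvalues of a symmetric matrix is finite and nonempty, so Max and Min are
   genuine; they are applied only to Hessians of C2 functions. *)

definition eigenvalues :: "real^'n^'n \<Rightarrow> real set" where
  "eigenvalues A = {l. \<exists>v. v \<noteq> 0 \<and> A *v v = l *\<^sub>R v}"

definition lambda_max :: "real^'n^'n \<Rightarrow> real" where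
  "lambda_max A = Max (eigenvalues A)"

definition lambda_min :: "real^'n^'n \<Rightarrow> real" where
  "lambda_min A = Min (eigenvalues A)"

definition infty_laplacian_upper :: "(real^'n \<Rightarrow> real) \<Rightarrow> real^'n \<Rightarrow> real" where
  "infty_laplacian_upper \<phi> x =
     (if gradient \<phi> x \<noteq> 0
      then ((hessian \<phi> x *v gradient \<phi> x) \<bullet> gradient \<phi> x) / (norm (gradient \<phi> x))\<^sup>2
      else lambda_max (hessian \<phi> x))"

definition infty_laplacian_lower :: "(real^'n \<Rightarrow> real) \<Rightarrow> real^'n \<Rightarrow> real" where
  "infty_laplacian_lower \<phi> x =
     (if gradient \<phi> x \<noteq> 0
      then ((hessian \<phi> x *v gradient \<phi> x) \<bullet> gradient \<phi> x) / (norm (gradient \<phi> x))\<^sup>2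
      else lambda_min (hessian \<phi> x))"

definition touches_from_below ::
    "(real^'n) set \<Rightarrow> real^'n \<Rightarrow> (real^'n \<Rightarrow> real) \<Rightarrow> (real^'n \<Rightarrow> real) \<Rightarrow> bool" where
  "touches_from_below \<Omega> x u v \<longleftrightarrow> u x = v x \<and> (\<forall>y\<in>\<Omega>. u y \<le> v y)"

definition viscosity_solution ::
    "(real^'n) set \<Rightarrow> (real^'n \<Rightarrow> real \<Rightarrow> real) \<Rightarrow> (real^'n \<Rightarrow> real) \<Rightarrow> bool" where
  "viscosity_solution \<Omega> f u \<longleftrightarrow>
     continuous_on \<Omega> u \<and>
     (\<forall>x\<in>\<Omega>.
        (\<forall>\<phi>. C2_on \<Omega> \<phi> \<and> touches_from_below \<Omega> x u \<phi> \<longrightarrow>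
              - infty_laplacian_upper \<phi> x \<le> f x (u x)) \<and>
        (\<forall>\<phi>. C2_on \<Omega> \<phi> \<and> touches_from_below \<Omega> x \<phi> u \<longrightarrow>
              - infty_laplacian_lower \<phi> x \<ge> f x (u x)))"

definition dirichlet_solution :: "(real^'n) set \<Rightarrow> (real^'n \<Rightarrow> real) \<Rightarrow> bool" where
  "dirichlet_solution \<Omega> u \<longleftrightarrow>
     continuous_on (closure \<Omega>) u \<and> viscosity_solution \<Omega> (\<lambda>x t. 1) u \<and>
     (\<forall>x\<in>frontier \<Omega>. u x = 0)"

definition semiconcave_on :: "real \<Rightarrow> (real^'n) set \<Rightarrow> (real^'n \<Rightarrow> real) \<Rightarrow> bool" where
  "semiconcave_on C K u \<longleftrightarrow>
     (\<forall>x y. closed_segment x y \<subseteq> K \<longrightarrow>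
        (\<forall>t\<in>{0..1}. u (t *\<^sub>R x + (1 - t) *\<^sub>R y) \<ge>
           t * u x + (1 - t) * u y - C * (t * (1 - t) / 2) * (norm (x - y))\<^sup>2))"

definition locally_semiconcave_on :: "(real^'n) set \<Rightarrow> (real^'n \<Rightarrow> real) \<Rightarrow> bool" where
  "locally_semiconcave_on \<Omega> u \<longleftrightarrow>
     (\<forall>K. compact K \<and> K \<subseteq> \<Omega> \<longrightarrow> (\<exists>C. semiconcave_on C K u))"

end

theory Submission
  imports Defs
begin

text \<open>
  (a) If the superdifferential of a locally semiconcave \<open>u\<close> at \<open>x\<close> contains a segment in a direction
  \<open>q\<close>, then near \<open>x\<close> the function \<open>u\<close> lies below \<open>u(x) + p h + C/2 |h|^2 - R (q h)^2\<close> for every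
  \<open>R\<close> and every interior point \<open>p\<close> of the segment. Choosing \<open>p\<close> not orthogonal to \<open>q\<close> and \<open>R\<close>
  large contradicts the subsolution property. So the superdifferential is a single point, and
  its closedness gives differentiability and continuity of the gradient.

  (b) By (a) it suffices that \<open>w = sqrt u\<close> is concave, since \<open>w\<close> is locally Lipschitz. Solutions of
  the equation compare with parabolas of second derivative \<open>-1\<close> in the distance to a point, which
  gives tug-of-war inequalities between the values of \<open>u\<close> at distances \<open>0\<close>, \<open>r\<close> and \<open>R\<close>. If concavity fails,
  with \<open>W = \<nu> w(y) + \<mu> w(z)\<close> and some \<open>\<theta> > 1\<close> maximize \<open>W^2 - \<theta> u(x)\<close> subject to
  \<open>|x - (\<nu> y + \<mu> z)| \<le> 2 \<epsilon> W\<close>. Because the balls scale with \<open>w\<close>, the inequalities at \<open>y\<close> and \<open>z\<close>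
  average (by convexity of \<open>d^2/b\<close>) to the one that \<open>x\<close> would have for \<open>\<theta> = 1\<close>, up to \<open>O(\<epsilon>^3)\<close>, whereas
  \<open>\<theta> > 1\<close> gains a term of order \<open>\<epsilon>^2\<close>. The maximum stays away from the boundary: if \<open>y\<close> is a
  boundary point, then \<open>\<mu>^2 u(z)\<close>, as a function of \<open>x = \<nu> y + \<mu> z\<close>, is the solution
  in a smaller domain, hence at most \<open>u(x)\<close>.
\<close>


section \<open>Functions of class C2 and local test functions\<close>

text \<open>Carries gradient and Hessian as explicit functions \<open>g\<close> and
  \<open>H\<close>, so that the derivatives of a concrete test function are computed by rules
  instead of being extracted from the descriptions behind \<open>gradient\<close> and
  \<open>hessian\<close>.\<close>

definition has_C2 :: "(real^'n) set \<Rightarrow> (real^'n \<Rightarrow> real) \<Rightarrow> (real^'n \<Rightarrow> real^'n) \<Rightarrow>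
    (real^'n \<Rightarrow> real^'n^'n) \<Rightarrow> bool" where
  "has_C2 S f g H \<longleftrightarrow> (\<forall>x\<in>S. GDERIV f x :> g x \<and> (g has_derivative (\<lambda>h. H x *v h)) (at x)) \<and>
     continuous_on S H"

section \<open>Calculus rules for gradients and Hessians\<close>

lemma gradient_cong:
  fixes f :: "real^'n \<Rightarrow> real"
  assumes "open S" "x \<in> S" "\<And>y. y \<in> S \<Longrightarrow> f y = f' y"
  shows "gradient f x = gradient f' x"
proof -
  have "GDERIV f x :> D \<longleftrightarrow> GDERIV f' x :> D" for D
    unfolding gderiv_def using assms by (metis has_derivative_transform_within_open)
  then have "gderiv f x = gderiv f' x" by (intro ext)
  then show ?thesis unfolding gradient_def by simp
qed

lemma hessian_eqI:
  fixes f :: "real^'n \<Rightarrow> real"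
  assumes S: "open S" "x \<in> S" and g: "\<And>y. y \<in> S \<Longrightarrow> gradient f y = g y"
    and D: "(g has_derivative (\<lambda>h. A *v h)) (at x)"
  shows "hessian f x = A" "(gradient f has_derivative (\<lambda>h. A *v h)) (at x)"
proof -
  show *: "(gradient f has_derivative (\<lambda>h. A *v h)) (at x)"
    using has_derivative_transform_within_open[OF D S] g by simp
  show "hessian f x = A"
    unfolding hessian_def jacobian_def using frechet_derivative_at[OF *]
    by (metis matrix_of_matrix_vector_mul)
qed

lemma has_C2_gradient:
  assumes "has_C2 S f g H" "x \<in> S" shows "gradient f x = g x"
  using assms gradient_eqI unfolding has_C2_def by blast

lemma has_C2_hessian:
  assumes "has_C2 S f g H" "open S" "x \<in> S" shows "hessian f x = H x"
  using assms hessian_eqI(1)[of S x f g "H x"] has_C2_gradient[OF assms(1)]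
  unfolding has_C2_def by blast

lemma has_C2_imp_C2_on:
  assumes f: "has_C2 S f g H" and S: "open S"
  shows "C2_on S f"
proof -
  have d: "(g has_derivative (\<lambda>h. H x *v h)) (at x)" if "x \<in> S" for x
    using f that unfolding has_C2_def by blast
  have "f differentiable (at x)" if "x \<in> S" for x
    using f that unfolding has_C2_def gderiv_def differentiable_def by blast
  moreover have "continuous_on S g"
    using d by (meson S continuous_on_eq_continuous_at has_derivative_continuous)
  then have "continuous_on S (gradient f)"
    by (rule continuous_on_eq) (simp add: has_C2_gradient[OF f])
  moreover have "gradient f differentiable (at x)" if "x \<in> S" for x
    using hessian_eqI(2)[OF S that has_C2_gradient[OF f] d[OF that]] unfolding differentiable_def by blast
  moreover have "continuous_on S H" using f unfolding has_C2_def by blast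
  then have "continuous_on S (hessian f)"
    by (rule continuous_on_eq) (simp add: has_C2_hessian[OF f S])
  ultimately show ?thesis unfolding C2_on_def C1_on_def by blast
qed

lemma C2_on_imp_has_C2:
  assumes "C2_on S f"
  shows "has_C2 S f (gradient f) (hessian f)"
  using assms unfolding has_C2_def C2_on_def C1_on_def
  by (auto intro: GDERIV_gradient simp: hessian_def jacobian_works)

lemma has_C2_subset: "has_C2 S f g H \<Longrightarrow> T \<subseteq> S \<Longrightarrow> has_C2 T f g H"
  unfolding has_C2_def using continuous_on_subset by blast

lemma has_C2_affine: "has_C2 S (\<lambda>y. c + p \<bullet> (y - a)) (\<lambda>y. p) (\<lambda>y. 0)"
  unfolding has_C2_def gderiv_def
  by (auto intro!: derivative_eq_intros simp: inner_commute)

lemma has_C2_sqnorm: "has_C2 S (\<lambda>y. (norm (y - a))\<^sup>2) (\<lambda>y. 2 *\<^sub>R (y - a)) (\<lambda>y. 2 *\<^sub>R mat 1)"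
  unfolding has_C2_def gderiv_def power2_norm_eq_inner
  by (auto intro!: derivative_eq_intros simp: inner_commute simp flip: scaleR_matrix_vector_assoc)
  
lemma has_C2_add:
  assumes "has_C2 S f g H" "has_C2 S f' g' H'"
  shows "has_C2 S (\<lambda>y. f y + f' y) (\<lambda>y. g y + g' y) (\<lambda>y. H y + H' y)"
  using assms unfolding has_C2_def gderiv_def
  by (auto intro!: derivative_eq_intros continuous_on_add simp: inner_add_right matrix_vector_mult_add_rdistrib)

definition outer_prod :: "real^'n \<Rightarrow> real^'n \<Rightarrow> real^'n^'n" where
  "outer_prod p q = (\<chi> i j. p$i * q$j)"

lemma outer_prod_mult: "outer_prod p q *v h = (q \<bullet> h) *\<^sub>R p"
  by (simp add: outer_prod_def matrix_vector_mult_def vec_eq_iff inner_vec_def sum_distrib_left mult_ac)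

text \<open>All nonlinear test functions arise in this way from an affine function or a squared
  distance: cubes of positive parts, squares of linear forms, and radial profiles.\<close>

lemma has_C2_compose:
  fixes \<theta> :: "real \<Rightarrow> real"
  assumes f: "has_C2 S f g H" 
    and 1: "\<And>t. (\<theta> has_real_derivative \<theta>' t) (at t)" and 2: "\<And>t. (\<theta>' has_real_derivative \<theta>'' t) (at t)"
    and c: "continuous_on UNIV \<theta>''"
  shows "has_C2 S (\<lambda>y. \<theta> (f y)) (\<lambda>y. \<theta>' (f y) *\<^sub>R g y)
    (\<lambda>y. \<theta>'' (f y) *\<^sub>R outer_prod (g y) (g y) + \<theta>' (f y) *\<^sub>R H y)"
proof -
  have f1: "(f has_derivative (\<lambda>h. h \<bullet> g x)) (at x)" 
    and g1: "(g has_derivative (\<lambda>h. H x *v h)) (at x)" if "x \<in> S" for x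
    using f that unfolding has_C2_def gderiv_def by auto
  have cf: "continuous_on S f" "continuous_on S g"
    using f1 g1 by (meson continuous_at_imp_continuous_on has_derivative_continuous)+
  have d1: "(\<theta> has_derivative (\<lambda>h. \<theta>' t * h)) (at t)" and d2: "(\<theta>' has_derivative (\<lambda>h. \<theta>'' t * h)) (at t)" for t
    using 1 2 has_field_derivative_imp_has_derivative by blast+
  have a: "((\<lambda>y. \<theta> (f y)) has_derivative (\<lambda>h. \<theta>' (f x) * (h \<bullet> g x))) (at x)" if "x \<in> S" for x
    using has_derivative_compose[OF f1[OF that] d1] .
  have b: "((\<lambda>y. \<theta>' (f y)) has_derivative (\<lambda>h. \<theta>'' (f x) * (h \<bullet> g x))) (at x)" if "x \<in> S" for x
    using has_derivative_compose[OF f1[OF that] d2] .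
  have "((\<lambda>y. \<theta>' (f y) *\<^sub>R g y) has_derivative
     (\<lambda>h. (\<theta>'' (f x) *\<^sub>R outer_prod (g x) (g x) + \<theta>' (f x) *\<^sub>R H x) *v h)) (at x)" if "x \<in> S" for x
    by (rule has_derivative_eq_rhs[OF has_derivative_scaleR[OF b[OF that] g1[OF that]]])
      (auto simp: fun_eq_iff matrix_vector_mult_add_rdistrib outer_prod_mult inner_commute
        simp flip: scaleR_matrix_vector_assoc)
  moreover have "continuous_on UNIV \<theta>'" using 2 by (meson DERIV_isCont continuous_at_imp_continuous_on)
  then have "continuous_on S (\<lambda>y. \<theta>' (f y))" "continuous_on S (\<lambda>y. \<theta>'' (f y))" 
    using cf c by (auto intro: continuous_on_compose2)
  moreover have "continuous_on S H" using f unfolding has_C2_def by blast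
  ultimately show ?thesis using a cf unfolding has_C2_def gderiv_def outer_prod_def
    by (auto intro!: continuous_intros)
qed

lemma has_C2_cmult:
  assumes "has_C2 S f g H"
  shows "has_C2 S (\<lambda>y. c * f y) (\<lambda>y. c *\<^sub>R g y) (\<lambda>y. c *\<^sub>R H y)"
proof -
  have "has_C2 S (\<lambda>y. c * f y) (\<lambda>y. c *\<^sub>R g y) (\<lambda>y. 0 *\<^sub>R outer_prod (g y) (g y) + c *\<^sub>R H y)"
    by (rule has_C2_compose[OF assms]) (auto intro!: derivative_eq_intros)
  then show ?thesis by simp
qed

lemma C2_on_add: "\<lbrakk>open S; C2_on S f; C2_on S g\<rbrakk> \<Longrightarrow> C2_on S (\<lambda>y. f y + g y)"
  by (rule has_C2_imp_C2_on[OF has_C2_add]) (auto dest: C2_on_imp_has_C2)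

lemma C2_on_cmult: "\<lbrakk>open S; C2_on S f\<rbrakk> \<Longrightarrow> C2_on S (\<lambda>y. c * f y)"
  by (rule has_C2_imp_C2_on[OF has_C2_cmult]) (auto dest: C2_on_imp_has_C2)

lemma C2_on_const: "open S \<Longrightarrow> C2_on S (\<lambda>y. c)"
  using has_C2_imp_C2_on[OF has_C2_affine[of S c 0]] by simp

lemma C2_on_sum:
  assumes "open S" "\<And>i. i \<in> I \<Longrightarrow> C2_on S (f i)" 
  shows "C2_on S (\<lambda>y. \<Sum>i\<in>I. f i y)"
  using assms by (induction I rule: infinite_finite_induct) (auto intro: C2_on_const C2_on_add)

text \<open>Meant for locally finite sums, which near each point coincide with a finite sum although
  no single finite sum works on all of \<open>S\<close>.\<close>

lemma C2_on_local:
  assumes "\<And>x. x \<in> S \<Longrightarrow> \<exists>U f'. open U \<and> x \<in> U \<and> C2_on U f' \<and> (\<forall>y\<in>U. f y = f' y)"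
    and "open S"
  shows "C2_on S f"
proof -
  have "GDERIV f x :> gradient f x \<and> (gradient f has_derivative (\<lambda>h. hessian f x *v h)) (at x)
    \<and> isCont (hessian f) x" if x: "x \<in> S" for x
  proof -
    from assms(1)[OF x] obtain U f' where U: "open U" "x \<in> U" and "C2_on U f'" and e: "\<And>y. y \<in> U \<Longrightarrow> f y = f' y" 
      by blast
    then have f': "has_C2 U f' (gradient f') (hessian f')" using C2_on_imp_has_C2 by blast
    have "has_C2 U f (gradient f') (hessian f')"
      unfolding has_C2_def
    proof (intro conjI ballI)
      fix y assume y: "y \<in> U"
      show "GDERIV f y :> gradient f' y" using f' y e U unfolding has_C2_def gderiv_def
        using has_derivative_transform_within_open by (metis (no_types, lifting))
    qed (use f' in \<open>auto simp: has_C2_def\<close>)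
    then have "C2_on U f" using U has_C2_imp_C2_on by blast
    then show ?thesis using C2_on_imp_has_C2 U unfolding has_C2_def 
      by (metis continuous_on_eq_continuous_at)
  qed
  then have "has_C2 S f (gradient f) (hessian f)"
    unfolding has_C2_def using continuous_at_imp_continuous_on by blast
  then show ?thesis using assms(2) has_C2_imp_C2_on by blast
qed

section \<open>Cutoff functions built from cubes of positive parts\<close>

lemma DERIV_max0_power:
  "((\<lambda>t::real. (max 0 t)^(Suc (Suc n))) has_real_derivative real (Suc (Suc n)) * (max 0 t)^(Suc n)) (at t)"
proof -
  consider "t < 0" | "t = 0" | "t > 0" by linarith
  then show ?thesis
  proof cases
    case 1
    have "((\<lambda>t::real. 0) has_real_derivative 0) (at t)" by simp
    then have "((\<lambda>t::real. (max 0 t)^(Suc (Suc n))) has_real_derivative 0) (at t)" 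
      by (rule has_field_derivative_transform_within_open[of _ _ _ "{..<0}"]) (use 1 in auto)
    then show ?thesis using 1 by simp
  next
    case 3
    have "((\<lambda>t::real. t^(Suc (Suc n))) has_real_derivative real (Suc (Suc n)) * t^(Suc n)) (at t)"
      by (rule DERIV_pow[of "Suc (Suc n)", simplified diff_Suc_Suc diff_zero diff_Suc_1])
    then have "((\<lambda>t::real. (max 0 t)^(Suc (Suc n))) has_real_derivative real (Suc (Suc n)) * t^(Suc n)) (at t)" 
      by (rule has_field_derivative_transform_within_open[of _ _ _ "{0<..}"]) (use 3 in auto)
    then show ?thesis using 3 by simp
  next
    case 2
    \<comment> \<open>At 0 the difference quotient is itself a positive power of the positive part,
      hence tends to 0. This is why the exponent starts at 2, and why the cube is twice continuously
      differentiable.\<close>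
    have "((\<lambda>y. (max 0 y)^(Suc n)) \<longlongrightarrow> (max 0 (0::real))^(Suc n)) (at 0)"
      by (intro tendsto_intros)
    moreover have "(max 0 y)^(Suc n) = ((max 0 y)^(Suc (Suc n)) - (max 0 (0::real))^(Suc (Suc n))) / (y - 0)" 
      if "y \<noteq> 0" for y :: real
      using that by (cases "y > 0") (auto simp: max_def)
    ultimately have "((\<lambda>y. ((max 0 y)^(Suc (Suc n)) - (max 0 (0::real))^(Suc (Suc n))) / (y - 0)) \<longlongrightarrow> 0) (at 0)"
      by (auto elim!: Lim_transform_eventually simp: eventually_at_filter)
    then show ?thesis using 2 by (simp add: has_field_derivative_iff)
  qed
qed

lemma C2_on_bump:
  assumes "open S"
  shows "C2_on S (\<lambda>y::real^'n. (max 0 (c - (norm (y - a))\<^sup>2))^3)"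
proof -
  \<comment> \<open>The affine term serves to bring in the constant \<open>c\<close>; its slope
    \<open>p\<close> is set to 0 below.\<close>
  have q: "has_C2 S (\<lambda>y. c + p \<bullet> (y - a) + (-1) * (norm (y - a))\<^sup>2) (\<lambda>y. p + (-1) *\<^sub>R 2 *\<^sub>R (y - a)) 
     (\<lambda>y. 0 + (-1) *\<^sub>R 2 *\<^sub>R mat 1)" for p
    by (intro has_C2_add has_C2_affine has_C2_cmult has_C2_sqnorm)
  have "((\<lambda>t::real. 3 * (max 0 t)^2) has_real_derivative 6 * max 0 t) (at t)" for t
    using DERIV_cmult[OF DERIV_max0_power[of 0 t], of 3] by (simp add: numeral_2_eq_2)
  moreover have "((\<lambda>t::real. (max 0 t)^3) has_real_derivative 3 * (max 0 t)^2) (at t)" for t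
    using DERIV_max0_power[of 1 t] by (simp add: numeral_2_eq_2 numeral_3_eq_3)
  moreover have "continuous_on UNIV (\<lambda>t::real. 6 * max 0 t)"
    by (intro continuous_on_mult continuous_on_max continuous_on_const continuous_on_id)
  ultimately show ?thesis 
    using has_C2_imp_C2_on[OF has_C2_compose[OF q[of 0], of "\<lambda>t. (max 0 t)^3" "\<lambda>t. 3 * (max 0 t)^2" "\<lambda>t. 6 * max 0 t"]] assms
    by auto
qed

text \<open>Finitely many balls that miss \<open>F\<close> cover \<open>T\<close>. The sum of their
  bumps is positive on \<open>T\<close>, so by compactness it has a positive minimum there, and a
  multiple of it exceeds \<open>M\<close>.\<close>

lemma C2_separating_function:
  fixes T :: "(real^'n) set"
  assumes T: "compact T" and F: "closed F" "T \<inter> F = {}"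
  shows "\<exists>\<psi>. (\<forall>S. open S \<longrightarrow> C2_on S \<psi>) \<and> (\<forall>y. \<psi> y \<ge> 0) \<and> (\<forall>y\<in>F. \<psi> y = 0) \<and> (\<forall>y\<in>T. \<psi> y \<ge> M)"
proof (cases "T = {}")
  case True
  then show ?thesis by (intro exI[of _ "\<lambda>y. 0"]) (simp add: C2_on_const)
next
  case False
  have "\<exists>r>0. ball a r \<inter> F = {}" if "a \<in> T" for a
  proof -
    have "a \<in> - F" using F that by blast
    then obtain r where "r > 0" "ball a r \<subseteq> - F"
      using open_contains_ball[of "- F"] F(1) by blast
    then show ?thesis by blast
  qed
  then have "\<forall>a\<in>T. \<exists>r>0. ball a r \<inter> F = {}" by blast
  then obtain r where r: "\<And>a. a \<in> T \<Longrightarrow> r a > 0" "\<And>a. a \<in> T \<Longrightarrow> ball a (r a) \<inter> F = {}" 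
    by (auto dest!: bchoice)
  have "T \<subseteq> (\<Union>a\<in>T. ball a (r a))" using r by force
  then obtain I where I: "I \<subseteq> T" "finite I" "T \<subseteq> (\<Union>a\<in>I. ball a (r a))"
    using compactE_image[OF T, of T "\<lambda>a. ball a (r a)"] by (metis open_ball)
  define \<beta> where "\<beta> a y = (max 0 ((r a)\<^sup>2 - (norm (y - a))\<^sup>2))^3" for a y :: "real^'n"
  define \<sigma> where "\<sigma> y = (\<Sum>a\<in>I. \<beta> a y)" for y
  have C2: "C2_on S \<sigma>" if "open S" for S
    unfolding \<sigma>_def \<beta>_def using that by (intro C2_on_sum C2_on_bump)
  have pos: "\<beta> a y \<ge> 0" for a y by (simp add: \<beta>_def)
  have in_ball: "\<beta> a y > 0 \<longleftrightarrow> y \<in> ball a (r a)" if "a \<in> I" for a y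
  proof -
    have "r a > 0" using r I that by blast
    have "\<beta> a y > 0 \<longleftrightarrow> (norm (y - a))\<^sup>2 < (r a)\<^sup>2" by (auto simp: \<beta>_def max_def)
    also have "\<dots> \<longleftrightarrow> norm (y - a) < r a" using \<open>r a > 0\<close> 
      by (meson less_imp_le norm_ge_zero power2_less_imp_less power_strict_mono pos2)
    finally show ?thesis by (simp add: dist_norm norm_minus_commute)
  qed
  have "\<sigma> y > 0" if yT: "y \<in> T" for y
  proof -
    obtain a where "a \<in> I" "y \<in> ball a (r a)" using I(3) yT by blast
    then show ?thesis unfolding \<sigma>_def using in_ball pos I by (intro sum_pos2) auto
  qed
  moreover have "continuous_on T \<sigma>" unfolding \<sigma>_def \<beta>_def
    by (intro continuous_on_sum continuous_on_power continuous_on_max continuous_intros)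
  ultimately obtain t where t: "t \<in> T" "\<sigma> t > 0" "\<And>y. y \<in> T \<Longrightarrow> \<sigma> t \<le> \<sigma> y"
    using continuous_attains_inf[OF T False] by metis
  have zero: "\<sigma> y = 0" if "y \<in> F" for y
    unfolding \<sigma>_def
  proof (rule sum.neutral, rule ballI)
    fix a assume a: "a \<in> I"
    then have "y \<notin> ball a (r a)" using r(2)[of a] I(1) that by blast
    then show "\<beta> a y = 0" using in_ball[OF a, of y] pos[of a y] by simp
  qed
  \<comment> \<open>Scaling by the absolute value of \<open>M\<close> keeps the function nonnegative
    when \<open>M\<close> is negative.\<close>
  have "\<bar>M\<bar> / \<sigma> t * \<sigma> y \<ge> M" if "y \<in> T" for y
  proof -
    have "\<bar>M\<bar> * \<sigma> t \<le> \<bar>M\<bar> * \<sigma> y" using t(3)[OF that] by (simp add: mult_left_mono)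
    then have "\<bar>M\<bar> \<le> \<bar>M\<bar> / \<sigma> t * \<sigma> y" using t(2) by (simp add: field_simps)
    then show ?thesis by linarith
  qed
  moreover have "\<sigma> y \<ge> 0" for y unfolding \<sigma>_def by (intro sum_nonneg pos)
  ultimately show ?thesis
    using zero C2 t(2) by (intro exI[of _ "\<lambda>y. \<bar>M\<bar> / \<sigma> t * \<sigma> y"]) (auto intro: C2_on_cmult simp del: times_divide_eq_left)
qed

text \<open>\<open>u\<close> may be unbounded near the boundary of \<Omega>. The domain is cut into
  compact shells, on each of which \<open>u\<close> is bounded, and the separating functions of the
  shells are added; each vanishes on the earlier compact sets, so the sum is locally finite.\<close>

lemma C2_dominating_function:
  fixes \<Omega> :: "(real^'n) set"
  assumes \<Omega>: "open \<Omega>" and u: "continuous_on \<Omega> u" and r: "r > 0"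
  shows "\<exists>\<psi>. C2_on \<Omega> \<psi> \<and> (\<forall>y\<in>\<Omega>. \<psi> y \<ge> 0) \<and> (\<forall>y\<in>ball x r. \<psi> y = 0) \<and>
    (\<forall>y\<in>\<Omega> - ball x (2 * r). \<psi> y \<ge> u y)"
proof -
  obtain C where C: "\<And>n. compact (C n)" "\<And>n. C n \<subseteq> \<Omega>" "\<And>n. C n \<subseteq> interior (C (Suc n))" "\<Union>(range C) = \<Omega>"
    using open_Union_compact_subsets[OF \<Omega>] by metis
  \<comment> \<open>Shifting the exhaustion so that \<open>D 0\<close> is empty ensures that the
    least index whose interior contains a given point is a successor.\<close>
  define D where "D n = (case n of 0 \<Rightarrow> {} | Suc m \<Rightarrow> C m)" for n
  have D: "compact (D n)" "D n \<subseteq> \<Omega>" "D n \<subseteq> interior (D (Suc n))" for n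
    using C by (auto simp: D_def split: nat.split)
  have mono: "D m \<subseteq> D n" if "m \<le> n" for m n
  proof (rule lift_Suc_mono_le[of D, OF _ that])
    show "D n \<subseteq> D (Suc n)" for n using D(3)[of n] interior_subset[of "D (Suc n)"] by blast
  qed
  define T where "T n = D (Suc n) - interior (D n) - ball x (2 * r)" for n
  have cT: "compact (T n)" for n unfolding T_def by (intro compact_diff D open_interior open_ball)
  have "\<exists>M. \<forall>y\<in>T n. u y \<le> M" for n
  proof -
    have "T n \<subseteq> \<Omega>" using D(2)[of "Suc n"] unfolding T_def by blast
    then have "compact (u ` T n)" using cT[of n] u compact_continuous_image continuous_on_subset by blast
    then have "bdd_above (u ` T n)" by (intro bounded_imp_bdd_above compact_imp_bounded)
    then show ?thesis unfolding bdd_above_def by blast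
  qed
  then obtain M where M: "\<And>n y. y \<in> T n \<Longrightarrow> u y \<le> M n" by metis
  \<comment> \<open>The set \<open>D (n - 1)\<close> lies in the interior of \<open>D n\<close>,
    which the shell \<open>T n\<close> avoids. For \<open>n = 0\<close> truncated subtraction gives
    \<open>D 0\<close>, the empty set.\<close>
  have "\<exists>\<psi>. (\<forall>S. open S \<longrightarrow> C2_on S \<psi>) \<and> (\<forall>y. \<psi> y \<ge> 0) \<and> (\<forall>y\<in>D (n - 1) \<union> cball x r. \<psi> y = 0) \<and> (\<forall>y\<in>T n. \<psi> y \<ge> M n)" for n
  proof -
    have "y \<notin> D (n - 1)" if "y \<in> T n" for y
      using that D(3)[of "n - 1"] unfolding T_def by (cases n) (auto simp: D_def)
    moreover have "y \<notin> cball x r" if "y \<in> T n" for y using that r unfolding T_def by auto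
    ultimately have "T n \<inter> (D (n - 1) \<union> cball x r) = {}" by blast
    moreover have "closed (D (n - 1) \<union> cball x r)" using D(1) compact_imp_closed by blast
    ultimately show ?thesis using C2_separating_function[OF cT[of n]] by blast
  qed
  then obtain \<psi> where \<psi>: "\<And>n S. open S \<Longrightarrow> C2_on S (\<psi> n)" "\<And>n y. \<psi> n y \<ge> 0" 
    "\<And>n y. y \<in> D (n - 1) \<union> cball x r \<Longrightarrow> \<psi> n y = 0" "\<And>n y. y \<in> T n \<Longrightarrow> \<psi> n y \<ge> M n" by metis
  define \<Psi> where "\<Psi> y = (\<Sum>n. \<psi> n y)" for y
  \<comment> \<open>For \<open>n > m\<close> the set \<open>D m\<close> is contained in
    \<open>D (n - 1)\<close>, where the summand with index \<open>n\<close> vanishes.\<close>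
  have fin: "\<Psi> y = (\<Sum>n\<le>m. \<psi> n y)" if "y \<in> interior (D m)" for m y
    unfolding \<Psi>_def
  proof (rule suminf_finite)
    fix n assume "n \<notin> {..m}"
    then have "D m \<subseteq> D (n - 1)" by (intro mono) auto
    then show "\<psi> n y = 0" using that interior_subset[of "D m"] \<psi>(3)[of y n] by blast
  qed auto
  have ex: "\<exists>m. y \<in> interior (D m)" if y: "y \<in> \<Omega>" for y
  proof -
    obtain m where "y \<in> C m" using y C(4) by blast
    then have "y \<in> D (Suc m)" by (simp add: D_def)
    then show ?thesis using D(3) by blast
  qed
  show ?thesis
  proof (intro exI[of _ \<Psi>] conjI ballI)
    show "C2_on \<Omega> \<Psi>"
    proof (rule C2_on_local[OF _ \<Omega>])
      fix y assume "y \<in> \<Omega>"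
      then obtain m where "y \<in> interior (D m)" using ex by blast
      then show "\<exists>U f'. open U \<and> y \<in> U \<and> C2_on U f' \<and> (\<forall>y\<in>U. \<Psi> y = f' y)"
        using fin[of _ m] C2_on_sum[of "interior (D m)" "{..m}" \<psi>] \<psi>(1) 
        by (intro exI[of _ "interior (D m)"] exI[of _ "\<lambda>y. \<Sum>n\<le>m. \<psi> n y"]) auto
    qed
    show "\<Psi> y \<ge> 0" if "y \<in> \<Omega>" for y
      using ex[OF that] fin \<psi>(2) by (metis sum_nonneg)
    show "\<Psi> y = 0" if "y \<in> ball x r" for y
      using that \<psi>(3) unfolding \<Psi>_def by simp
    show "\<Psi> y \<ge> u y" if y: "y \<in> \<Omega> - ball x (2 * r)" for y
    proof -
      define m where "m = (LEAST m. y \<in> interior (D m))"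
      have m: "y \<in> interior (D m)" unfolding m_def using ex y LeastI_ex by (metis DiffD1)
      then have "m \<noteq> 0" by (auto simp: D_def intro: ccontr)
      then obtain k where k: "m = Suc k" using not0_implies_Suc by blast
      then have "y \<notin> interior (D k)" unfolding m_def using not_less_Least by (metis lessI m_def)
      then have "y \<in> T k" using m y k interior_subset unfolding T_def by blast
      then have "u y \<le> \<psi> k y" using \<psi>(4) M order_trans by blast
      also have "\<dots> \<le> (\<Sum>n\<le>m. \<psi> n y)" by (rule member_le_sum) (use k \<psi>(2) in auto)
      finally show ?thesis using fin[OF m] by simp
    qed
  qed
qed

section \<open>Locality of the viscosity inequalities\<close>

lemma C2_on_subset: "\<lbrakk>C2_on S f; T \<subseteq> S; open T\<rbrakk> \<Longrightarrow> C2_on T f"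
  using has_C2_imp_C2_on has_C2_subset C2_on_imp_has_C2 by blast

lemma infty_laplacian_cong:
  fixes f :: "real^'n \<Rightarrow> real"
  assumes S: "open S" "x \<in> S" and e: "\<And>y. y \<in> S \<Longrightarrow> f y = g y"
    and C2: "C2_on S g"
  shows "infty_laplacian_upper f x = infty_laplacian_upper g x"
    "infty_laplacian_lower f x = infty_laplacian_lower g x"
proof -
  have gr: "gradient f y = gradient g y" if "y \<in> S" for y by (rule gradient_cong[OF S(1) that e])
  then have "hessian f x = hessian g x"
    using hessian_eqI(1)[OF S, of f "gradient g" "hessian g x"] C2_on_imp_has_C2[OF C2] S(2)
    unfolding has_C2_def by blast
  then show "infty_laplacian_upper f x = infty_laplacian_upper g x"
    "infty_laplacian_lower f x = infty_laplacian_lower g x"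
    using gr[OF S(2)] unfolding infty_laplacian_upper_def infty_laplacian_lower_def by simp_all
qed

text \<open>The definition asks for contact from above in the whole domain. Adding a nonnegative
  function that vanishes near \<open>x\<close> and exceeds \<open>u - \<phi>\<close> away from
  \<open>x\<close> makes local contact global without changing any derivative at
  \<open>x\<close>.\<close>

lemma viscosity_sub_local:
  assumes \<Omega>: "open \<Omega>" and u: "viscosity_solution \<Omega> f u" and x: "x \<in> \<Omega>"
    and \<phi>: "C2_on \<Omega> \<phi>" "u x = \<phi> x" and r: "r > 0" "\<And>y. y \<in> ball x r \<inter> \<Omega> \<Longrightarrow> u y \<le> \<phi> y"
  shows "- infty_laplacian_upper \<phi> x \<le> f x (u x)"
proof -
  have "continuous_on \<Omega> (\<lambda>y. u y - \<phi> y)"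
    using u C2_on_imp_has_C2[OF \<phi>(1)] unfolding viscosity_solution_def has_C2_def gderiv_def
    by (intro continuous_on_diff) (auto intro!: continuous_at_imp_continuous_on has_derivative_continuous)
  then obtain \<psi> where \<psi>: "C2_on \<Omega> \<psi>" "\<And>y. y \<in> \<Omega> \<Longrightarrow> \<psi> y \<ge> 0" "\<And>y. y \<in> ball x (r/2) \<Longrightarrow> \<psi> y = 0"
    "\<And>y. y \<in> \<Omega> - ball x (2 * (r/2)) \<Longrightarrow> \<psi> y \<ge> u y - \<phi> y"
    using C2_dominating_function[OF \<Omega> _ half_gt_zero[OF r(1)], of _ x] by blast
  have C: "C2_on \<Omega> (\<lambda>y. \<phi> y + \<psi> y)" using C2_on_add \<Omega> \<phi> \<psi> by blast
  have "u y \<le> \<phi> y + \<psi> y" if "y \<in> \<Omega>" for y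
    using \<psi>(4)[of y] \<psi>(2)[OF that] r(2)[of y] that by (cases "y \<in> ball x r") auto
  moreover have "u x = \<phi> x + \<psi> x" using \<phi>(2) \<psi>(3)[of x] r by simp
  ultimately have "- infty_laplacian_upper (\<lambda>y. \<phi> y + \<psi> y) x \<le> f x (u x)"
    using u x C unfolding viscosity_solution_def touches_from_below_def by blast
  moreover have "infty_laplacian_upper (\<lambda>y. \<phi> y + \<psi> y) x = infty_laplacian_upper \<phi> x"
    by (rule infty_laplacian_cong(1)[of "\<Omega> \<inter> ball x (r/2)"])
     (use \<Omega> x r \<psi>(3) in \<open>auto intro: C2_on_subset[OF \<phi>(1)]\<close>)
  ultimately show ?thesis by simp
qed

text \<open>Mirror image of \<open>viscosity_sub_local\<close>: here the dominating function is
  subtracted.\<close>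

lemma viscosity_super_local:
  assumes \<Omega>: "open \<Omega>" and u: "viscosity_solution \<Omega> f u" and x: "x \<in> \<Omega>"
    and \<phi>: "C2_on \<Omega> \<phi>" "u x = \<phi> x" and r: "r > 0" "\<And>y. y \<in> ball x r \<inter> \<Omega> \<Longrightarrow> \<phi> y \<le> u y"
  shows "- infty_laplacian_lower \<phi> x \<ge> f x (u x)"
proof -
  have "continuous_on \<Omega> (\<lambda>y. \<phi> y - u y)"
    using u C2_on_imp_has_C2[OF \<phi>(1)] unfolding viscosity_solution_def has_C2_def gderiv_def
    by (intro continuous_on_diff) (auto intro!: continuous_at_imp_continuous_on has_derivative_continuous)
  then obtain \<psi> where \<psi>: "C2_on \<Omega> \<psi>" "\<And>y. y \<in> \<Omega> \<Longrightarrow> \<psi> y \<ge> 0" "\<And>y. y \<in> ball x (r/2) \<Longrightarrow> \<psi> y = 0"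
    "\<And>y. y \<in> \<Omega> - ball x (2 * (r/2)) \<Longrightarrow> \<psi> y \<ge> \<phi> y - u y"
    using C2_dominating_function[OF \<Omega> _ half_gt_zero[OF r(1)], of _ x] by blast
  have C: "C2_on \<Omega> (\<lambda>y. \<phi> y + (-1) * \<psi> y)" using C2_on_add C2_on_cmult \<Omega> \<phi> \<psi> by blast
  have "\<phi> y + (-1) * \<psi> y \<le> u y" if "y \<in> \<Omega>" for y
    using \<psi>(4)[of y] \<psi>(2)[OF that] r(2)[of y] that by (cases "y \<in> ball x r") auto
  moreover have "\<phi> x + (-1) * \<psi> x = u x" using \<phi>(2) \<psi>(3)[of x] r by simp
  ultimately have "- infty_laplacian_lower (\<lambda>y. \<phi> y + (-1) * \<psi> y) x \<ge> f x (u x)"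
    using u x C unfolding viscosity_solution_def touches_from_below_def by blast
  moreover have "infty_laplacian_lower (\<lambda>y. \<phi> y + (-1) * \<psi> y) x = infty_laplacian_lower \<phi> x"
    by (rule infty_laplacian_cong(2)[of "\<Omega> \<inter> ball x (r/2)"])
     (use \<Omega> x r \<psi>(3) in \<open>auto intro: C2_on_subset[OF \<phi>(1)]\<close>)
  ultimately show ?thesis by simp
qed

section \<open>Locally semiconcave solutions\<close>

lemma convex_on_has_subgradient:
  fixes g :: "'a::euclidean_space \<Rightarrow> real"
  assumes g: "convex_on S g" and S: "open S" and x: "x \<in> S"
  shows "\<exists>p. \<forall>y\<in>S. g y \<ge> g x + p \<bullet> (y - x)"
proof -
  \<comment> \<open>The subgradient is the slope of a hyperplane separating the epigraph from the
    open vertical ray below the point \<open>(x, g x)\<close>.\<close>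
  define T where "T = {x} \<times> {..<g x}"
  have "convex (epigraph S g)" using g convex_epigraph convex_on_imp_convex by blast
  moreover have "convex T" unfolding T_def by (intro convex_Times) auto
  moreover have "epigraph S g \<noteq> {}" using x unfolding epigraph_def by force
  moreover have "T \<noteq> {}" unfolding T_def by (auto intro: lt_ex)
  moreover have "epigraph S g \<inter> T = {}" unfolding T_def epigraph_def by auto
  ultimately obtain a b where a: "a \<noteq> 0" "\<And>z. z \<in> epigraph S g \<Longrightarrow> a \<bullet> z \<le> b" "\<And>z. z \<in> T \<Longrightarrow> a \<bullet> z \<ge> b"
    using separating_hyperplane_sets[of "epigraph S g" T] by blast
  obtain p \<tau> where p: "a = (p, \<tau>)" by (cases a)
  have up: "p \<bullet> y + \<tau> * t \<le> b" if "y \<in> S" "t \<ge> g y" for y t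
    using a(2)[of "(y, t)"] that by (simp add: p epigraph_def)
  have lo: "p \<bullet> x + \<tau> * t \<ge> b" if "t < g x" for t
    using a(3)[of "(x, t)"] that by (simp add: p T_def)
  have "\<tau> \<le> 0" using up[OF x, of "g x + 1"] lo[of "g x - 1"] by (simp add: algebra_simps)
  \<comment> \<open>A vertical hyperplane would give
    \<open>p \<bullet> y \<le> p \<bullet> x\<close> on all of \<open>S\<close>; a small step from
    the interior point \<open>x\<close> in direction \<open>p\<close> violates this.\<close>
  moreover have "\<tau> \<noteq> 0"
  proof
    assume \<tau>: "\<tau> = 0"
    obtain e where e: "e > 0" "ball x e \<subseteq> S" using S x openE by blast
    have "p \<noteq> 0" using a(1) p \<tau> by (auto simp: zero_prod_def)
    define y where "y = x + (e / 2 / norm p) *\<^sub>R p"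
    have "y \<in> S" using e \<open>p \<noteq> 0\<close> by (auto simp: y_def dist_norm intro!: subsetD[OF e(2)])
    then have "p \<bullet> y \<le> p \<bullet> x" using up[of y "g y"] lo[of "g x - 1"] \<tau> by simp
    then have "e / 2 / norm p * (p \<bullet> p) \<le> 0" by (simp add: y_def inner_add_right)
    moreover have "e / 2 / norm p * (p \<bullet> p) > 0" using e(1) \<open>p \<noteq> 0\<close> by simp
    ultimately show False by linarith
  qed
  ultimately have \<tau>: "\<tau> < 0" by simp
  have "g y \<ge> g x + ((1 / (-\<tau>)) *\<^sub>R p) \<bullet> (y - x)" if y: "y \<in> S" for y
  proof -
    have "p \<bullet> y + \<tau> * g y \<le> p \<bullet> x + \<tau> * g x"
    proof (rule ccontr)
      assume "\<not> ?thesis"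
      then obtain t where t: "t > 0" "p \<bullet> y + \<tau> * g y > p \<bullet> x + \<tau> * g x + t" 
        using field_le_epsilon[of "p \<bullet> y + \<tau> * g y" "p \<bullet> x + \<tau> * g x"] by force
      \<comment> \<open>Only heights strictly below \<open>g x\<close> belong to the ray. Going down
        by \<open>t / (-\<tau>)\<close> raises the separating functional by exactly the slack
        \<open>t\<close>.\<close>
      have "b \<le> p \<bullet> x + \<tau> * (g x - t / (-\<tau>))" using t \<tau> by (intro lo) (auto simp: divide_pos_neg)
      also have "\<dots> = p \<bullet> x + \<tau> * g x + t" using \<tau> by (simp add: field_simps)
      finally show False using up[OF y order_refl] t by linarith
    qed
    then have "p \<bullet> (y - x) \<le> (-\<tau>) * (g y - g x)" by (simp add: algebra_simps)
    then have "p \<bullet> (y - x) / (-\<tau>) \<le> g y - g x" using \<tau> by (subst pos_divide_le_eq) (auto simp: algebra_simps)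
    then show ?thesis by simp
  qed
  then show ?thesis by blast
qed

text \<open>A quantitative version of the superdifferential: the quadratic inequality holds on all
  of \<open>B\<close> with one constant. It therefore survives limits in \<open>x\<close> and
  directly yields test functions.\<close>

definition superdiff :: "real \<Rightarrow> (real^'n) set \<Rightarrow> (real^'n \<Rightarrow> real) \<Rightarrow> real^'n \<Rightarrow> (real^'n) set" where
  "superdiff C B u x = {p. \<forall>y\<in>B. u y \<le> u x + p \<bullet> (y - x) + C / 2 * (norm (y - x))\<^sup>2}"

text \<open>Semiconcavity with constant \<open>C\<close> means that
  \<open>C / 2 * (norm y)^2 - u y\<close> is convex along segments. If \<open>p\<close> is a
  subgradient of this function at \<open>x\<close>, then \<open>C *\<^sub>R x - p\<close> is in the
  superdifferential.\<close>

lemma semiconcave_superdiff_nonempty: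
  fixes u :: "real^'n \<Rightarrow> real"
  assumes u: "semiconcave_on C B u" and B: "open B" "convex B" and x: "x \<in> B"
  shows "superdiff C B u x \<noteq> {}"
proof -
  define g where "g y = C / 2 * (norm y)\<^sup>2 - u y" for y
  have "convex_on B g"
  proof (rule convex_onI[OF _ B(2)])
    fix t :: real and y z assume t: "0 < t" "t < 1" and yz: "y \<in> B" "z \<in> B"
    have "closed_segment z y \<subseteq> B" using yz B(2) closed_segment_subset by blast
    then have "u (t *\<^sub>R z + (1 - t) *\<^sub>R y) \<ge> t * u z + (1 - t) * u y - C * (t * (1 - t) / 2) * (norm (z - y))\<^sup>2"
      using u t unfolding semiconcave_on_def by simp
    moreover have "(norm ((1 - t) *\<^sub>R y + t *\<^sub>R z))\<^sup>2 = (1 - t) * (norm y)\<^sup>2 + t * (norm z)\<^sup>2 - t * (1 - t) * (norm (z - y))\<^sup>2"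
      unfolding power2_norm_eq_inner by (simp add: algebra_simps inner_commute)
    moreover define v where "v = (1 - t) *\<^sub>R y + t *\<^sub>R z"
    ultimately have lo: "u v \<ge> t * u z + (1 - t) * u y - C * (t * (1 - t) / 2) * (norm (z - y))\<^sup>2"
      and v: "(norm v)\<^sup>2 = (1 - t) * (norm y)\<^sup>2 + t * (norm z)\<^sup>2 - t * (1 - t) * (norm (z - y))\<^sup>2"
      by (simp_all add: add.commute)
    \<comment> \<open>Here \<open>a\<close>, \<open>b\<close>, \<open>c\<close> stand for the
      squared norms of \<open>y\<close>, \<open>z\<close>, \<open>z - y\<close>, and
      \<open>w\<close>, \<open>w1\<close>, \<open>w2\<close> for the values of \<open>u\<close> at
      \<open>v\<close>, \<open>y\<close>, \<open>z\<close>. The semiconcavity error cancels the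
      convexity defect of the squared norm.\<close>
    have "C / 2 * ((1 - t) * a + t * b - t * (1 - t) * c) - w
      = (1 - t) * (C / 2 * a - w1) + t * (C / 2 * b - w2) + (t * w2 + (1 - t) * w1 - C * (t * (1 - t) / 2) * c - w)"
      for a b c w w1 w2 :: real by (simp add: field_simps)
    then have "g v = (1 - t) * g y + t * g z + 
        (t * u z + (1 - t) * u y - C * (t * (1 - t) / 2) * (norm (z - y))\<^sup>2 - u v)"
      unfolding g_def v .
    then have "g v \<le> (1 - t) * g y + t * g z" using lo by linarith
    then show "g ((1 - t) *\<^sub>R y + t *\<^sub>R z) \<le> (1 - t) * g y + t * g z" unfolding v_def .
  qed
  from convex_on_has_subgradient[OF this B(1) x]
  obtain p where p: "\<And>y. y \<in> B \<Longrightarrow> g y \<ge> g x + p \<bullet> (y - x)" by blast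
  have "C *\<^sub>R x - p \<in> superdiff C B u x"
    unfolding superdiff_def
  proof (intro CollectI ballI)
    fix y assume "y \<in> B"
    moreover have "C / 2 * (norm y)\<^sup>2 - C / 2 * (norm x)\<^sup>2 = C / 2 * (norm (y - x))\<^sup>2 + C * (x \<bullet> (y - x))"
      unfolding power2_norm_eq_inner by (simp add: algebra_simps inner_commute)
    ultimately show "u y \<le> u x + (C *\<^sub>R x - p) \<bullet> (y - x) + C / 2 * (norm (y - x))\<^sup>2"
      using p[of y] unfolding g_def by (simp add: inner_diff_left)
  qed
  then show ?thesis by blast
qed

text \<open>The inequality at \<open>x\<close> bounds \<open>u y\<close> from above with slope
  \<open>G x\<close>; the one at \<open>y\<close>, read at \<open>x\<close>, bounds
  \<open>u y\<close> from below with slope \<open>G y\<close>. Continuity of \<open>G\<close> at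
  \<open>x\<close> makes the two bounds agree to first order.\<close>

lemma superdiff_selection_differentiable:
  fixes u :: "real^'n \<Rightarrow> real"
  assumes B: "open B" and x: "x \<in> B" and G: "\<And>y. y \<in> B \<Longrightarrow> G y \<in> superdiff C B u y" and c: "isCont G x"
  shows "GDERIV u x :> G x"
  unfolding gderiv_def has_derivative_at_alt
proof (intro conjI allI impI bounded_linear_inner_left)
  fix e :: real assume e: "e > 0"
  obtain r where r: "r > 0" "ball x r \<subseteq> B" using B x openE by blast
  obtain d where d: "d > 0" "\<And>y. norm (y - x) < d \<Longrightarrow> norm (G y - G x) < e / 2"
    using c e unfolding continuous_at_eps_delta by (metis dist_norm half_gt_zero)
  define d' where "d' = min r (min d (e / (\<bar>C\<bar> + 1)))"
  have "d' > 0" using r d e by (simp add: d'_def)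
  moreover have "norm (u y - u x - (y - x) \<bullet> G x) \<le> e * norm (y - x)" if y: "norm (y - x) < d'" for y
  proof -
    have yB: "y \<in> B" using y r by (auto simp: d'_def dist_norm norm_minus_commute)
    have n: "\<bar>C\<bar> / 2 * (norm (y - x))\<^sup>2 \<le> e / 2 * norm (y - x)"
    proof -
      have "norm (y - x) \<le> e / (\<bar>C\<bar> + 1)" using y by (simp add: d'_def)
      then have "(\<bar>C\<bar> + 1) * norm (y - x) \<le> e" by (simp add: field_simps)
      then have "\<bar>C\<bar> * norm (y - x) \<le> e" by (simp add: algebra_simps) (use norm_ge_zero[of "y - x"] in linarith)
      then have "\<bar>C\<bar> * norm (y - x) * norm (y - x) \<le> e * norm (y - x)" by (simp add: mult_right_mono)
      then show ?thesis by (simp add: power2_eq_square)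
    qed
    have C: "C / 2 * (norm (y - x))\<^sup>2 \<le> \<bar>C\<bar> / 2 * (norm (y - x))\<^sup>2" by (simp add: mult_right_mono)
    have "u y \<le> u x + G x \<bullet> (y - x) + C / 2 * (norm (y - x))\<^sup>2"
      using G[OF x] yB unfolding superdiff_def by blast
    moreover have "u x \<le> u y + G y \<bullet> (x - y) + C / 2 * (norm (x - y))\<^sup>2"
      using G[OF yB] x unfolding superdiff_def by blast
    moreover have "\<bar>(G y - G x) \<bullet> (y - x)\<bar> \<le> e / 2 * norm (y - x)"
    proof -
      have "\<bar>(G y - G x) \<bullet> (y - x)\<bar> \<le> norm (G y - G x) * norm (y - x)" by (rule Cauchy_Schwarz_ineq2)
      also have "\<dots> \<le> e / 2 * norm (y - x)" using d(2)[of y] y by (intro mult_right_mono) (auto simp: d'_def)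
      finally show ?thesis .
    qed
    moreover have "G y \<bullet> (x - y) = - (G y \<bullet> (y - x))" "(G y - G x) \<bullet> (y - x) = G y \<bullet> (y - x) - G x \<bullet> (y - x)"
      by (simp_all add: inner_diff_left inner_diff_right)
    moreover have "norm (x - y) = norm (y - x)" "(y - x) \<bullet> G x = G x \<bullet> (y - x)"
      by (rule norm_minus_commute, rule inner_commute)
    ultimately have "\<bar>u y - u x - (y - x) \<bullet> G x\<bar> \<le> e / 2 * norm (y - x) + e / 2 * norm (y - x)" using n C
      by (smt (verit))
    then show ?thesis by simp
  qed
  ultimately show "\<exists>d>0. \<forall>y. norm (y - x) < d \<longrightarrow> norm (u y - u x - (y - x) \<bullet> G x) \<le> e * norm (y - x)" by blast
qed

text \<open>The defining inequality is evaluated at distance \<open>d\<close> from \<open>x\<close>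
  in the direction opposite to \<open>p\<close>, where its linear term is
  \<open>- d * norm p\<close>.\<close>

lemma superdiff_bound:
  assumes p: "p \<in> superdiff C B u x" and d: "d > 0" "cball x d \<subseteq> B" and M: "\<And>y. y \<in> cball x d \<Longrightarrow> \<bar>u y\<bar> \<le> M"
  shows "norm p \<le> 2 * M / d + \<bar>C\<bar> * d / 2"
proof (cases "p = 0")
  case True
  have "M \<ge> 0" using M[of x] d(1) by (smt (verit) centre_in_cball)
  then show ?thesis using True d by simp
next
  case False
  define y where "y = x - (d / norm p) *\<^sub>R p"
  have y: "y \<in> cball x d" using d False by (simp add: y_def dist_norm)
  then have "u y \<le> u x + p \<bullet> (y - x) + C / 2 * (norm (y - x))\<^sup>2"
    using p d unfolding superdiff_def by blast
  moreover have "p \<bullet> (y - x) = - d * norm p" using False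
    by (simp add: y_def dot_square_norm power2_eq_square)
  moreover have "norm (y - x) = d" using False d by (simp add: y_def)
  moreover have "C / 2 * d\<^sup>2 \<le> \<bar>C\<bar> / 2 * d\<^sup>2" by (simp add: mult_right_mono)
  moreover have "x \<in> cball x d" using d by simp
  ultimately have "d * norm p \<le> 2 * M + \<bar>C\<bar> / 2 * d\<^sup>2" using M[OF y] M[of x] by (simp add: abs_le_iff)
  then show ?thesis using d by (simp add: field_simps power2_eq_square)
qed

text \<open>The selection \<open>G\<close> is bounded on smaller closed balls, and its graph is
  closed because limits of supergradients are supergradients and these are unique. A map with closed
  graph into a compact set is continuous.\<close>

lemma unique_superdiff_imp_C1_on:
  fixes u :: "real^'n \<Rightarrow> real"
  assumes u: "continuous_on (ball x0 r) u"
    and ex: "\<And>x. x \<in> ball x0 r \<Longrightarrow> superdiff C (ball x0 r) u x \<noteq> {}"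
    and uniq: "\<And>x p q. \<lbrakk>x \<in> ball x0 r; p \<in> superdiff C (ball x0 r) u x; q \<in> superdiff C (ball x0 r) u x\<rbrakk> \<Longrightarrow> p = q"
  shows "C1_on (ball x0 r) u"
proof -
  define B where "B = ball x0 r"
  define G where "G x = (SOME p. p \<in> superdiff C B u x)" for x
  have G: "G x \<in> superdiff C B u x" if "x \<in> B" for x
    unfolding G_def using ex[of x] that by (simp add: B_def some_in_eq)
  have cont: "continuous_on (cball x0 s) G" if s: "0 < s" "s < r" for s
  proof -
    \<comment> \<open>Half of the remaining gap: balls of radius \<open>d\<close> around points of
      \<open>cball x0 s\<close> stay in one compact ball, on which \<open>u\<close> is
      bounded.\<close>
    define d where "d = (r - s) / 2"
    have d: "d > 0" using s by (simp add: d_def)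
    have sub: "cball x d \<subseteq> cball x0 ((r + s) / 2)" if "x \<in> cball x0 s" for x
    proof
      fix y assume "y \<in> cball x d"
      then have "dist x0 y \<le> s + d" using that dist_triangle[of x0 y x] by simp
      then show "y \<in> cball x0 ((r + s) / 2)" by (simp add: d_def field_simps)
    qed
    have subB: "cball x0 ((r + s) / 2) \<subseteq> B" using s by (auto simp: B_def)
    then have "compact (u ` cball x0 ((r + s) / 2))" using u
      by (intro compact_continuous_image) (auto simp: B_def intro: continuous_on_subset)
    then obtain M where "\<forall>v\<in>u ` cball x0 ((r + s) / 2). norm v \<le> M" 
      using compact_imp_bounded bounded_iff by blast
    then have M: "\<bar>u y\<bar> \<le> M" if "y \<in> cball x0 ((r + s) / 2)" for y using that by auto
    have sB: "cball x0 s \<subseteq> B" using s by (auto simp: B_def)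
    define N where "N = 2 * M / d + \<bar>C\<bar> * d / 2"
    have "norm (G x) \<le> N" if "x \<in> cball x0 s" for x
      unfolding N_def
    proof (rule superdiff_bound[OF G d])
      show "x \<in> B" using that sB by blast
      show "cball x d \<subseteq> B" using sub[OF that] subB by blast
      show "\<bar>u y\<bar> \<le> M" if "y \<in> cball x d" for y using sub[OF \<open>x \<in> cball x0 s\<close>] that M by blast
    qed
    then have "G \<in> cball x0 s \<rightarrow> cball 0 N" by simp
    moreover have "closed ((\<lambda>x. (x, G x)) ` cball x0 s)"
      unfolding closed_sequential_limits
    proof (intro allI impI, elim conjE)
      fix z :: "nat \<Rightarrow> _" and l assume z: "\<forall>n. z n \<in> (\<lambda>x. (x, G x)) ` cball x0 s" and l: "z \<longlonglongrightarrow> l"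
      obtain x p where xp: "l = (x, p)" by (cases l)
      define a where "a n = fst (z n)" for n
      have a: "a n \<in> cball x0 s \<and> z n = (a n, G (a n))" for n
      proof -
        obtain w where "w \<in> cball x0 s" "z n = (w, G w)" using z by blast
        then show ?thesis by (simp add: a_def)
      qed
      then have "a = (\<lambda>n. fst (z n))" "(\<lambda>n. G (a n)) = (\<lambda>n. snd (z n))" by (auto simp: fun_eq_iff)
      then have lim: "a \<longlonglongrightarrow> x" "(\<lambda>n. G (a n)) \<longlonglongrightarrow> p" 
        using tendsto_fst[OF l] tendsto_snd[OF l] xp by simp_all
      have x: "x \<in> cball x0 s" using closed_sequentially[OF closed_cball _ lim(1)] a by blast
      have "isCont u x" using u x sB by (metis B_def continuous_on_eq_continuous_at open_ball subsetD)
      then have ul: "(\<lambda>n. u (a n)) \<longlonglongrightarrow> u x" using lim(1) isCont_tendsto_compose by blast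
      have "u y \<le> u x + p \<bullet> (y - x) + C / 2 * (norm (y - x))\<^sup>2" if "y \<in> B" for y
      proof (rule LIMSEQ_le_const)
        show "(\<lambda>n. u (a n) + G (a n) \<bullet> (y - a n) + C / 2 * (norm (y - a n))\<^sup>2) \<longlonglongrightarrow>
           u x + p \<bullet> (y - x) + C / 2 * (norm (y - x))\<^sup>2" by (intro tendsto_intros ul lim)
        show "\<exists>N. \<forall>n\<ge>N. u y \<le> u (a n) + G (a n) \<bullet> (y - a n) + C / 2 * (norm (y - a n))\<^sup>2"
          using G a sB that unfolding superdiff_def by blast
      qed
      then have "p \<in> superdiff C B u x" unfolding superdiff_def by blast
      then have "p = G x" using uniq[of x p "G x"] G[of x] x sB unfolding B_def by blast
      then show "l \<in> (\<lambda>x. (x, G x)) ` cball x0 s" using x xp by blast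
    qed
    ultimately show ?thesis using continuous_from_closed_graph compact_cball by blast
  qed
  have iC: "isCont G x" if "x \<in> B" for x
  proof -
    have "dist x0 x < r" using that by (simp add: B_def)
    then obtain s where s: "dist x0 x < s" "s < r" using dense by blast
    then have "0 < s" using zero_le_dist[of x0 x] by linarith
    then have "continuous_on (ball x0 s) G" using cont[of s] s by (auto intro: continuous_on_subset)
    moreover have "x \<in> ball x0 s" using s by simp
    ultimately show ?thesis using continuous_on_eq_continuous_at open_ball by blast
  qed
  have D: "GDERIV u x :> G x" if "x \<in> B" for x
    using superdiff_selection_differentiable[of B x G C u] G that iC by (simp add: B_def)
  have "continuous_on B G" using iC continuous_at_imp_continuous_on by blast
  then have "continuous_on B (gradient u)" by (rule continuous_on_eq) (simp add: gradient_eqI[OF D])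
  moreover have "u differentiable (at x)" if "x \<in> B" for x
    using D[OF that] unfolding gderiv_def differentiable_def by blast
  ultimately show ?thesis unfolding C1_on_def B_def by blast
qed

section \<open>Supergradients of solutions are unique; proof of (a)\<close>

lemma viscosity_superdiff_unique:
  fixes \<Omega> :: "(real^'n) set"
  assumes \<Omega>: "open \<Omega>" and u: "viscosity_solution \<Omega> f u" and B: "B \<subseteq> \<Omega>" "open B" "x \<in> B"
    and p0: "p0 \<in> superdiff C B u x" and p1: "p1 \<in> superdiff C B u x"
  shows "p0 = p1"
proof (rule ccontr)
  assume ne: "p0 \<noteq> p1"
  define q where "q = p1 - p0"
  have q: "q \<bullet> q > 0" using ne by (simp add: q_def)
  \<comment> \<open>Since \<open>q \<bullet> q > 0\<close>, the product vanishes for at most one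
    \<theta>, so one of 1/2 and 1/3 will do.\<close>
  obtain \<theta> :: real where \<theta>: "0 < \<theta>" "\<theta> < 1" "(p0 + \<theta> *\<^sub>R q) \<bullet> q \<noteq> 0"
  proof (cases "(p0 + (1/2) *\<^sub>R q) \<bullet> q = 0")
    case True
    then have "p0 \<bullet> q + 1/2 * (q \<bullet> q) = 0" by (simp add: inner_add_left)
    then have "p0 \<bullet> q + 1/3 * (q \<bullet> q) \<noteq> 0" using q by linarith
    then have "(p0 + (1/3) *\<^sub>R q) \<bullet> q \<noteq> 0" by (simp add: inner_add_left)
    then show ?thesis using that[of "1/3"] by simp
  qed (use that[of "1/2"] in simp)
  define p where "p = p0 + \<theta> *\<^sub>R q"
  have p: "p \<noteq> 0" "q \<bullet> p \<noteq> 0" using \<theta> by (auto simp: p_def inner_commute)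
  \<comment> \<open>With \<open>t = q \<bullet> (y - x)\<close>, the linear terms of
    \<open>p0\<close> and \<open>p1\<close> exceed that of \<open>p\<close> by
    \<open>- \<theta> * t\<close> and \<open>(1 - \<theta>) * t\<close>. The smaller of these is at
    most \<open>- m * \<bar>t\<bar>\<close>, hence at most \<open>- R * t^2\<close> as long as
    \<open>\<bar>t\<bar> \<le> m / R\<close>.\<close>
  define m where "m = min \<theta> (1 - \<theta>)"
  have m: "m > 0" using \<theta> by (simp add: m_def)
  define k where "k = (q \<bullet> p)\<^sup>2 / (norm p)\<^sup>2"
  have k: "k > 0" using p by (simp add: k_def)
  \<comment> \<open>The subtracted square contributes \<open>- 2 * R * k\<close> to the second
    derivative along the nonzero gradient \<open>p\<close>. This \<open>R\<close> makes
    \<open>2 * R * k - C\<close> larger than \<open>f x (u x)\<close>.\<close>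
  define R where "R = (\<bar>f x (u x)\<bar> + \<bar>C\<bar> + 1) / (2 * k)"
  have R: "R > 0" using k by (simp add: R_def)
  define \<phi> where "\<phi> y = ((u x + p \<bullet> (y - x)) + (C / 2) * (norm (y - x))\<^sup>2) + (-R) * (0 + q \<bullet> (y - x))\<^sup>2" for y
  define g where "g y = (p + (C/2) *\<^sub>R 2 *\<^sub>R (y - x)) + (-R) *\<^sub>R (2 * (0 + q \<bullet> (y - x))) *\<^sub>R q" for y
  define H :: "real^'n \<Rightarrow> real^'n^'n" where 
    "H y = (0 + (C/2) *\<^sub>R 2 *\<^sub>R mat 1) + (-R) *\<^sub>R (2 *\<^sub>R outer_prod q q + (2 * (0 + q \<bullet> (y - x))) *\<^sub>R 0)" for y
  have sq: "has_C2 \<Omega> (\<lambda>y. (0 + q \<bullet> (y - x))\<^sup>2) (\<lambda>y. (2 * (0 + q \<bullet> (y - x))) *\<^sub>R q) 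
    (\<lambda>y. 2 *\<^sub>R outer_prod q q + (2 * (0 + q \<bullet> (y - x))) *\<^sub>R 0)"
    by (rule has_C2_compose[OF has_C2_affine, of "\<lambda>t. t\<^sup>2" "\<lambda>t. 2 * t" "\<lambda>t. 2"])
      (auto intro!: derivative_eq_intros)
  have C2: "has_C2 \<Omega> \<phi> g H" unfolding \<phi>_def g_def H_def
    by (intro has_C2_add has_C2_cmult has_C2_affine has_C2_sqnorm sq)
  have x: "x \<in> \<Omega>" using B by blast
  have "gradient \<phi> x = p" using has_C2_gradient[OF C2 x] by (simp add: g_def)
  moreover have "hessian \<phi> x = H x" using has_C2_hessian[OF C2 \<Omega> x] .
  moreover have "H x *v p = C *\<^sub>R p - (2 * R * (q \<bullet> p)) *\<^sub>R q"
    by (simp add: H_def matrix_vector_mult_diff_rdistrib matrix_vector_mult_add_rdistrib outer_prod_mult 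
      flip: scaleR_matrix_vector_assoc)
  ultimately have "infty_laplacian_upper \<phi> x = (C * (p \<bullet> p) - 2 * R * (q \<bullet> p) * (q \<bullet> p)) / (norm p)\<^sup>2"
    using p unfolding infty_laplacian_upper_def by (simp add: inner_diff_left)
  also have "\<dots> = C - 2 * R * k" using p(1)
    by (simp add: k_def dot_square_norm power2_eq_square field_simps)
  also have "2 * R * k = \<bar>f x (u x)\<bar> + \<bar>C\<bar> + 1" using k by (simp add: R_def)
  finally have L: "- infty_laplacian_upper \<phi> x > f x (u x)" by linarith
  obtain e where e: "e > 0" "ball x e \<subseteq> B" using B openE by blast
  define r where "r = min e (m / (R * norm q))"
  have nq: "norm q > 0" using ne by (simp add: q_def)
  have r: "r > 0" using e m R nq by (simp add: r_def)
  have "u y \<le> \<phi> y" if y: "y \<in> ball x r \<inter> \<Omega>" for y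
  proof -
    define t where "t = q \<bullet> (y - x)"
    have yr: "norm (y - x) < r" using y by (simp add: dist_norm norm_minus_commute)
    then have "norm (y - x) < m / (R * norm q)" by (simp add: r_def)
    then have "norm q * norm (y - x) \<le> m / R" using R nq by (simp add: field_simps)
    then have t: "\<bar>t\<bar> \<le> m / R" using Cauchy_Schwarz_ineq2[of q "y - x"] unfolding t_def by linarith
    have "R * t\<^sup>2 \<le> m * \<bar>t\<bar>"
    proof -
      have "R * \<bar>t\<bar> * \<bar>t\<bar> \<le> m * \<bar>t\<bar>" using t R by (intro mult_right_mono) (auto simp: field_simps)
      then show ?thesis by (simp add: power2_eq_square mult.assoc)
    qed
    moreover have "m * \<bar>t\<bar> \<le> \<theta> * \<bar>t\<bar>" "m * \<bar>t\<bar> \<le> (1 - \<theta>) * \<bar>t\<bar>" 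
      by (intro mult_right_mono; simp add: m_def)+
    moreover have "y \<in> B" using yr e by (auto simp: r_def dist_norm norm_minus_commute)
    then have "u y \<le> u x + p0 \<bullet> (y - x) + C / 2 * (norm (y - x))\<^sup>2" "u y \<le> u x + p1 \<bullet> (y - x) + C / 2 * (norm (y - x))\<^sup>2"
      using p0 p1 unfolding superdiff_def by blast+
    moreover have "p0 \<bullet> (y - x) = p \<bullet> (y - x) - \<theta> * t" "p1 \<bullet> (y - x) = p \<bullet> (y - x) + (1 - \<theta>) * t"
      by (simp_all add: p_def q_def t_def algebra_simps)
    \<comment> \<open>For \<open>t \<ge> 0\<close> the supergradient \<open>p0\<close> gives the
      better bound, for \<open>t < 0\<close> the supergradient \<open>p1\<close>.\<close>
    moreover have "R * t\<^sup>2 \<le> \<theta> * t \<or> R * t\<^sup>2 \<le> - ((1 - \<theta>) * t)"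
    proof (cases "t \<ge> 0")
      case True
      then have "R * t\<^sup>2 \<le> \<theta> * t" using order_trans[OF calculation(1,2)] by simp
      then show ?thesis ..
    next
      case False
      then have "R * t\<^sup>2 \<le> - ((1 - \<theta>) * t)" using order_trans[OF calculation(1,3)] by simp
      then show ?thesis ..
    qed
    ultimately show ?thesis unfolding \<phi>_def t_def[symmetric] by auto
  qed
  then have "- infty_laplacian_upper \<phi> x \<le> f x (u x)"
    by (intro viscosity_sub_local[OF \<Omega> u x has_C2_imp_C2_on[OF C2 \<Omega>] _ r]) (auto simp: \<phi>_def)
  then show False using L by simp
qed

text \<open>On a small closed ball a single semiconcavity constant is available, and being of class
  C1 is a local property.\<close>

lemma locally_semiconcave_viscosity_C1:
  fixes \<Omega> :: "(real^'n) set"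
  assumes \<Omega>: "open \<Omega>" and u: "viscosity_solution \<Omega> f u" and sc: "locally_semiconcave_on \<Omega> u"
  shows "C1_on \<Omega> u"
proof -
  have "\<exists>r>0. C1_on (ball x r) u" if x: "x \<in> \<Omega>" for x
  proof -
    obtain r where r: "r > 0" "cball x r \<subseteq> \<Omega>" using \<Omega> x open_contains_cball by blast
    then obtain C where "semiconcave_on C (cball x r) u" 
      using sc compact_cball unfolding locally_semiconcave_on_def by blast
    then have C: "semiconcave_on C (ball x r) u" unfolding semiconcave_on_def
      using ball_subset_cball by blast
    have B: "ball x r \<subseteq> \<Omega>" using r by auto
    have "C1_on (ball x r) u"
    proof (rule unique_superdiff_imp_C1_on[where C = C])
      show "continuous_on (ball x r) u" using u B unfolding viscosity_solution_def
        by (auto intro: continuous_on_subset)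
    qed (use semiconcave_superdiff_nonempty[OF C] viscosity_superdiff_unique[OF \<Omega> u B] in auto)
    then show ?thesis using r by blast
  qed
  note loc = this
  have "u differentiable (at x) \<and> isCont (gradient u) x" if x: "x \<in> \<Omega>" for x
  proof -
    obtain r where "r > 0" "C1_on (ball x r) u" using loc[OF x] by blast
    then show ?thesis unfolding C1_on_def
      by (metis centre_in_ball continuous_on_eq_continuous_at open_ball)
  qed
  then show ?thesis unfolding C1_on_def using continuous_at_imp_continuous_on by blast
qed

section \<open>Comparison with radial parabolas\<close>

text \<open>The cubic is the Taylor polynomial of \<open>sqrt (1 + x)\<close> at 0. Its error
  contains the exact factor \<open>(\<sigma> - 1)^4\<close>, which also divides \<open>x^4\<close>,
  so the bound holds for every \<sigma> \<ge> 0 and not only near 1; at \<sigma> = 0 it is an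
  equality.\<close>

lemma sqrt_taylor_bound:
  fixes \<sigma> :: real
  assumes "\<sigma> \<ge> 0"
  defines "x \<equiv> \<sigma>\<^sup>2 - 1"
  shows "\<bar>\<sigma> - (1 + x / 2 - x\<^sup>2 / 8 + x^3 / 16)\<bar> \<le> 5 / 16 * x^4"
proof -
  have 1: "(1 + x / 2 - x\<^sup>2 / 8 + x^3 / 16) - \<sigma> = (\<sigma> - 1)^4 * (\<sigma>\<^sup>2 + 4 * \<sigma> + 5) / 16"
    unfolding x_def by (simp add: field_simps eval_nat_numeral)
  have "5 * x^4 = (\<sigma> - 1)^4 * (5 * (\<sigma> + 1)^4)"
    unfolding x_def by (simp add: algebra_simps eval_nat_numeral)
  moreover have "\<sigma>\<^sup>2 + 4 * \<sigma> + 5 \<le> 5 * (\<sigma> + 1)^4"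
  proof -
    have "5 * (\<sigma> + 1)^4 - (\<sigma>\<^sup>2 + 4 * \<sigma> + 5) = 5 * \<sigma>^4 + 20 * \<sigma>^3 + 29 * \<sigma>\<^sup>2 + 16 * \<sigma>"
      by (simp add: algebra_simps eval_nat_numeral)
    then show ?thesis using assms(1) by (smt (verit) zero_le_power mult_nonneg_nonneg)
  qed
  then have "(\<sigma> - 1)^4 * (\<sigma>\<^sup>2 + 4 * \<sigma> + 5) \<le> (\<sigma> - 1)^4 * (5 * (\<sigma> + 1)^4)"
    by (rule mult_left_mono) simp
  ultimately have "(\<sigma> - 1)^4 * (\<sigma>\<^sup>2 + 4 * \<sigma> + 5) / 16 \<le> 5 / 16 * x^4"
    by linarith
  moreover have "(\<sigma> - 1)^4 * (\<sigma>\<^sup>2 + 4 * \<sigma> + 5) / 16 \<ge> 0" using assms(1) by simp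
  ultimately show ?thesis using 1 by linarith
qed

text \<open>The Taylor polynomial of the square root turns a radial profile
  \<open>a * |w - z| - \<kappa>/2 * |w - z|^2\<close> into a test function that is a polynomial in \<open>|w - z|^2\<close>,
  hence \<open>C^2\<close> also at the centre; the quartic term decides on which side it stays.\<close>

lemma radial_test_function:
  fixes y z :: "real^'n" and a \<kappa> k :: real
  assumes "open \<Omega>" "y \<in> \<Omega>" and s: "norm (y - z) = s" "s > 0" and k: "\<bar>k\<bar> = 5 / 16 * \<bar>a\<bar>"
  shows "\<exists>\<phi>. C2_on \<Omega> \<phi> \<and> \<phi> y = a * s - \<kappa> / 2 * s\<^sup>2 \<and>
    (k \<ge> 0 \<longrightarrow> (\<forall>w. \<phi> w \<ge> a * norm (w - z) - \<kappa> / 2 * (norm (w - z))\<^sup>2)) \<and>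
    (k \<le> 0 \<longrightarrow> (\<forall>w. \<phi> w \<le> a * norm (w - z) - \<kappa> / 2 * (norm (w - z))\<^sup>2)) \<and>
    gradient \<phi> y = ((a - \<kappa> * s) / s) *\<^sub>R (y - z) \<and>
    (\<forall>w. hessian \<phi> y *v w = (- (a / s^3) * ((y - z) \<bullet> w)) *\<^sub>R (y - z) + (a / s - \<kappa>) *\<^sub>R w)"
proof -
  \<comment> \<open>\<open>X\<close> is the relative deviation of the squared distance
    \<open>t\<close> from \<open>s^2\<close>. The term with \<open>(X t)^4\<close> has vanishing
    first and second derivatives at \<open>t = s^2\<close>, so it controls the side of contact
    without affecting gradient or Hessian at \<open>y\<close>.\<close>
  define X where "X t = t / s\<^sup>2 - 1" for t
  define \<theta> where "\<theta> t = s * (a * (1 + X t / 2 - (X t)\<^sup>2 / 8 + (X t)^3 / 16) + k * (X t)^4) - \<kappa> / 2 * t" for t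
  define \<theta>' where "\<theta>' t = (1 / s) * (a * (1 / 2 - X t / 4 + 3 * (X t)\<^sup>2 / 16) + 4 * k * (X t)^3) - \<kappa> / 2" for t
  define \<theta>'' where "\<theta>'' t = (1 / s^3) * (a * (- 1 / 4 + 3 * X t / 8) + 12 * k * (X t)\<^sup>2)" for t
  have dX: "(X has_real_derivative 1 / s\<^sup>2) (at t)" for t
    unfolding X_def using s(2) by (auto intro!: derivative_eq_intros simp: field_simps eval_nat_numeral)
  have 1: "(\<theta> has_real_derivative \<theta>' t) (at t)" for t
    unfolding \<theta>_def \<theta>'_def using s(2)
    by (auto intro!: derivative_eq_intros dX simp: field_simps power2_eq_square power3_eq_cube)
  have 2: "(\<theta>' has_real_derivative \<theta>'' t) (at t)" for t
    unfolding \<theta>'_def \<theta>''_def using s(2)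
    by (auto intro!: derivative_eq_intros dX simp: field_simps power2_eq_square power3_eq_cube)
  have c: "continuous_on UNIV \<theta>''" unfolding \<theta>''_def X_def using s(2) by (intro continuous_intros) auto
  define \<phi> where "\<phi> w = \<theta> ((norm (w - z))\<^sup>2)" for w
  define H where "H w = \<theta>'' ((norm (w - z))\<^sup>2) *\<^sub>R outer_prod (2 *\<^sub>R (w - z)) (2 *\<^sub>R (w - z)) + \<theta>' ((norm (w - z))\<^sup>2) *\<^sub>R 2 *\<^sub>R mat 1" for w
  have C2: "has_C2 \<Omega> \<phi> (\<lambda>w. \<theta>' ((norm (w - z))\<^sup>2) *\<^sub>R 2 *\<^sub>R (w - z)) H"
    unfolding \<phi>_def H_def by (rule has_C2_compose[OF has_C2_sqnorm 1 2 c])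
  have X0: "X (s\<^sup>2) = 0" using s(2) by (simp add: X_def)
  have th: "\<theta>' (s\<^sup>2) = (a / s - \<kappa>) / 2" "\<theta>'' (s\<^sup>2) = - (a / s^3) / 4"
    by (simp_all add: \<theta>'_def \<theta>''_def X0 diff_divide_distrib)
  have close: "\<bar>a * norm (w - z) - (s * a * (1 + x / 2 - x\<^sup>2 / 8 + x^3 / 16))\<bar> \<le> s * \<bar>k\<bar> * x^4"
    if "x = X ((norm (w - z))\<^sup>2)" for w x
  proof -
    define \<sigma> where "\<sigma> = norm (w - z) / s"
    have x: "x = \<sigma>\<^sup>2 - 1" by (simp add: \<sigma>_def X_def that power_divide)
    have "\<bar>\<sigma> - (1 + x / 2 - x\<^sup>2 / 8 + x^3 / 16)\<bar> \<le> 5 / 16 * x^4"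
      unfolding x by (rule sqrt_taylor_bound) (use s(2) in \<open>simp add: \<sigma>_def\<close>)
    then have "\<bar>s * a\<bar> * \<bar>\<sigma> - (1 + x / 2 - x\<^sup>2 / 8 + x^3 / 16)\<bar> \<le> \<bar>s * a\<bar> * (5 / 16 * x^4)" 
      by (rule mult_left_mono) simp
    moreover have "a * norm (w - z) - s * a * (1 + x / 2 - x\<^sup>2 / 8 + x^3 / 16) = 
        (s * a) * (\<sigma> - (1 + x / 2 - x\<^sup>2 / 8 + x^3 / 16))" 
      using s(2) by (simp add: \<sigma>_def right_diff_distrib)
    moreover have "\<bar>s * a\<bar> * (5 / 16 * x^4) = s * \<bar>k\<bar> * x^4" using s(2) by (simp add: k abs_mult)
    ultimately show ?thesis by (simp only: abs_mult)
  qed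
  have sk: "\<phi> w - (a * norm (w - z) - \<kappa> / 2 * (norm (w - z))\<^sup>2) =
      s * k * x^4 - (a * norm (w - z) - (s * a * (1 + x / 2 - x\<^sup>2 / 8 + x^3 / 16)))"
    if "x = X ((norm (w - z))\<^sup>2)" for w x
    unfolding \<phi>_def \<theta>_def that[symmetric] by (simp add: algebra_simps)
  have hi: "\<phi> w \<ge> a * norm (w - z) - \<kappa> / 2 * (norm (w - z))\<^sup>2" if "k \<ge> 0" for w
    using sk[OF refl, of w] close[OF refl, of w] that by simp
  have lo: "\<phi> w \<le> a * norm (w - z) - \<kappa> / 2 * (norm (w - z))\<^sup>2" if "k \<le> 0" for w
    using sk[OF refl, of w] close[OF refl, of w] that by simp
  have "\<phi> y = a * s - \<kappa> / 2 * s\<^sup>2" by (simp add: \<phi>_def \<theta>_def s X0)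
  moreover have "gradient \<phi> y = ((a - \<kappa> * s) / s) *\<^sub>R (y - z)"
  proof -
    have "\<theta>' (s\<^sup>2) * 2 = (a - \<kappa> * s) / s" using th(1) s(2) by (simp add: diff_divide_distrib)
    then show ?thesis using has_C2_gradient[OF C2 assms(2)] by (simp add: s(1))
  qed
  moreover have "hessian \<phi> y *v w = (- (a / s^3) * ((y - z) \<bullet> w)) *\<^sub>R (y - z) + (a / s - \<kappa>) *\<^sub>R w" for w
    unfolding has_C2_hessian[OF C2 assms(1,2)] H_def s(1) th
    by (simp add: matrix_vector_mult_add_rdistrib matrix_vector_mult_diff_rdistrib outer_prod_mult diff_divide_distrib
      flip: scaleR_matrix_vector_assoc)
  ultimately show ?thesis using has_C2_imp_C2_on[OF C2 assms(1)] hi lo by blast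
qed

text \<open>At \<open>y\<close> the Hessian of the test function has \<open>y - z\<close> as an
  eigenvector with eigenvalue \<open>- \<kappa>\<close>, the second derivative of the profile. The
  assumption \<open>a \<noteq> \<kappa> * s\<close> says that the profile has nonzero slope there,
  so the gradient is a nonzero multiple of \<open>y - z\<close>.\<close>

lemma radial_touching_above:
  fixes y z :: "real^'n"
  assumes \<Omega>: "open \<Omega>" and u: "viscosity_solution \<Omega> f u" and y: "y \<in> \<Omega>"
    and s: "norm (y - z) = s" "s > 0" and a: "a \<noteq> \<kappa> * s" and r: "r > 0"
    and le: "\<And>w. w \<in> ball y r \<Longrightarrow> u w - (a * norm (w - z) - \<kappa> / 2 * (norm (w - z))\<^sup>2) \<le> u y - (a * s - \<kappa> / 2 * s\<^sup>2)"
  shows "\<kappa> \<le> f y (u y)"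
proof -
  obtain \<phi> where \<phi>: "C2_on \<Omega> \<phi>" "\<phi> y = a * s - \<kappa> / 2 * s\<^sup>2"
    "\<And>w. \<phi> w \<ge> a * norm (w - z) - \<kappa> / 2 * (norm (w - z))\<^sup>2"
    "gradient \<phi> y = ((a - \<kappa> * s) / s) *\<^sub>R (y - z)"
    "\<And>w. hessian \<phi> y *v w = (- (a / s^3) * ((y - z) \<bullet> w)) *\<^sub>R (y - z) + (a / s - \<kappa>) *\<^sub>R w"
    using radial_test_function[OF \<Omega> y s, of "5 / 16 * \<bar>a\<bar>" a \<kappa>] by auto
  define \<psi> where "\<psi> w = (u y - (a * s - \<kappa> / 2 * s\<^sup>2)) + \<phi> w" for w
  have c: "has_C2 \<Omega> \<psi> (\<lambda>w. 0 + gradient \<phi> w) (\<lambda>w. 0 + hessian \<phi> w)"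
    unfolding \<psi>_def using has_C2_add[OF has_C2_affine[of \<Omega> _ 0 0] C2_on_imp_has_C2[OF \<phi>(1)]] by simp
  have g: "gradient \<psi> y = gradient \<phi> y" "hessian \<psi> y = hessian \<phi> y"
    using has_C2_gradient[OF c y] has_C2_hessian[OF c \<Omega> y] by simp_all
  have yz: "y - z \<noteq> 0" using s by auto
  define v where "v = y - z"
  have v: "v \<bullet> v = s\<^sup>2" using s by (simp add: v_def dot_square_norm)
  have gn: "gradient \<phi> y \<noteq> 0" using a s(2) yz unfolding \<phi>(4) by auto
  have "hessian \<phi> y *v v = (- (a / s^3) * s\<^sup>2) *\<^sub>R v + (a / s - \<kappa>) *\<^sub>R v"
    unfolding \<phi>(5) v_def[symmetric] v ..
  also have "\<dots> = (- \<kappa>) *\<^sub>R v" using s(2) by (simp add: power2_eq_square power3_eq_cube scaleR_diff_left)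
  finally have "hessian \<phi> y *v gradient \<phi> y = (- \<kappa>) *\<^sub>R gradient \<phi> y"
    unfolding \<phi>(4) v_def[symmetric] by (simp add: matrix_vector_mult_scaleR)
  then have "- infty_laplacian_upper \<psi> y = \<kappa>"
    using gn unfolding infty_laplacian_upper_def g by (simp add: dot_square_norm)
  moreover have "- infty_laplacian_upper \<psi> y \<le> f y (u y)"
  proof (rule viscosity_sub_local[OF \<Omega> u y has_C2_imp_C2_on[OF c \<Omega>] _ r])
    show "u y = \<psi> y" using \<phi>(2) by (simp add: \<psi>_def)
    show "u w \<le> \<psi> w" if "w \<in> ball y r \<inter> \<Omega>" for w
      using le[of w] \<phi>(3)[of w] that unfolding \<psi>_def by auto
  qed
  ultimately show ?thesis by simp
qed

text \<open>For nonzero slope this is the computation of \<open>radial_touching_above\<close>. If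
  the slope vanishes, the Hessian has rank one with eigenvalues among \<open>- \<kappa>\<close> and
  0, and \<kappa> > 0 bounds its smallest eigenvalue from below by
  \<open>- \<kappa>\<close>.\<close>

lemma radial_touching_below:
  fixes y z :: "real^'n"
  assumes \<Omega>: "open \<Omega>" and u: "viscosity_solution \<Omega> f u" and y: "y \<in> \<Omega>"
    and s: "norm (y - z) = s" "s > 0" and \<kappa>: "\<kappa> > 0" and r: "r > 0"
    and le: "\<And>w. w \<in> ball y r \<Longrightarrow> u w - (a * norm (w - z) - \<kappa> / 2 * (norm (w - z))\<^sup>2) \<ge> u y - (a * s - \<kappa> / 2 * s\<^sup>2)"
  shows "\<kappa> \<ge> f y (u y)"
proof -
  obtain \<phi> where \<phi>: "C2_on \<Omega> \<phi>" "\<phi> y = a * s - \<kappa> / 2 * s\<^sup>2"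
    "\<And>w. \<phi> w \<le> a * norm (w - z) - \<kappa> / 2 * (norm (w - z))\<^sup>2"
    "gradient \<phi> y = ((a - \<kappa> * s) / s) *\<^sub>R (y - z)"
    "\<And>w. hessian \<phi> y *v w = (- (a / s^3) * ((y - z) \<bullet> w)) *\<^sub>R (y - z) + (a / s - \<kappa>) *\<^sub>R w"
    using radial_test_function[OF \<Omega> y s, of "- (5 / 16 * \<bar>a\<bar>)" a \<kappa>] by auto
  define \<psi> where "\<psi> w = (u y - (a * s - \<kappa> / 2 * s\<^sup>2)) + \<phi> w" for w
  have c: "has_C2 \<Omega> \<psi> (\<lambda>w. 0 + gradient \<phi> w) (\<lambda>w. 0 + hessian \<phi> w)"
    unfolding \<psi>_def using has_C2_add[OF has_C2_affine[of \<Omega> _ 0 0] C2_on_imp_has_C2[OF \<phi>(1)]] by simp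
  have g: "gradient \<psi> y = gradient \<phi> y" "hessian \<psi> y = hessian \<phi> y"
    using has_C2_gradient[OF c y] has_C2_hessian[OF c \<Omega> y] by simp_all
  define v where "v = y - z"
  have v: "v \<bullet> v = s\<^sup>2" "v \<noteq> 0" using s by (auto simp: v_def dot_square_norm)
  have "hessian \<phi> y *v v = (- (a / s^3) * s\<^sup>2) *\<^sub>R v + (a / s - \<kappa>) *\<^sub>R v"
    unfolding \<phi>(5) v_def[symmetric] v ..
  also have "\<dots> = (- \<kappa>) *\<^sub>R v" using s(2) by (simp add: power2_eq_square power3_eq_cube scaleR_diff_left)
  finally have Hv: "hessian \<phi> y *v v = (- \<kappa>) *\<^sub>R v" .
  have "- infty_laplacian_lower \<psi> y \<le> \<kappa>"
  proof (cases "gradient \<phi> y = 0")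
    case False
    have "hessian \<phi> y *v gradient \<phi> y = (- \<kappa>) *\<^sub>R gradient \<phi> y"
      using Hv unfolding \<phi>(4) v_def[symmetric] by (simp add: matrix_vector_mult_scaleR)
    then show ?thesis using False unfolding infty_laplacian_lower_def g by (simp add: dot_square_norm)
  next
    case True
    then have "a = \<kappa> * s" using v(2) s(2) unfolding \<phi>(4) v_def by simp
    then have H: "hessian \<phi> y *v w = (- (\<kappa> / s\<^sup>2) * (v \<bullet> w)) *\<^sub>R v" for w
      using s(2) unfolding \<phi>(5) v_def by (simp add: power2_eq_square power3_eq_cube)
    have "l = - \<kappa> \<or> l = 0" if ev: "l \<in> eigenvalues (hessian \<phi> y)" for l
    proof (rule ccontr)
      assume l: "\<not> ?thesis"
      obtain w where w: "w \<noteq> 0" "hessian \<phi> y *v w = l *\<^sub>R w" using ev unfolding eigenvalues_def by blast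
      then have *: "l *\<^sub>R w = (- (\<kappa> / s\<^sup>2) * (v \<bullet> w)) *\<^sub>R v" using H by simp
      then have "l * (v \<bullet> w) = - \<kappa> * (v \<bullet> w)" 
      proof -
        have "v \<bullet> (l *\<^sub>R w) = v \<bullet> ((- (\<kappa> / s\<^sup>2) * (v \<bullet> w)) *\<^sub>R v)" by (simp only: *)
        then show ?thesis using v(1) s(2) by simp
      qed
      then have "(l + \<kappa>) * (v \<bullet> w) = 0" by (simp add: algebra_simps)
      then have "v \<bullet> w = 0" using l by auto
      then show False using * l w(1) by simp
    qed
    then have fin: "eigenvalues (hessian \<phi> y) \<subseteq> {- \<kappa>, 0}" by blast
    then have "finite (eigenvalues (hessian \<phi> y))" using finite_subset by blast
    moreover have "- \<kappa> \<in> eigenvalues (hessian \<phi> y)" using Hv v(2) unfolding eigenvalues_def by blast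
    ultimately have "lambda_min (hessian \<phi> y) \<in> eigenvalues (hessian \<phi> y)"
      unfolding lambda_min_def using Min_in by blast
    then have "lambda_min (hessian \<phi> y) \<ge> - \<kappa>" using fin \<kappa> by auto
    then show ?thesis using True unfolding infty_laplacian_lower_def g by simp
  qed
  moreover have "- infty_laplacian_lower \<psi> y \<ge> f y (u y)"
  proof (rule viscosity_super_local[OF \<Omega> u y has_C2_imp_C2_on[OF c \<Omega>] _ r])
    show "u y = \<psi> y" using \<phi>(2) by (simp add: \<psi>_def)
    show "u w \<ge> \<psi> w" if "w \<in> ball y r \<inter> \<Omega>" for w
      using le[of w] \<phi>(3)[of w] that unfolding \<psi>_def by auto
  qed
  ultimately show ?thesis by simp
qed

text \<open>The right-hand side is the parabola in the distance to \<open>z\<close> with second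
  derivative -1 and values \<open>u z\<close> at 0 and \<open>A\<close> at \<open>R\<close>. If
  \<open>u\<close> exceeded a parabola with second derivative \<open>- \<kappa>\<close>, \<kappa> >
  1, the difference would have a maximum in the open ball away from \<open>z\<close>, which
  \<open>radial_touching_above\<close> forbids; then \<kappa> tends to 1.\<close>

lemma sub_comparison:
  fixes \<Omega> :: "(real^'n) set"
  assumes \<Omega>: "open \<Omega>" and u: "viscosity_solution \<Omega> (\<lambda>x t. 1) u"
    and z: "cball z R \<subseteq> \<Omega>" and A: "\<And>w. w \<in> cball z R \<Longrightarrow> u w \<le> A" and R: "R > 0"
    and s: "norm (y - z) = s" "s \<le> R"
  shows "u y \<le> (1 - s / R) * u z + s / R * A + s * (R - s) / 2"
proof -
  have "u y \<le> u z + s / R * (A - u z) + \<kappa> * (s * (R - s) / 2)" if \<kappa>: "\<kappa> > 1" for \<kappa>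
  proof (rule ccontr)
    assume neg: "\<not> ?thesis"
    \<comment> \<open>The slope at 0 for which \<open>G R = A - u z\<close>.\<close>
    define a where "a = (A - u z) / R + \<kappa> * R / 2"
    define G where "G t = a * t - \<kappa> / 2 * t\<^sup>2" for t
    have G: "u z + G t = u z + t / R * (A - u z) + \<kappa> * (t * (R - t) / 2)" for t
      using R by (simp add: G_def a_def algebra_simps power2_eq_square add_divide_distrib diff_divide_distrib)
    have "continuous_on (cball z R) u" using u z unfolding viscosity_solution_def by (auto intro: continuous_on_subset)
    then have "continuous_on (cball z R) (\<lambda>w. u w - G (norm (w - z)))" unfolding G_def by (intro continuous_intros)
    moreover have "cball z R \<noteq> {}" using R by simp
    ultimately obtain y' where y': "y' \<in> cball z R" "\<And>w. w \<in> cball z R \<Longrightarrow> u w - G (norm (w - z)) \<le> u y' - G (norm (y' - z))"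
      using continuous_attains_sup[OF compact_cball] by blast
    define s0 where "s0 = norm (y' - z)"
    have "u z < u y - G s" using neg G[of s] by simp
    also have "\<dots> \<le> u y' - G s0" using y'(2)[of y] s unfolding s0_def by (simp add: dist_norm norm_minus_commute)
    finally have pos: "u z < u y' - G s0" .
    have "s0 \<noteq> 0" using pos by (auto simp: s0_def G_def)
    then have s0: "s0 > 0" by (simp add: s0_def)
    have "s0 \<le> R" using y'(1) by (simp add: s0_def dist_norm norm_minus_commute)
    have lt: "u z + G s0 < A" using pos A[OF y'(1)] by simp
    then have "s0 \<noteq> R" using G[of R] R by auto
    then have s0R: "s0 < R" using \<open>s0 \<le> R\<close> by simp
    \<comment> \<open>Otherwise \<open>s0\<close> would be the vertex of the concave parabola, whose
      value is at least the value \<open>A\<close> at \<open>R\<close>; but the value at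
      \<open>s0\<close> is below \<open>A\<close>.\<close>
    have "a \<noteq> \<kappa> * s0"
    proof
      assume "a = \<kappa> * s0"
      then have eq: "(A - u z) / R = \<kappa> * s0 - \<kappa> * R / 2" by (simp add: a_def)
      have "u z + G s0 - A = (R - s0) * (\<kappa> * s0 / 2 - (A - u z) / R)"
        using G[of s0] R by (simp add: field_simps)
      also have "\<dots> = (R - s0) * (\<kappa> * (R - s0) / 2)" unfolding eq by (simp add: field_simps)
      also have "\<dots> \<ge> 0" using s0R \<kappa> by simp
      finally show False using lt by simp
    qed
    moreover have "y' \<in> \<Omega>" using y'(1) z by blast
    moreover have "ball y' (R - s0) \<subseteq> cball z R"
    proof
      fix w assume "w \<in> ball y' (R - s0)"
      then show "w \<in> cball z R" using dist_triangle[of z w y'] by (simp add: s0_def dist_norm norm_minus_commute)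
    qed
    then have "u w - G (norm (w - z)) \<le> u y' - G s0" if "w \<in> ball y' (R - s0)" for w
      using y'(2) that unfolding s0_def by blast
    ultimately have "\<kappa> \<le> 1"
      using radial_touching_above[OF \<Omega> u, of y' z s0 a \<kappa> "R - s0"] s0 s0R
      unfolding G_def s0_def[symmetric] by simp
    then show False using \<kappa> by simp
  qed
  note * = this
  define D where "D = s * (R - s) / 2"
  have D: "D \<ge> 0" using s norm_ge_zero[of "y - z"] by (simp add: D_def)
  have "u y \<le> u z + s / R * (A - u z) + D"
  proof (rule field_le_epsilon)
    fix e :: real assume e: "e > 0"
    then have "e * D \<le> e * (D + 1)" by simp
    then have "e / (D + 1) * D \<le> e" using D by (simp add: field_simps)
    moreover have "u y \<le> u z + s / R * (A - u z) + (1 + e / (D + 1)) * D"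
      unfolding D_def[symmetric] using *[of "1 + e / (D + 1)"] e D by (simp add: D_def)
    ultimately show "u y \<le> u z + s / R * (A - u z) + D + e" by (simp add: algebra_simps)
  qed
  then show ?thesis by (simp add: D_def algebra_simps)
qed

text \<open>As for \<open>sub_comparison\<close>, now with 0 < \<kappa> < 1 and an interior minimum
  of the difference. A vertex of the parabola at \<open>s0\<close> is covered by
  \<open>radial_touching_below\<close>.\<close>

lemma super_comparison:
  fixes \<Omega> :: "(real^'n) set"
  assumes \<Omega>: "open \<Omega>" and u: "viscosity_solution \<Omega> (\<lambda>x t. 1) u"
    and z: "cball z R \<subseteq> \<Omega>" and A: "\<And>w. w \<in> cball z R \<Longrightarrow> u w \<ge> A" and R: "R > 0"
    and s: "norm (y - z) = s" "s \<le> R"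
  shows "u y \<ge> (1 - s / R) * u z + s / R * A + s * (R - s) / 2"
proof -
  have "u y \<ge> u z + s / R * (A - u z) + \<kappa> * (s * (R - s) / 2)" if \<kappa>: "0 < \<kappa>" "\<kappa> < 1" for \<kappa>
  proof (rule ccontr)
    assume neg: "\<not> ?thesis"
    define a where "a = (A - u z) / R + \<kappa> * R / 2"
    define G where "G t = a * t - \<kappa> / 2 * t\<^sup>2" for t
    have G: "u z + G t = u z + t / R * (A - u z) + \<kappa> * (t * (R - t) / 2)" for t
      using R by (simp add: G_def a_def algebra_simps power2_eq_square add_divide_distrib diff_divide_distrib)
    have "continuous_on (cball z R) u" using u z unfolding viscosity_solution_def by (auto intro: continuous_on_subset)
    then have "continuous_on (cball z R) (\<lambda>w. u w - G (norm (w - z)))" unfolding G_def by (intro continuous_intros)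
    moreover have "cball z R \<noteq> {}" using R by simp
    ultimately obtain y' where y': "y' \<in> cball z R" "\<And>w. w \<in> cball z R \<Longrightarrow> u w - G (norm (w - z)) \<ge> u y' - G (norm (y' - z))"
      using continuous_attains_inf[OF compact_cball] by blast
    define s0 where "s0 = norm (y' - z)"
    have "u y' - G s0 \<le> u y - G s" using y'(2)[of y] s unfolding s0_def by (simp add: dist_norm norm_minus_commute)
    also have "\<dots> < u z" using neg G[of s] by simp
    finally have pos: "u z > u y' - G s0" .
    have "s0 \<noteq> 0" using pos by (auto simp: s0_def G_def)
    then have s0: "s0 > 0" by (simp add: s0_def)
    have "s0 \<le> R" using y'(1) by (simp add: s0_def dist_norm norm_minus_commute)
    have "u z + G s0 > A" using pos A[OF y'(1)] by simp
    then have "s0 \<noteq> R" using G[of R] R by auto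
    then have s0R: "s0 < R" using \<open>s0 \<le> R\<close> by simp
    have "y' \<in> \<Omega>" using y'(1) z by blast
    moreover have "ball y' (R - s0) \<subseteq> cball z R"
    proof
      fix w assume "w \<in> ball y' (R - s0)"
      then show "w \<in> cball z R" using dist_triangle[of z w y'] by (simp add: s0_def dist_norm norm_minus_commute)
    qed
    then have "u w - G (norm (w - z)) \<ge> u y' - G s0" if "w \<in> ball y' (R - s0)" for w
      using y'(2) that unfolding s0_def by blast
    ultimately have "\<kappa> \<ge> 1"
      using radial_touching_below[OF \<Omega> u, of y' z s0 \<kappa> "R - s0" a] s0 s0R \<kappa>
      unfolding G_def s0_def[symmetric] by simp
    then show False using \<kappa> by simp
  qed
  note * = this
  define D where "D = s * (R - s) / 2"
  have D: "D \<ge> 0" using s norm_ge_zero[of "y - z"] by (simp add: D_def)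
  have "u z + s / R * (A - u z) + D \<le> u y"
  proof (rule field_le_epsilon)
    fix e :: real assume e: "e > 0"
    define k where "k = min (1/2) (e / (D + 1))"
    have k: "0 < k" "k < 1" "k \<le> e / (D + 1)" using e D by (auto simp: k_def)
    have "k * D \<le> e / (D + 1) * D" using k D by (intro mult_right_mono)
    also have "e * D \<le> e * (D + 1)" using e by simp
    then have "e / (D + 1) * D \<le> e" using D by (simp add: field_simps)
    finally have "k * D \<le> e" .
    moreover have "u y \<ge> u z + s / R * (A - u z) + (1 - k) * D"
      using *[of "1 - k"] k by (simp add: D_def)
    ultimately show "u z + s / R * (A - u z) + D \<le> u y + e" by (simp add: algebra_simps)
  qed
  then show ?thesis by (simp add: D_def algebra_simps)
qed

section \<open>Asymptotics of the discrete inequalities\<close>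

text \<open>The value at distance \<open>\<epsilon> * b\<close> of the parabola with second derivative \<open>- \<theta>\<close>
  that equals \<open>q\<^sup>2\<close> at \<open>0\<close> and \<open>p\<^sup>2\<close> at \<open>2 * \<epsilon> * p\<close>.\<close>

abbreviation parabola :: "real \<Rightarrow> real \<Rightarrow> real \<Rightarrow> real \<Rightarrow> real \<Rightarrow> real" where
  "parabola \<theta> \<epsilon> b p q \<equiv>
     (1 - b / (2 * p)) * q\<^sup>2 + b / (2 * p) * p\<^sup>2 + \<theta> * (\<epsilon>\<^sup>2 * b * (2 * p - b) / 2)"

text \<open>Since \<open>Q\<close> is of order \<open>\<epsilon>^2\<close> and
  \<open>T - 2 * b\<close> of order \<epsilon>, replacing the divisor \<open>T\<close> by
  \<open>2 * b\<close> costs only order \<open>\<epsilon>^3\<close>.\<close>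

lemma quotient_expansion:
  fixes X T Q b m \<epsilon> E q c :: real
  assumes m: "m > 0" "b \<ge> m" "T \<ge> m" and T: "\<bar>T - 2 * b\<bar> \<le> c * \<epsilon>" and Q: "\<bar>Q\<bar> \<le> q * \<epsilon>^2"
    and \<epsilon>: "\<epsilon> > 0" and E: "E \<ge> 0" and X: "X * T \<le> Q + E * \<epsilon>^3"
  shows "X \<le> Q / (2 * b) + (E + q * c / (2 * m)) / m * \<epsilon>^3"
proof -
  define F where "F = E + q * c / (2 * m)"
  have q: "q \<ge> 0" using Q \<epsilon> by (smt (verit) zero_le_mult_iff zero_less_power abs_ge_zero)
  have c: "c \<ge> 0" using T \<epsilon> by (smt (verit) zero_le_mult_iff)
  have F: "F \<ge> 0" using E q c m by (simp add: F_def)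
  have "\<bar>Q * (T - 2 * b) / (2 * b)\<bar> = \<bar>Q\<bar> * \<bar>T - 2 * b\<bar> / (2 * b)" using m by (simp add: abs_mult)
  also have "\<dots> \<le> (q * \<epsilon>^2) * (c * \<epsilon>) / (2 * m)"
    using m \<epsilon> q c by (intro frac_le mult_mono Q T) auto
  also have "\<dots> = q * c / (2 * m) * \<epsilon>^3" by (simp add: power2_eq_square power3_eq_cube)
  finally have "\<bar>Q * (T - 2 * b) / (2 * b)\<bar> \<le> q * c / (2 * m) * \<epsilon>^3" .
  moreover have "Q / (2 * b) * T = Q + Q * (T - 2 * b) / (2 * b)" using m by (simp add: field_simps)
  moreover have "F * \<epsilon>^3 = E * \<epsilon>^3 + q * c / (2 * m) * \<epsilon>^3" by (simp add: F_def algebra_simps)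
  ultimately have "X * T \<le> Q / (2 * b) * T + F * \<epsilon>^3" using X by linarith
  also have "F * \<epsilon>^3 = F / m * \<epsilon>^3 * m" using m by simp
  also have "F / m * \<epsilon>^3 * m \<le> F / m * \<epsilon>^3 * T" using m F \<epsilon> by (intro mult_left_mono) auto
  finally have "X * T \<le> (Q / (2 * b) + F / m * \<epsilon>^3) * T" by (simp add: algebra_simps)
  then show ?thesis using m unfolding F_def by simp
qed

text \<open>The numbers \<open>b\<close>, \<open>b + d\<close>, \<open>b - e\<close> will be values
  of \<open>w\<close> at a point, at the maximum on the large ball, and at the centre of that ball.
  The difference \<open>d - e\<close> acts as a second-order quantity, determined by
  \<open>d\<close> and \<open>b\<close> up to order \<open>\<epsilon>^3\<close>.\<close>

lemma sub_expansion:
  fixes b d e \<epsilon> m N C :: real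
  assumes b: "0 < m" "m \<le> b" "b \<le> N" and d: "0 \<le> d" "d \<le> C * \<epsilon>" and e: "0 \<le> e" "e \<le> C * \<epsilon>"
    and \<epsilon>: "0 < \<epsilon>" "C * \<epsilon> \<le> m"
    and h: "b\<^sup>2 \<le> parabola 1 \<epsilon> b (b + d) (b - e)"
  shows "d\<^sup>2 / b - \<epsilon>\<^sup>2 * b / 2 - ((2 * C^3 + 5 * N\<^sup>2 * C) / m + (2 * C\<^sup>2 + N\<^sup>2) * (3 * C) / (2 * m)) / m * \<epsilon>^3 \<le> d - e"
proof -
  define T where "T = 2 * b + 3 * d - e"
  define Q where "Q = 2 * d\<^sup>2 - \<epsilon>\<^sup>2 * b\<^sup>2"
  have C: "C \<ge> 0" using d \<epsilon> by (smt (verit) zero_le_mult_iff)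
  have bd: "b + d > 0" using b d by simp
  \<comment> \<open>After clearing the denominator of the parabola everything carries a factor
    \<open>b\<close>, apart from terms of order \<open>\<epsilon>^3\<close>.\<close>
  have "b\<^sup>2 * (2 * (b + d)) \<le> (parabola 1 \<epsilon> b (b + d) (b - e)) * (2 * (b + d))"
    using h bd by (intro mult_right_mono) auto
  also have "\<dots> = (2 * (b + d) - b) * (b - e)\<^sup>2 + b * (b + d)\<^sup>2 + \<epsilon>\<^sup>2 * b * (2 * (b + d) - b) * (b + d)"
  proof -
    define g where "g = b + d"
    have "g \<noteq> 0" using bd by (simp add: g_def)
    then show ?thesis unfolding g_def[symmetric] by (simp add: field_simps power2_eq_square)
  qed
  finally have "0 \<le> (2 * (b + d) - b) * (b - e)\<^sup>2 + b * (b + d)\<^sup>2 + \<epsilon>\<^sup>2 * b * (2 * (b + d) - b) * (b + d) - b\<^sup>2 * (2 * (b + d))"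
    by simp
  also have "\<dots> = b * ((d - e) * T - Q) + (2 * (d * e\<^sup>2) + 3 * (\<epsilon>\<^sup>2 * b\<^sup>2 * d) + 2 * (\<epsilon>\<^sup>2 * b * d * d))"
    by (simp add: T_def Q_def algebra_simps power2_eq_square)
  finally have *: "0 \<le> b * ((d - e) * T - Q) + (2 * (d * e\<^sup>2) + 3 * (\<epsilon>\<^sup>2 * b\<^sup>2 * d) + 2 * (\<epsilon>\<^sup>2 * b * d * d))" .
  have "d * e\<^sup>2 \<le> (C * \<epsilon>) * (C * \<epsilon>)\<^sup>2" using d e by (intro mult_mono power_mono) auto
  moreover have "\<epsilon>\<^sup>2 * b\<^sup>2 * d \<le> \<epsilon>\<^sup>2 * N\<^sup>2 * (C * \<epsilon>)" using d b \<epsilon> C by (intro mult_mono power_mono) auto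
  moreover have "\<epsilon>\<^sup>2 * b * d * d \<le> \<epsilon>\<^sup>2 * N * N * (C * \<epsilon>)" using d b \<epsilon> C by (intro mult_mono) auto
  ultimately have "2 * (d * e\<^sup>2) + 3 * (\<epsilon>\<^sup>2 * b\<^sup>2 * d) + 2 * (\<epsilon>\<^sup>2 * b * d * d) \<le> (2 * C^3 + 5 * N\<^sup>2 * C) * \<epsilon>^3"
    by (simp add: algebra_simps power2_eq_square power3_eq_cube)
  then have "b * (Q - (d - e) * T) \<le> (2 * C^3 + 5 * N\<^sup>2 * C) * \<epsilon>^3" using * by (simp add: algebra_simps)
  then have "Q - (d - e) * T \<le> (2 * C^3 + 5 * N\<^sup>2 * C) * \<epsilon>^3 / b" using b by (simp add: field_simps)
  also have "\<dots> \<le> (2 * C^3 + 5 * N\<^sup>2 * C) * \<epsilon>^3 / m" using b C \<epsilon> by (intro divide_left_mono) auto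
  finally have XT: "(e - d) * T \<le> - Q + (2 * C^3 + 5 * N\<^sup>2 * C) / m * \<epsilon>^3" by (simp add: algebra_simps)
  have "e - d \<le> (- Q) / (2 * b) + ((2 * C^3 + 5 * N\<^sup>2 * C) / m + (2 * C\<^sup>2 + N\<^sup>2) * (3 * C) / (2 * m)) / m * \<epsilon>^3"
  proof (rule quotient_expansion[OF b(1,2) _ _ _ \<epsilon>(1) _ XT])
    show "m \<le> T" using b d e \<epsilon> by (simp add: T_def)
    show "\<bar>T - 2 * b\<bar> \<le> 3 * C * \<epsilon>" using d e by (simp add: T_def abs_le_iff)
    have "d\<^sup>2 \<le> (C * \<epsilon>)\<^sup>2" "b\<^sup>2 \<le> N\<^sup>2" using d b by (auto intro!: power_mono)
    moreover have "\<epsilon>\<^sup>2 * b\<^sup>2 \<le> \<epsilon>\<^sup>2 * N\<^sup>2" using calculation(2) by (rule mult_left_mono) simp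
    moreover have "d\<^sup>2 \<ge> 0" "\<epsilon>\<^sup>2 * b\<^sup>2 \<ge> 0" "(C * \<epsilon>)\<^sup>2 \<ge> 0" by simp_all
    moreover have "(2 * C\<^sup>2 + N\<^sup>2) * \<epsilon>\<^sup>2 = 2 * (C * \<epsilon>)\<^sup>2 + \<epsilon>\<^sup>2 * N\<^sup>2"
      by (simp add: algebra_simps power_mult_distrib)
    ultimately show "\<bar>- Q\<bar> \<le> (2 * C\<^sup>2 + N\<^sup>2) * \<epsilon>\<^sup>2"
      unfolding Q_def by linarith
    show "0 \<le> (2 * C^3 + 5 * N\<^sup>2 * C) / m" using C b by simp
  qed
  moreover have "Q / (2 * b) = d\<^sup>2 / b - \<epsilon>\<^sup>2 * b / 2" using b by (simp add: Q_def field_simps power2_eq_square)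
  ultimately show ?thesis by simp
qed

text \<open>Here \<open>b + d\<close> belongs to the centre and \<open>b - e\<close> to the outer
  radius. Up to order \<open>\<epsilon>^3\<close> the bound differs from that of
  \<open>sub_expansion\<close> only in its direction and in the factor \<theta>, which is the gain
  to be exploited.\<close>

lemma super_expansion:
  fixes b d e \<epsilon> m N C \<theta> :: real
  assumes b: "0 < m" "m \<le> b" "b \<le> N" and d: "0 \<le> d" "d \<le> C * \<epsilon>" and e: "0 \<le> e" "e \<le> C * \<epsilon>"
    and \<epsilon>: "0 < \<epsilon>" "C * \<epsilon> < m" and \<theta>: "\<theta> \<ge> 0"
    and h: "parabola \<theta> \<epsilon> b (b - e) (b + d) \<le> b\<^sup>2"
  shows "d - e \<le> d\<^sup>2 / b - \<theta> * \<epsilon>\<^sup>2 * b / 2 + ((2 * C^3 + 3 * \<theta> * N\<^sup>2 * C) / m + (2 * C\<^sup>2 + \<theta> * N\<^sup>2) * (3 * C) / (2 * m)) / m * \<epsilon>^3"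
proof -
  define T where "T = 2 * b + 3 * d - e"
  define Q where "Q = 2 * d\<^sup>2 - \<theta> * (\<epsilon>\<^sup>2 * b\<^sup>2)"
  have C: "C \<ge> 0" using d \<epsilon> by (smt (verit) zero_le_mult_iff)
  have be: "b - e > 0" using b e \<epsilon> by simp
  have "(parabola \<theta> \<epsilon> b (b - e) (b + d)) * (2 * (b - e)) \<le> b\<^sup>2 * (2 * (b - e))"
    using h be by (intro mult_right_mono) auto
  moreover have "(parabola \<theta> \<epsilon> b (b - e) (b + d)) * (2 * (b - e))
    = (2 * (b - e) - b) * (b + d)\<^sup>2 + b * (b - e)\<^sup>2 + \<theta> * (\<epsilon>\<^sup>2 * b * (2 * (b - e) - b)) * (b - e)"
  proof -
    define g where "g = b - e"
    have "g \<noteq> 0" using be by (simp add: g_def)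
    then show ?thesis unfolding g_def[symmetric] by (simp add: field_simps power2_eq_square)
  qed
  moreover have "(2 * (b - e) - b) * (b + d)\<^sup>2 + b * (b - e)\<^sup>2 + \<theta> * (\<epsilon>\<^sup>2 * b * (2 * (b - e) - b)) * (b - e) - b\<^sup>2 * (2 * (b - e))
    = b * ((d - e) * T - Q) - (2 * (e * d\<^sup>2) + 3 * (\<theta> * (\<epsilon>\<^sup>2 * b\<^sup>2 * e))) + 2 * (\<theta> * (\<epsilon>\<^sup>2 * b * e\<^sup>2))"
    by (simp add: T_def Q_def algebra_simps power2_eq_square)
  \<comment> \<open>The only remainder that contains \<open>e^2\<close> and \<theta> together has
    the favourable sign and is dropped.\<close>
  moreover have "\<theta> * (\<epsilon>\<^sup>2 * b * e\<^sup>2) \<ge> 0" using \<theta> b by simp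
  ultimately have *: "b * ((d - e) * T - Q) \<le> 2 * (e * d\<^sup>2) + 3 * (\<theta> * (\<epsilon>\<^sup>2 * b\<^sup>2 * e))" by linarith
  have "e * d\<^sup>2 \<le> (C * \<epsilon>) * (C * \<epsilon>)\<^sup>2" using d e by (intro mult_mono power_mono) auto
  moreover have "\<theta> * (\<epsilon>\<^sup>2 * b\<^sup>2 * e) \<le> \<theta> * (\<epsilon>\<^sup>2 * N\<^sup>2 * (C * \<epsilon>))" using e b \<theta> by (intro mult_left_mono mult_mono power_mono) auto
  ultimately have "2 * (e * d\<^sup>2) + 3 * (\<theta> * (\<epsilon>\<^sup>2 * b\<^sup>2 * e)) \<le> (2 * C^3 + 3 * \<theta> * N\<^sup>2 * C) * \<epsilon>^3"
    by (simp add: algebra_simps power2_eq_square power3_eq_cube)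
  then have "b * ((d - e) * T - Q) \<le> (2 * C^3 + 3 * \<theta> * N\<^sup>2 * C) * \<epsilon>^3" using * by simp
  then have "(d - e) * T - Q \<le> (2 * C^3 + 3 * \<theta> * N\<^sup>2 * C) * \<epsilon>^3 / b" using b by (simp add: field_simps)
  also have "\<dots> \<le> (2 * C^3 + 3 * \<theta> * N\<^sup>2 * C) * \<epsilon>^3 / m" using b C \<epsilon> \<theta> by (intro divide_left_mono) auto
  finally have XT: "(d - e) * T \<le> Q + (2 * C^3 + 3 * \<theta> * N\<^sup>2 * C) / m * \<epsilon>^3" by simp
  have "d - e \<le> Q / (2 * b) + ((2 * C^3 + 3 * \<theta> * N\<^sup>2 * C) / m + (2 * C\<^sup>2 + \<theta> * N\<^sup>2) * (3 * C) / (2 * m)) / m * \<epsilon>^3"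
  proof (rule quotient_expansion[OF b(1,2) _ _ _ \<epsilon>(1) _ XT])
    show "m \<le> T" using b d e \<epsilon> by (simp add: T_def)
    show "\<bar>T - 2 * b\<bar> \<le> 3 * C * \<epsilon>" using d e by (simp add: T_def abs_le_iff)
    have "d\<^sup>2 \<le> (C * \<epsilon>)\<^sup>2" "b\<^sup>2 \<le> N\<^sup>2" using d b by (auto intro!: power_mono)
    moreover have "\<theta> * (\<epsilon>\<^sup>2 * b\<^sup>2) \<le> \<theta> * (\<epsilon>\<^sup>2 * N\<^sup>2)" using calculation(2) \<theta> by (intro mult_left_mono) auto
    moreover have "d\<^sup>2 \<ge> 0" "\<theta> * (\<epsilon>\<^sup>2 * b\<^sup>2) \<ge> 0" "(C * \<epsilon>)\<^sup>2 \<ge> 0" using \<theta> by simp_all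
    moreover have "(2 * C\<^sup>2 + \<theta> * N\<^sup>2) * \<epsilon>\<^sup>2 = 2 * (C * \<epsilon>)\<^sup>2 + \<theta> * (\<epsilon>\<^sup>2 * N\<^sup>2)"
      by (simp add: algebra_simps power_mult_distrib)
    ultimately show "\<bar>Q\<bar> \<le> (2 * C\<^sup>2 + \<theta> * N\<^sup>2) * \<epsilon>\<^sup>2"
      unfolding Q_def by linarith
    show "0 \<le> (2 * C^3 + 3 * \<theta> * N\<^sup>2 * C) / m" using C b \<theta> by simp
  qed
  moreover have "Q / (2 * b) = d\<^sup>2 / b - \<theta> * \<epsilon>\<^sup>2 * b / 2" using b by (simp add: Q_def field_simps power2_eq_square)
  ultimately show ?thesis by simp
qed

text \<open>The function \<open>x^2 / p\<close> is the supremum over \<open>t\<close> of the linear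
  functions \<open>2 * t * x - t^2 * p\<close>; the \<open>t\<close> that is optimal for the sums is
  inserted in both summands.\<close>

lemma quadratic_over_linear_convex:
  fixes p q x y :: real
  assumes "p > 0" "q > 0"
  shows "(x + y)\<^sup>2 / (p + q) \<le> x\<^sup>2 / p + y\<^sup>2 / q"
proof -
  have t: "2 * t * x - t\<^sup>2 * p \<le> x\<^sup>2 / p" if "p > 0" for t x p :: real
  proof -
    have "0 \<le> (x - t * p)\<^sup>2 / p" using that by simp
    also have "\<dots> = x\<^sup>2 / p - (2 * t * x - t\<^sup>2 * p)" using that by (simp add: field_simps power2_eq_square)
    finally show ?thesis by simp
  qed
  define t where "t = (x + y) / (p + q)"
  have "x + y = t * (p + q)" using assms by (simp add: t_def)
  then have "(x + y)\<^sup>2 / (p + q) = 2 * t * (x + y) - t\<^sup>2 * (p + q)" using assms by (simp add: power2_eq_square field_simps)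
  then show ?thesis using t[OF assms(1), of t x] t[OF assms(2), of t y] by (simp add: algebra_simps)
qed

text \<open>If the conclusion failed, averaging the two subsolution expansions and comparing with
  the supersolution expansion would bound \<open>(\<theta> - 1) * \<epsilon>^2 * b / 2\<close> by a
  multiple of \<open>\<epsilon>^3\<close>. The threshold is chosen before the values
  \<open>b1\<close>, ..., \<open>e2\<close>, because the points at which they are taken depend on
  \<epsilon>.\<close>

lemma discrete_contradiction:
  fixes m N C \<theta> \<nu> \<mu> :: real
  assumes mN: "m > 0" and \<theta>: "\<theta> > 1" and nm: "\<nu> > 0" "\<mu> > 0" "\<nu> + \<mu> = 1"
  shows "\<exists>\<epsilon>0>0. \<forall>\<epsilon> b1 d1 e1 b2 d2 e2. 0 < \<epsilon> \<and> \<epsilon> < \<epsilon>0 \<and> C * \<epsilon> < m \<longrightarrow>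
     m \<le> b1 \<and> b1 \<le> N \<and> 0 \<le> d1 \<and> d1 \<le> C * \<epsilon> \<and> 0 \<le> e1 \<and> e1 \<le> C * \<epsilon> \<longrightarrow>
     m \<le> b2 \<and> b2 \<le> N \<and> 0 \<le> d2 \<and> d2 \<le> C * \<epsilon> \<and> 0 \<le> e2 \<and> e2 \<le> C * \<epsilon> \<longrightarrow>
     b1\<^sup>2 \<le> parabola 1 \<epsilon> b1 (b1 + d1) (b1 - e1) \<longrightarrow>
     b2\<^sup>2 \<le> parabola 1 \<epsilon> b2 (b2 + d2) (b2 - e2) \<longrightarrow>
     (let b = \<nu> * b1 + \<mu> * b2; d = \<nu> * d1 + \<mu> * d2; e = \<nu> * e1 + \<mu> * e2 in
     b\<^sup>2 < parabola \<theta> \<epsilon> b (b - e) (b + d))"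
proof -
  define K1 where "K1 = ((2 * C^3 + 5 * N\<^sup>2 * C) / m + (2 * C\<^sup>2 + N\<^sup>2) * (3 * C) / (2 * m)) / m"
  define K2 where "K2 = ((2 * C^3 + 3 * \<theta> * N\<^sup>2 * C) / m + (2 * C\<^sup>2 + \<theta> * N\<^sup>2) * (3 * C) / (2 * m)) / m"
  \<comment> \<open>Chosen so that \<open>(\<bar>K1 + K2\<bar> + 1) * \<epsilon>0 = (\<theta> - 1) *
    m / 2\<close>.\<close>
  define \<epsilon>0 where "\<epsilon>0 = (\<theta> - 1) * m / (2 * (\<bar>K1 + K2\<bar> + 1))"
  have \<epsilon>0: "\<epsilon>0 > 0" using \<theta> mN unfolding \<epsilon>0_def by (intro divide_pos_pos mult_pos_pos) auto
  have "b\<^sup>2 < parabola \<theta> \<epsilon> b (b - e) (b + d)"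
    if \<epsilon>: "0 < \<epsilon>" "\<epsilon> < \<epsilon>0" "C * \<epsilon> < m"
      and h1: "m \<le> b1" "b1 \<le> N" "0 \<le> d1" "d1 \<le> C * \<epsilon>" "0 \<le> e1" "e1 \<le> C * \<epsilon>"
      and h2: "m \<le> b2" "b2 \<le> N" "0 \<le> d2" "d2 \<le> C * \<epsilon>" "0 \<le> e2" "e2 \<le> C * \<epsilon>"
      and s1: "b1\<^sup>2 \<le> parabola 1 \<epsilon> b1 (b1 + d1) (b1 - e1)"
      and s2: "b2\<^sup>2 \<le> parabola 1 \<epsilon> b2 (b2 + d2) (b2 - e2)"
      and bde: "b = \<nu> * b1 + \<mu> * b2" "d = \<nu> * d1 + \<mu> * d2" "e = \<nu> * e1 + \<mu> * e2"
    for \<epsilon> b1 d1 e1 b2 d2 e2 b d e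
  proof (rule ccontr)
    assume "\<not> ?thesis"
    then have h: "parabola \<theta> \<epsilon> b (b - e) (b + d) \<le> b\<^sup>2"
      by simp
    have up: "\<nu> * x + \<mu> * y \<le> M" if "x \<le> M" "y \<le> M" for x y M
      using convex_bound_le[OF that, of \<nu> \<mu>] nm by simp
    have lo: "M \<le> \<nu> * x + \<mu> * y" if "M \<le> x" "M \<le> y" for x y M
      using convex_bound_le[of "- x" "- M" "- y" \<nu> \<mu>] that nm by simp
    have b: "m \<le> b" "b \<le> N" and d: "0 \<le> d" "d \<le> C * \<epsilon>" and e: "0 \<le> e" "e \<le> C * \<epsilon>"
      unfolding bde using h1 h2 by (auto intro!: up lo)
    have E1: "d1\<^sup>2 / b1 - \<epsilon>\<^sup>2 * b1 / 2 - K1 * \<epsilon>^3 \<le> d1 - e1"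
      unfolding K1_def by (rule sub_expansion) (use mN h1 s1 \<epsilon> in auto)
    have E2: "d2\<^sup>2 / b2 - \<epsilon>\<^sup>2 * b2 / 2 - K1 * \<epsilon>^3 \<le> d2 - e2"
      unfolding K1_def by (rule sub_expansion) (use mN h2 s2 \<epsilon> in auto)
    have E3: "d - e \<le> d\<^sup>2 / b - \<theta> * \<epsilon>\<^sup>2 * b / 2 + K2 * \<epsilon>^3"
      unfolding K2_def by (rule super_expansion) (use mN b d e \<epsilon> \<theta> h in auto)
    have "(\<nu> * d1 + \<mu> * d2)\<^sup>2 / (\<nu> * b1 + \<mu> * b2) \<le> (\<nu> * d1)\<^sup>2 / (\<nu> * b1) + (\<mu> * d2)\<^sup>2 / (\<mu> * b2)"
      using nm h1 h2 mN by (intro quadratic_over_linear_convex) auto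
    then have "d\<^sup>2 / b \<le> \<nu> * (d1\<^sup>2 / b1) + \<mu> * (d2\<^sup>2 / b2)"
      unfolding bde using nm by (simp add: power2_eq_square mult.left_commute)
    moreover have "\<nu> * (d1\<^sup>2 / b1 - \<epsilon>\<^sup>2 * b1 / 2 - K1 * \<epsilon>^3) + \<mu> * (d2\<^sup>2 / b2 - \<epsilon>\<^sup>2 * b2 / 2 - K1 * \<epsilon>^3) \<le> \<nu> * (d1 - e1) + \<mu> * (d2 - e2)"
      using E1 E2 nm by (intro add_mono mult_left_mono) auto
    moreover have "\<nu> * (d1\<^sup>2 / b1 - \<epsilon>\<^sup>2 * b1 / 2 - K1 * \<epsilon>^3) + \<mu> * (d2\<^sup>2 / b2 - \<epsilon>\<^sup>2 * b2 / 2 - K1 * \<epsilon>^3)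
      = \<nu> * (d1\<^sup>2 / b1) + \<mu> * (d2\<^sup>2 / b2) - \<epsilon>\<^sup>2 * b / 2 - (\<nu> + \<mu>) * (K1 * \<epsilon>^3)"
      unfolding bde by (simp add: algebra_simps add_divide_distrib)
    moreover have "\<nu> * (d1 - e1) + \<mu> * (d2 - e2) = d - e" unfolding bde by (simp add: algebra_simps)
    ultimately have "d\<^sup>2 / b - \<epsilon>\<^sup>2 * b / 2 - K1 * \<epsilon>^3 \<le> d - e" using nm(3) by simp
    then have "\<theta> * \<epsilon>\<^sup>2 * b / 2 - \<epsilon>\<^sup>2 * b / 2 \<le> (K1 + K2) * \<epsilon>^3" using E3 by (simp add: algebra_simps)
    then have "\<epsilon>\<^sup>2 * ((\<theta> - 1) * b / 2) \<le> \<epsilon>\<^sup>2 * ((K1 + K2) * \<epsilon>)"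
      by (simp add: algebra_simps power2_eq_square power3_eq_cube)
    then have "(\<theta> - 1) * b / 2 \<le> (K1 + K2) * \<epsilon>" using \<epsilon> by simp
    also have "\<dots> \<le> (\<bar>K1 + K2\<bar> + 1) * \<epsilon>" using \<epsilon> by (intro mult_right_mono) auto
    also have "\<dots> < (\<bar>K1 + K2\<bar> + 1) * \<epsilon>0" using \<epsilon> by (intro mult_strict_left_mono) auto
    also have "\<dots> = (\<theta> - 1) * m / 2" 
    proof -
      have "k * ((\<theta> - 1) * m / (2 * k)) = (\<theta> - 1) * m / 2" if "k \<noteq> 0" for k using that by simp
      moreover have "\<bar>K1 + K2\<bar> + 1 \<noteq> 0" by linarith
      ultimately show ?thesis unfolding \<epsilon>0_def by blast
    qed
    also have "\<dots> \<le> (\<theta> - 1) * b / 2" using \<theta> b by simp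
    finally show False by simp
  qed
  then show ?thesis using \<epsilon>0 unfolding Let_def by blast
qed

section \<open>The Dirichlet problem in a convex domain\<close>

text \<open>Converts a strict gap into a factor \<theta> > 1 in front of the supersolution, from
  which both contradictions below are drawn.\<close>

lemma exists_factor_greater_one:
  fixes a b :: real
  assumes "a \<ge> 0" "a < b"
  shows "\<exists>\<theta>>1. \<theta> * a < b"
proof (cases "a = 0")
  case False
  then have "a > 0" using assms by simp
  then have "1 < b / a" using assms by simp
  then obtain \<theta> where "1 < \<theta>" "\<theta> < b / a" using dense by blast
  then show ?thesis using \<open>a > 0\<close> by (intro exI[of _ \<theta>]) (simp add: field_simps)
qed (use assms in \<open>auto intro: exI[of _ 2]\<close>)

locale dirichlet_problem =
  fixes \<Omega> :: "(real^'n) set" and u :: "real^'n \<Rightarrow> real"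
  assumes open_domain: "open \<Omega>" and bounded_domain: "bounded \<Omega>" and convex_domain: "convex \<Omega>"
    and solution: "dirichlet_solution \<Omega> u"
begin

section \<open>Positivity, bounds and the local Lipschitz property\<close>

lemma viscosity: "viscosity_solution \<Omega> (\<lambda>x t. 1) u"
  using solution unfolding dirichlet_solution_def by blast

lemma continuous_closure: "continuous_on (closure \<Omega>) u"
  using solution unfolding dirichlet_solution_def by blast

lemma zero_frontier: "x \<in> frontier \<Omega> \<Longrightarrow> u x = 0"
  using solution unfolding dirichlet_solution_def by blast

lemma compact_closure_domain: "compact (closure \<Omega>)"
  using bounded_domain by simp

lemma closure_cases: "x \<in> closure \<Omega> \<Longrightarrow> x \<in> \<Omega> \<or> x \<in> frontier \<Omega>"
  using open_domain by (simp add: frontier_def interior_open)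

text \<open>In \<open>super_comparison\<close> centred at a nearby point \<open>y\<close>, the value
  at \<open>x\<close> exceeds an average of \<open>u y\<close> and the lower bound
  \<open>u x\<close> by a positive quadratic term, while \<open>u y \<ge> u x\<close>.\<close>

lemma no_local_min:
  assumes r: "r > 0" "ball x r \<subseteq> \<Omega>" and min: "\<And>w. w \<in> ball x r \<Longrightarrow> u x \<le> u w"
  shows False
proof -
  \<comment> \<open>With \<open>x\<close> at distance \<open>r / 3\<close> from \<open>y\<close>, it
    lies inside the ball of radius \<open>r / 2\<close> about \<open>y\<close>, and
    \<open>r / 3 + r / 2 < r\<close> keeps that ball in \<open>ball x r\<close>.\<close>
  obtain v :: "real^'n" where v: "norm v = r / 3" using vector_choose_size[of "r / 3"] r by auto
  define y where "y = x + v"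
  have sub: "cball y (r / 2) \<subseteq> ball x r"
  proof
    fix w assume "w \<in> cball y (r / 2)"
    then have "dist x w \<le> r / 3 + r / 2" using dist_triangle[of x w y] v by (simp add: y_def dist_norm)
    then show "w \<in> ball x r" using r by simp
  qed
  have le: "(1 - (r/3) / (r/2)) * u y + (r/3) / (r/2) * u x + r / 3 * (r / 2 - r / 3) / 2 \<le> u x"
    by (rule super_comparison[OF open_domain viscosity]) (use sub r min v in \<open>auto simp: y_def\<close>)
  have "(r/3) / (r/2) = 2/3" using r by simp
  moreover have "u x \<le> u y" using min[of y] sub r by (auto simp: subset_eq)
  moreover define D where "D = r / 3 * (r / 2 - r / 3) / 2"
  moreover have "D > 0" using r by (simp add: D_def)
  moreover have "(1 - 2/3) * u y = u y / 3" by simp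
  ultimately have "u y / 3 + 2/3 * u x + D \<le> u x" using le by (simp only:)
  then show False using \<open>u x \<le> u y\<close> \<open>D > 0\<close> by linarith
qed

text \<open>A minimum strictly inside the ball would be a local minimum. In the doubling arguments
  this fixes the distance of the optimal \<open>x1\<close> and so provides a unit direction.\<close>

lemma constrained_min_on_sphere:
  assumes x1: "x1 \<in> \<Omega>" "norm (x1 - q) \<le> R"
    and min: "\<And>x. \<lbrakk>x \<in> closure \<Omega>; norm (x - q) \<le> R\<rbrakk> \<Longrightarrow> u x1 \<le> u x"
  shows "norm (x1 - q) = R"
proof (rule ccontr)
  assume "\<not> ?thesis"
  then have lt: "norm (x1 - q) < R" using x1 by simp
  obtain r' where r': "r' > 0" "ball x1 r' \<subseteq> \<Omega>" using x1 open_domain openE by blast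
  define r where "r = min r' (R - norm (x1 - q))"
  have "u x1 \<le> u x" if x: "x \<in> ball x1 r" for x
  proof (rule min)
    have "norm (x - q) \<le> norm (x - x1) + norm (x1 - q)" using norm_triangle_ineq[of "x - x1" "x1 - q"] by simp
    then show "norm (x - q) \<le> R" using x by (simp add: r_def dist_norm norm_minus_commute)
    show "x \<in> closure \<Omega>" using x r' closure_subset[of \<Omega>] by (auto simp: r_def)
  qed
  moreover have "r > 0" "ball x1 r \<subseteq> \<Omega>" using r' lt by (auto simp: r_def)
  ultimately show False using no_local_min by blast
qed

lemma nonneg: assumes "x \<in> closure \<Omega>" shows "u x \<ge> 0"
proof -
  have ne: "closure \<Omega> \<noteq> {}" using assms by (metis empty_iff)
  obtain m where m: "m \<in> closure \<Omega>" "\<And>w. w \<in> closure \<Omega> \<Longrightarrow> u m \<le> u w"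
    using continuous_attains_inf[OF compact_closure_domain ne continuous_closure] by blast
  have "m \<notin> \<Omega>"
  proof
    assume "m \<in> \<Omega>"
    then obtain r where "r > 0" "ball m r \<subseteq> \<Omega>" using open_domain openE by blast
    then show False using no_local_min[of r m] m(2) closure_subset[of \<Omega>] by blast
  qed
  then have "u m = 0" using closure_cases[OF m(1)] zero_frontier by blast
  then show ?thesis using m(2)[OF assms] by simp
qed

lemma pos: assumes "x \<in> \<Omega>" shows "u x > 0"
proof (rule ccontr)
  assume "\<not> u x > 0"
  moreover obtain r where r: "r > 0" "ball x r \<subseteq> \<Omega>" using assms open_domain openE by blast
  ultimately have "u x \<le> u w" if "w \<in> ball x r" for w
    using nonneg[of w] closure_subset[of \<Omega>] that by fastforce
  then show False using no_local_min[OF r] by blast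
qed

lemma upper_bound: obtains M where "M > 0" "\<And>x. x \<in> closure \<Omega> \<Longrightarrow> u x \<le> M"
proof -
  have "bounded (u ` closure \<Omega>)"
    by (intro compact_imp_bounded compact_continuous_image continuous_closure compact_closure_domain)
  then obtain M where "M > 0" "\<And>v. v \<in> u ` closure \<Omega> \<Longrightarrow> norm v \<le> M" unfolding bounded_pos by blast
  then show ?thesis using that[of M] by fastforce
qed

text \<open>Comparison on balls of a fixed radius, with the global bound \<open>M\<close> as outer
  value, gives a Lipschitz bound for \<open>u\<close>. It passes to the square root because
  \<open>u\<close> has a positive minimum on \<open>K\<close>.\<close>

lemma lipschitz_sqrt:
  assumes K: "compact K" "K \<subseteq> \<Omega>"
  shows "\<exists>\<Lambda>\<ge>0. \<forall>x\<in>K. \<forall>y\<in>K. \<bar>sqrt (u x) - sqrt (u y)\<bar> \<le> \<Lambda> * norm (x - y)"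
proof (cases "K = {}")
  case False
  obtain M where M: "M > 0" "\<And>x. x \<in> closure \<Omega> \<Longrightarrow> u x \<le> M" using upper_bound by blast
  obtain \<rho> where \<rho>: "\<rho> > 0" "(\<Union>x\<in>K. cball x \<rho>) \<subseteq> \<Omega>"
    using compact_subset_open_imp_cball_epsilon_subset[OF K(1) open_domain K(2)] by blast
  have cl: "\<Omega> \<subseteq> closure \<Omega>" by (rule closure_subset)
  have "continuous_on K u" using continuous_closure K(2) cl by (meson continuous_on_subset order_trans)
  then obtain t where t: "t \<in> K" "\<And>x. x \<in> K \<Longrightarrow> u t \<le> u x"
    using continuous_attains_inf[OF K(1) False] by blast
  have ut: "u t > 0" using pos t(1) K by blast
  \<comment> \<open>\<open>M / \<rho>\<close> comes from interpolating up to \<open>M\<close>, and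
    \<open>\<rho> / 2\<close> from the quadratic term. As \<open>L * \<rho> \<ge> M\<close>, the
    same constant serves for points farther apart than \<rho>.\<close>
  define L where "L = M / \<rho> + \<rho> / 2"
  have L: "L > 0" using M \<rho> by (simp add: L_def add_pos_pos)
  have one: "u y - u x \<le> L * norm (y - x)" if x: "x \<in> K" and y: "y \<in> K" for x y
  proof (cases "norm (y - x) \<le> \<rho>")
    case True
    define s where "s = norm (y - x)"
    have x0: "u x \<ge> 0" using pos K x by force
    have sub: "cball x \<rho> \<subseteq> \<Omega>" using \<rho> x by blast
    have uM: "u w \<le> M" if "w \<in> cball x \<rho>" for w using sub cl M(2) that by blast
    have "u y \<le> (1 - s / \<rho>) * u x + s / \<rho> * M + s * (\<rho> - s) / 2"
      by (rule sub_comparison[OF open_domain viscosity sub uM \<rho>(1)]) (use True in \<open>auto simp: s_def\<close>)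
    moreover have "s * (\<rho> - s) / 2 \<le> s * \<rho> / 2" by (simp add: s_def mult_left_mono)
    moreover have "(1 - s / \<rho>) * u x = u x - s / \<rho> * u x" "L * s = s / \<rho> * M + s * \<rho> / 2"
      by (simp_all add: L_def algebra_simps)
    moreover have "s / \<rho> * u x \<ge> 0" using x0 \<rho> by (simp add: s_def)
    ultimately show ?thesis unfolding s_def[symmetric] by linarith
  next
    case False
    have "u y \<le> M" "u x > 0" using M pos x y K cl by blast+
    then have "u y - u x \<le> M / \<rho> * \<rho>" using \<rho> by simp
    also have "\<dots> \<le> L * norm (y - x)" using False M \<rho> L by (intro mult_mono) (auto simp: L_def)
    finally show ?thesis .
  qed
  have "\<bar>sqrt (u x) - sqrt (u y)\<bar> \<le> L / sqrt (u t) * norm (x - y)" if x: "x \<in> K" and y: "y \<in> K" for x y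
  proof -
    have p: "u x > 0" "u y > 0" using pos K x y by blast+
    have "\<bar>sqrt (u x) - sqrt (u y)\<bar> * sqrt (u t) \<le> \<bar>sqrt (u x) - sqrt (u y)\<bar> * (sqrt (u x) + sqrt (u y))"
      using t(2)[OF x] p by (intro mult_left_mono) (auto intro: add_increasing2)
    also have "\<dots> = \<bar>(sqrt (u x) - sqrt (u y)) * (sqrt (u x) + sqrt (u y))\<bar>" using p by (simp add: abs_mult)
    also have "\<dots> = \<bar>u x - u y\<bar>" using p by (simp add: algebra_simps)
    also have "\<dots> \<le> L * norm (x - y)" using one[OF x y] one[OF y x] by (simp add: norm_minus_commute abs_le_iff)
    finally show ?thesis using ut by (simp add: field_simps)
  qed
  then show ?thesis using L ut by (intro exI[of _ "L / sqrt (u t)"]) auto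
qed auto

text \<open>The comparison of the rescaled solution with \<open>u\<close> is done by doubling:
  \<open>\<mu>^2 * u z - \<theta> * u x\<close> is maximized over \<open>x\<close> within
  \<open>2 * \<mu> * r\<close> of \<open>P z\<close>. Balls of radius \<open>2 * r\<close> about
  \<open>z'\<close> correspond under \<open>P\<close> to balls of radius
  \<open>2 * \<mu> * r\<close> about \<open>P z'\<close>, so the quadratic terms of both comparisons
  match up to the factor \<theta>.\<close>

lemma boundary_comparison:
  assumes y0: "y0 \<in> frontier \<Omega>" and z0: "z0 \<in> closure \<Omega>" and lm: "0 < \<nu>" "0 < \<mu>" "\<nu> + \<mu> = 1"
  shows "\<mu>\<^sup>2 * u z0 \<le> u (\<nu> *\<^sub>R y0 + \<mu> *\<^sub>R z0)"
proof (rule ccontr)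
  define P where "P z = \<nu> *\<^sub>R y0 + \<mu> *\<^sub>R z" for z
  assume "\<not> ?thesis"
  then have gap: "u (P z0) < \<mu>\<^sup>2 * u z0" by (simp add: P_def)
  have y0c: "y0 \<in> closure \<Omega>" using y0 by (simp add: frontier_def)
  have Pcl: "P z \<in> closure \<Omega>" if "z \<in> closure \<Omega>" for z
    unfolding P_def using convexD[OF convex_closure[OF convex_domain] y0c that] lm by simp
  have PO: "P z \<in> \<Omega>" if "z \<in> \<Omega>" for z
  proof -
    have "y0 - \<mu> *\<^sub>R (y0 - z) \<in> interior \<Omega>"
      using lm that by (intro mem_interior_closure_convex_shrink convex_domain y0c) (auto simp: interior_open[OF open_domain])
    moreover have "y0 - \<mu> *\<^sub>R (y0 - z) = P z"
      using lm(3) by (simp add: P_def algebra_simps flip: scaleR_add_left)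
    ultimately show ?thesis by (simp add: interior_open[OF open_domain])
  qed
  have ux0: "u (P z0) \<ge> 0" using nonneg Pcl z0 by blast
  obtain \<theta> where \<theta>: "\<theta> > 1" "\<theta> * u (P z0) < \<mu>\<^sup>2 * u z0" using exists_factor_greater_one[OF ux0 gap] by blast
  \<comment> \<open>Every maximizer has \<open>\<mu>^2 * u z \<ge> c\<close>, hence \<open>z\<close>
    stays in the compact subset \<open>Z\<close> of the open domain, which is independent of the
    radius chosen later.\<close>
  define c where "c = \<mu>\<^sup>2 * u z0 - \<theta> * u (P z0)"
  have c: "c > 0" using \<theta> by (simp add: c_def)
  define Z where "Z = {z \<in> closure \<Omega>. c \<le> \<mu>\<^sup>2 * u z}"
  have "closed Z" unfolding Z_def
    by (intro continuous_closed_preimage_constant continuous_on_closed_Collect_le continuous_intros continuous_closure closed_closure)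
  then have cZ: "compact Z" using compact_Int_closed[OF compact_closure_domain, of Z] 
    by (metis (no_types, lifting) Int_absorb1 Z_def mem_Collect_eq subsetI)
  have ZO: "Z \<subseteq> \<Omega>"
  proof
    fix z assume "z \<in> Z"
    then have "z \<in> closure \<Omega>" "u z \<noteq> 0" using c by (auto simp: Z_def)
    then show "z \<in> \<Omega>" using closure_cases zero_frontier by blast
  qed
  obtain \<rho>1 where \<rho>1: "\<rho>1 > 0" "(\<Union>x\<in>Z. cball x \<rho>1) \<subseteq> \<Omega>"
    using compact_subset_open_imp_cball_epsilon_subset[OF cZ open_domain ZO] by blast
  have cPZ: "compact (P ` Z)" unfolding P_def by (intro compact_continuous_image continuous_intros cZ)
  have "P ` Z \<subseteq> \<Omega>" using PO ZO by blast
  then obtain \<rho>2 where \<rho>2: "\<rho>2 > 0" "(\<Union>x\<in>P ` Z. cball x \<rho>2) \<subseteq> \<Omega>"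
    using compact_subset_open_imp_cball_epsilon_subset[OF cPZ open_domain] by blast
  define r where "r = min \<rho>1 \<rho>2 / 4"
  have r: "r > 0" "4 * r \<le> \<rho>1" "4 * r \<le> \<rho>2" using \<rho>1 \<rho>2 by (auto simp: r_def)
  have \<mu>r: "0 < \<mu> * r" "\<mu> * r \<le> r" using lm r by auto
  define T where "T = (closure \<Omega> \<times> closure \<Omega>) \<inter> {p. norm (snd p - P (fst p)) \<le> 2 * (\<mu> * r)}"
  have "closed {p. norm (snd p - P (fst p)) \<le> 2 * (\<mu> * r)}"
    unfolding P_def by (intro closed_Collect_le continuous_intros)
  then have cT: "compact T" unfolding T_def by (intro compact_Int_closed compact_Times compact_closure_domain)
  have inT: "(z, x) \<in> T" if "z \<in> closure \<Omega>" "x \<in> closure \<Omega>" "norm (x - P z) \<le> 2 * (\<mu> * r)" for z x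
    using that by (simp add: T_def)
  define \<Phi> where "\<Phi> p = \<mu>\<^sup>2 * u (fst p) - \<theta> * u (snd p)" for p
  have "continuous_on T \<Phi>" unfolding \<Phi>_def T_def
    by (intro continuous_intros continuous_on_compose2[OF continuous_closure]) auto
  moreover have T0: "(z0, P z0) \<in> T" using z0 Pcl \<mu>r by (intro inT) auto
  ultimately obtain p where p: "p \<in> T" "\<And>q. q \<in> T \<Longrightarrow> \<Phi> q \<le> \<Phi> p"
    using continuous_attains_sup[OF cT] by blast
  obtain z1 x1 where p_eq: "p = (z1, x1)" by (cases p)
  have z1: "z1 \<in> closure \<Omega>" and x1: "x1 \<in> closure \<Omega>" and con: "norm (x1 - P z1) \<le> 2 * (\<mu> * r)"
    using p(1) by (auto simp: T_def p_eq)
  have mx: "\<mu>\<^sup>2 * u z - \<theta> * u x \<le> \<mu>\<^sup>2 * u z1 - \<theta> * u x1" 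
    if "z \<in> closure \<Omega>" "x \<in> closure \<Omega>" "norm (x - P z) \<le> 2 * (\<mu> * r)" for z x
    using p(2)[OF inT[OF that]] by (simp add: p_eq \<Phi>_def)
  have "c \<le> \<mu>\<^sup>2 * u z1 - \<theta> * u x1" using mx[OF z0 Pcl[OF z0]] \<mu>r by (simp add: c_def)
  moreover have "\<theta> * u x1 \<ge> 0" using nonneg[OF x1] \<theta> by simp
  ultimately have z1Z: "z1 \<in> Z" using z1 by (simp add: Z_def)
  have bz: "cball z1 (4 * r) \<subseteq> \<Omega>" using \<rho>1(2) z1Z r(2) by (auto simp: subset_eq)
  have bx: "cball (P z1) (4 * (\<mu> * r)) \<subseteq> \<Omega>" 
  proof -
    have "cball (P z1) (4 * (\<mu> * r)) \<subseteq> cball (P z1) \<rho>2" using \<mu>r r(3) by (intro subset_cball) linarith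
    then show ?thesis using \<rho>2(2) z1Z by blast
  qed
  have cl: "\<Omega> \<subseteq> closure \<Omega>" by (rule closure_subset)
  have x1O: "x1 \<in> \<Omega>" using bx con \<mu>r by (auto simp: subset_eq dist_norm norm_minus_commute)
  have tight: "norm (x1 - P z1) = 2 * (\<mu> * r)"
  proof (rule constrained_min_on_sphere[OF x1O con])
    show "u x1 \<le> u x" if "x \<in> closure \<Omega>" "norm (x - P z1) \<le> 2 * (\<mu> * r)" for x
      using mx[OF z1 that] \<theta> by simp
  qed
  define e where "e = (1 / (2 * (\<mu> * r))) *\<^sub>R (x1 - P z1)"
  have e: "norm e = 1" using tight \<mu>r lm r by (simp add: e_def)
  have x1e: "x1 = P z1 + (2 * (\<mu> * r)) *\<^sub>R e" using lm r by (simp add: e_def)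
  \<comment> \<open>The new centres: \<open>z1\<close> lies at distance \<open>r\<close> behind
    \<open>z'\<close>, and \<open>x1\<close> at distance \<open>\<mu> * r\<close> ahead of
    \<open>x' = P z'\<close>, so both are at half the radius of the balls used.\<close>
  define z' where "z' = z1 + r *\<^sub>R e"
  define x' where "x' = P z'"
  have x': "x' = P z1 + (\<mu> * r) *\<^sub>R e" by (simp add: x'_def z'_def P_def algebra_simps)
  have sz: "cball z' (2 * r) \<subseteq> \<Omega>"
  proof -
    have "cball z' (2 * r) \<subseteq> cball z1 (4 * r)" 
      using r(1) e by (subst cball_subset_cball_iff) (simp add: z'_def dist_norm)
    then show ?thesis using bz by blast
  qed
  have sx: "cball x' (2 * (\<mu> * r)) \<subseteq> \<Omega>"
  proof -
    have "cball x' (2 * (\<mu> * r)) \<subseteq> cball (P z1) (4 * (\<mu> * r))"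
      using \<mu>r e by (subst cball_subset_cball_iff) (simp add: x' dist_norm)
    then show ?thesis using bx by blast
  qed
  have ne: "cball z' (2 * r) \<noteq> {}" "cball x' (2 * (\<mu> * r)) \<noteq> {}" using r \<mu>r by auto
  have cu: "continuous_on S u" if "S \<subseteq> \<Omega>" for S using continuous_closure that cl by (meson continuous_on_subset order_trans)
  obtain z2 where z2: "z2 \<in> cball z' (2 * r)" "\<And>w. w \<in> cball z' (2 * r) \<Longrightarrow> u w \<le> u z2"
    using continuous_attains_sup[OF compact_cball ne(1) cu[OF sz]] by blast
  obtain x3 where x3: "x3 \<in> cball x' (2 * (\<mu> * r))" "\<And>w. w \<in> cball x' (2 * (\<mu> * r)) \<Longrightarrow> u w \<ge> u x3"
    using continuous_attains_inf[OF compact_cball ne(2) cu[OF sx]] by blast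
  have z'O: "z' \<in> \<Omega>" "x' \<in> \<Omega>" using sz sx r \<mu>r by (auto simp: subset_eq)
  have "norm (x' - P z2) \<le> 2 * (\<mu> * r)"
  proof -
    have "x' - P z2 = \<mu> *\<^sub>R (z' - z2)" by (simp add: x'_def P_def algebra_simps)
    then have "norm (x' - P z2) = \<mu> * norm (z' - z2)" using lm by simp
    also have "\<dots> \<le> \<mu> * (2 * r)" using z2(1) lm by (intro mult_left_mono) (auto simp: dist_norm)
    finally show ?thesis by simp
  qed
  \<comment> \<open>Crossed competitors: the maximum point near \<open>z'\<close> is paired with the
    centre \<open>x'\<close>, and below the centre \<open>z'\<close> with the minimum point near
    \<open>x'\<close>.\<close>
  then have m1: "\<mu>\<^sup>2 * u z2 - \<theta> * u x' \<le> \<mu>\<^sup>2 * u z1 - \<theta> * u x1"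
    using z2(1) sz z'O cl by (intro mx) auto
  have m2: "\<mu>\<^sup>2 * u z' - \<theta> * u x3 \<le> \<mu>\<^sup>2 * u z1 - \<theta> * u x1"
    using x3(1) sx z'O cl by (intro mx) (auto simp: x'_def dist_norm norm_minus_commute)
  have "u z1 \<le> (1 - r / (2 * r)) * u z' + r / (2 * r) * u z2 + r * (2 * r - r) / 2"
    by (rule sub_comparison[OF open_domain viscosity sz z2(2)]) (use r e in \<open>auto simp: z'_def\<close>)
  then have s1: "u z1 \<le> u z' / 2 + u z2 / 2 + r\<^sup>2 / 2" using r by (simp add: power2_eq_square field_simps)
  have "x1 - x' = (\<mu> * r) *\<^sub>R e" by (simp add: x1e x' flip: scaleR_diff_left)
  then have "norm (x1 - x') = \<mu> * r" using e \<mu>r by simp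
  then have "u x1 \<ge> (1 - (\<mu> * r) / (2 * (\<mu> * r))) * u x' + (\<mu> * r) / (2 * (\<mu> * r)) * u x3 + (\<mu> * r) * (2 * (\<mu> * r) - \<mu> * r) / 2"
    by (intro super_comparison[OF open_domain viscosity sx x3(2)]) (use \<mu>r in auto)
  then have s2: "u x1 \<ge> u x' / 2 + u x3 / 2 + (\<mu> * r)\<^sup>2 / 2" using \<mu>r lm r by (simp add: power2_eq_square)
  have "\<mu>\<^sup>2 * u z1 \<le> \<mu>\<^sup>2 * (u z' / 2 + u z2 / 2 + r\<^sup>2 / 2)" using s1 by (rule mult_left_mono) simp
  moreover have "\<theta> * (u x' / 2 + u x3 / 2 + (\<mu> * r)\<^sup>2 / 2) \<le> \<theta> * u x1" using s2 \<theta> by (intro mult_left_mono) auto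
  \<comment> \<open>The average of \<open>m1\<close> and \<open>m2\<close> cancels all values of
    \<open>u\<close>; only the quadratic terms remain.\<close>
  ultimately have "\<theta> * (\<mu> * r)\<^sup>2 \<le> (\<mu> * r)\<^sup>2" using m1 m2 by (simp add: algebra_simps power_mult_distrib)
  moreover have "(\<mu> * r)\<^sup>2 > 0" using \<mu>r(1) by (rule zero_less_power)
  ultimately have "\<theta> \<le> 1" by (metis mult_le_cancel_right2 order_less_imp_not_less)
  then show False using \<theta>(1) by simp
qed


section \<open>Concavity of the square root of the solution\<close>

abbreviation w :: "real^'n \<Rightarrow> real" where "w x \<equiv> sqrt (u x)"

lemma continuous_sqrt: "S \<subseteq> closure \<Omega> \<Longrightarrow> continuous_on S w"
  by (intro continuous_intros continuous_on_subset[OF continuous_closure])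

lemma sq_sqrt: "x \<in> closure \<Omega> \<Longrightarrow> (w x)\<^sup>2 = u x"
  using nonneg by simp

text \<open>One of the two ends of the segment in the doubling argument: the ball of radius
  \<open>2 * \<epsilon> * w\<close> is measured with the value of \<open>w\<close> at its own maximum point, so that
  all three radii scale with \<open>w\<close>.\<close>

lemma endpoint_estimate:
  assumes y: "y \<in> \<Omega>" and \<epsilon>: "\<epsilon> > 0" and e: "norm e = 1" and N: "\<And>x. x \<in> closure \<Omega> \<Longrightarrow> w x \<le> N"
    and K: "cball y (3 * (\<epsilon> * N)) \<subseteq> K" "K \<subseteq> \<Omega>"
    and \<Lambda>: "\<Lambda> \<ge> 0" "\<And>x x'. \<lbrakk>x \<in> K; x' \<in> K\<rbrakk> \<Longrightarrow> \<bar>w x - w x'\<bar> \<le> \<Lambda> * norm (x - x')"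
    and y': "y' = y + (\<epsilon> * w y) *\<^sub>R e" "w y' \<le> w y"
  shows "\<exists>d. 0 \<le> d \<and> d \<le> 3 * \<Lambda> * N * \<epsilon> \<and> w y - w y' \<le> 3 * \<Lambda> * N * \<epsilon> \<and>
    (\<exists>y2\<in>closure \<Omega>. norm (y2 - y') \<le> 2 * (\<epsilon> * w y2) \<and> w y2 = w y + d) \<and>
    (w y)\<^sup>2 \<le> parabola 1 \<epsilon> (w y) (w y + d) (w y')"
proof -
  have cl: "\<Omega> \<subseteq> closure \<Omega>" by (rule closure_subset)
  have wN: "0 \<le> w x" "w x \<le> N" if "x \<in> closure \<Omega>" for x using N[OF that] nonneg[OF that] by auto
  have N0: "N \<ge> 0" using wN[OF subsetD[OF cl y]] by linarith
  note y = y subsetD[OF cl y]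
  have yK: "y \<in> K" using K(1) N0 \<epsilon> by auto
  have b: "w y > 0" using pos[OF y(1)] by simp
  have yy': "norm (y - y') = \<epsilon> * w y" using e \<epsilon> b y' by simp
  have \<epsilon>N: "\<epsilon> * w x \<le> \<epsilon> * N" if "x \<in> closure \<Omega>" for x using wN[OF that] \<epsilon> by simp
  have y'K: "y' \<in> K" using K(1) yy' \<epsilon>N[OF y(2)] N0 \<epsilon> by (auto simp: subset_eq dist_norm)
  \<comment> \<open>The radius depends on the value at the competing point itself. \<open>y\<close>
    belongs to \<open>S\<close> because its distance to \<open>y'\<close> is only
    \<open>\<epsilon> * w y\<close>.\<close>
  define S where "S = {x \<in> closure \<Omega>. norm (x - y') \<le> 2 * (\<epsilon> * w x)}"
  have "closed S" unfolding S_def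
    by (intro continuous_on_closed_Collect_le continuous_intros continuous_sqrt closed_closure order_refl)
  then have cS: "compact S" using compact_Int_closed[OF compact_closure_domain, of S] 
    by (metis (no_types, lifting) Int_absorb1 S_def mem_Collect_eq subsetI)
  have yS: "y \<in> S" using y yy' \<epsilon> b by (simp add: S_def)
  then have "S \<noteq> {}" by blast
  moreover have "continuous_on S w" by (rule continuous_sqrt) (auto simp: S_def)
  ultimately obtain y2 where y2: "y2 \<in> S" "\<And>x. x \<in> S \<Longrightarrow> w x \<le> w y2"
    using continuous_attains_sup[OF cS] by blast
  have y2c: "y2 \<in> closure \<Omega>" "norm (y2 - y') \<le> 2 * (\<epsilon> * w y2)" using y2(1) by (auto simp: S_def)
  define d where "d = w y2 - w y"
  have d0: "0 \<le> d" using y2(2)[OF yS] by (simp add: d_def)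
  have "norm (y2 - y) \<le> norm (y2 - y') + norm (y' - y)" using norm_triangle_ineq[of "y2 - y'" "y' - y"] by simp
  also have "\<dots> \<le> 3 * (\<epsilon> * N)" using y2c(2) \<epsilon>N[OF y2c(1)] yy' \<epsilon>N[OF y(2)] by (simp add: norm_minus_commute)
  finally have n: "norm (y2 - y) \<le> 3 * (\<epsilon> * N)" .
  then have y2K: "y2 \<in> K" using K(1) by (auto simp: subset_eq dist_norm norm_minus_commute)
  have "d \<le> \<Lambda> * norm (y2 - y)" using \<Lambda>(2)[OF y2K yK] by (simp add: d_def)
  also have "\<dots> \<le> \<Lambda> * (3 * (\<epsilon> * N))" using n \<Lambda>(1) by (rule mult_left_mono)
  finally have d1: "d \<le> 3 * \<Lambda> * N * \<epsilon>" by (simp add: mult_ac)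
  have "w y - w y' \<le> \<Lambda> * norm (y - y')" using \<Lambda>(2)[OF yK y'K] by simp
  also have "\<dots> \<le> \<Lambda> * (3 * (\<epsilon> * N))" using \<Lambda>(1) yy' \<epsilon>N[OF y(2)] N0 \<epsilon> by (intro mult_left_mono) auto
  finally have d2: "w y - w y' \<le> 3 * \<Lambda> * N * \<epsilon>" by (simp add: mult_ac)
  define R where "R = 2 * (\<epsilon> * w y2)"
  have w2: "w y2 = w y + d" by (simp add: d_def)
  have R: "R > 0" using \<epsilon> b d0 unfolding R_def w2 by (intro mult_pos_pos add_pos_nonneg) auto
  have sub: "cball y' R \<subseteq> \<Omega>"
  proof
    fix x assume "x \<in> cball y' R"
    then have "dist y x \<le> \<epsilon> * w y + R" using dist_triangle[of y x y'] yy' by (simp add: dist_norm)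
    then have "x \<in> cball y (3 * (\<epsilon> * N))" using \<epsilon>N[OF y(2)] \<epsilon>N[OF y2c(1)] by (simp add: R_def)
    then show "x \<in> \<Omega>" using K by blast
  qed
  \<comment> \<open>A point of the ball with a larger value of \<open>w\<close> is allowed an even
    larger radius, so it would belong to \<open>S\<close> and contradict the choice of
    \<open>y2\<close>.\<close>
  have le: "u x \<le> u y2" if x: "x \<in> cball y' R" for x
  proof (rule ccontr)
    assume "\<not> ?thesis"
    then have "w y2 < w x" by simp
    moreover have "norm (x - y') \<le> 2 * (\<epsilon> * w y2)" using x by (simp add: R_def dist_norm norm_minus_commute)
    ultimately have "norm (x - y') \<le> 2 * (\<epsilon> * w x)" using \<epsilon> by (smt (verit) mult_left_mono)
    then have "x \<in> S" using x sub cl by (auto simp: S_def)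
    then show False using y2(2) \<open>w y2 < w x\<close> by force
  qed
  have s: "norm (y - y') \<le> R" unfolding yy' R_def w2 using \<epsilon> b d0 by simp
  have y'c: "y' \<in> closure \<Omega>" using y'K K cl by blast
  have "u y \<le> (1 - \<epsilon> * w y / R) * u y' + \<epsilon> * w y / R * u y2 + \<epsilon> * w y * (R - \<epsilon> * w y) / 2"
    by (rule sub_comparison[OF open_domain viscosity sub le R yy']) (use s yy' in auto)
  moreover have "\<epsilon> * w y / R = w y / (2 * (w y + d))" using \<epsilon> by (simp add: R_def w2)
  moreover have "\<epsilon> * w y * (R - \<epsilon> * w y) / 2 = \<epsilon>\<^sup>2 * w y * (2 * (w y + d) - w y) / 2"
    by (simp add: R_def w2 power2_eq_square algebra_simps)
  moreover have "u y = (w y)\<^sup>2" "u y' = (w y')\<^sup>2" "u y2 = (w y + d)\<^sup>2"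
    using sq_sqrt[OF y(2)] sq_sqrt[OF y'c] sq_sqrt[OF y2c(1)] w2 by simp_all
  ultimately have "(w y)\<^sup>2 \<le> parabola 1 \<epsilon> (w y) (w y + d) (w y')"
    unfolding mult_1_left by metis
  then show ?thesis using d0 d1 d2 y2c w2 by blast
qed


lemma sqrt_concave:
  assumes y0: "y0 \<in> \<Omega>" and z0: "z0 \<in> \<Omega>" and nm: "0 < \<nu>" "0 < \<mu>" "\<nu> + \<mu> = 1"
  shows "\<nu> * w y0 + \<mu> * w z0 \<le> w (\<nu> *\<^sub>R y0 + \<mu> *\<^sub>R z0)"
proof (rule ccontr)
  define P where "P y z = \<nu> *\<^sub>R y + \<mu> *\<^sub>R z" for y z :: "real^'n"
  define W where "W y z = \<nu> * w y + \<mu> * w z" for y z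
  assume "\<not> ?thesis"
  then have gap: "w (P y0 z0) < W y0 z0" by (simp add: P_def W_def)
  have cl: "\<Omega> \<subseteq> closure \<Omega>" by (rule closure_subset)
  have Pcl: "P y z \<in> closure \<Omega>" if "y \<in> closure \<Omega>" "z \<in> closure \<Omega>" for y z
    unfolding P_def using convexD[OF convex_closure[OF convex_domain] that] nm by simp
  have PO: "P y z \<in> \<Omega>" if "y \<in> \<Omega>" "z \<in> \<Omega>" for y z
    unfolding P_def using convexD[OF convex_domain that] nm by simp
  have w0: "0 \<le> w x" if "x \<in> closure \<Omega>" for x using nonneg[OF that] by simp
  have W0: "0 \<le> W y z" if "y \<in> closure \<Omega>" "z \<in> closure \<Omega>" for y z
    using w0[OF that(1)] w0[OF that(2)] nm by (simp add: W_def)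
  have P0: "P y0 z0 \<in> closure \<Omega>" using PO[OF y0 z0] cl by blast
  have "(w (P y0 z0))\<^sup>2 < (W y0 z0)\<^sup>2" by (intro power_strict_mono gap w0[OF P0]) simp
  then have "u (P y0 z0) < (W y0 z0)\<^sup>2" using sq_sqrt[OF P0] by simp
  then obtain \<theta> where \<theta>: "\<theta> > 1" "\<theta> * u (P y0 z0) < (W y0 z0)\<^sup>2"
    using exists_factor_greater_one[OF nonneg[OF P0]] by blast
  define c where "c = (W y0 z0)\<^sup>2 - \<theta> * u (P y0 z0)"
  have c: "c > 0" using \<theta> by (simp add: c_def)
  obtain M where M: "M > 0" "\<And>x. x \<in> closure \<Omega> \<Longrightarrow> u x \<le> M" using upper_bound by blast
  define N where "N = sqrt M"
  have N: "N > 0" "\<And>x. x \<in> closure \<Omega> \<Longrightarrow> w x \<le> N" using M by (simp_all add: N_def)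
  have WN: "W y z \<le> N" if "y \<in> closure \<Omega>" "z \<in> closure \<Omega>" for y z
    unfolding W_def using convex_bound_le[OF N(2)[OF that(1)] N(2)[OF that(2)]] nm by simp

  \<comment> \<open>Pairs that retain half of the gap. The constraint allows \<open>x\<close> to
    differ from \<open>P y z\<close>, and for small \<epsilon> this displacement costs at most the
    other half.\<close>
  define Z where "Z = (closure \<Omega> \<times> closure \<Omega>) \<inter> {p. c / 2 \<le> (W (fst p) (snd p))\<^sup>2 - \<theta> * u (P (fst p) (snd p))}"
  have cP: "continuous_on S (\<lambda>p. P (fst p) (snd p))" for S unfolding P_def by (intro continuous_intros)
  have cW: "continuous_on (closure \<Omega> \<times> closure \<Omega>) (\<lambda>p. W (fst p) (snd p))"
    unfolding W_def by (intro continuous_intros continuous_on_compose2[OF continuous_sqrt[OF order_refl]]) auto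
  have "compact (closure \<Omega> \<times> closure \<Omega>)" by (intro compact_Times compact_closure_domain)
  moreover have "continuous_on (closure \<Omega> \<times> closure \<Omega>) (\<lambda>p. (W (fst p) (snd p))\<^sup>2 - \<theta> * u (P (fst p) (snd p)))"
    by (intro continuous_intros cW continuous_on_compose2[OF continuous_closure cP]) (auto intro: Pcl)
  then have "closed ((closure \<Omega> \<times> closure \<Omega>) \<inter> (\<lambda>p. (W (fst p) (snd p))\<^sup>2 - \<theta> * u (P (fst p) (snd p))) -` {c / 2..})"
    by (intro continuous_closed_preimage) (auto intro: closed_Times)
  then have "closed Z" unfolding Z_def by (simp add: vimage_def)
  ultimately have cZ: "compact Z"
    using compact_Int_closed[of "closure \<Omega> \<times> closure \<Omega>" Z] by (simp add: Z_def)
  have ZO: "y \<in> \<Omega> \<and> z \<in> \<Omega>" if "(y, z) \<in> Z" for y z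
  proof -
    have yz: "y \<in> closure \<Omega>" "z \<in> closure \<Omega>" and Zc: "c / 2 \<le> (W y z)\<^sup>2 - \<theta> * u (P y z)"
      using that by (auto simp: Z_def)
    have uP: "u (P y z) < (W y z)\<^sup>2"
    proof -
      have "1 * u (P y z) \<le> \<theta> * u (P y z)" using \<theta> nonneg[OF Pcl[OF yz]] by (intro mult_right_mono) auto
      then show ?thesis using Zc c by linarith
    qed
    \<comment> \<open>At a boundary point one summand of \<open>W\<close> vanishes, and
      \<open>boundary_comparison\<close> excludes a positive gap.\<close>
    have "y \<notin> frontier \<Omega>"
    proof
      assume f: "y \<in> frontier \<Omega>"
      then have "(W y z)\<^sup>2 = \<mu>\<^sup>2 * u z" using zero_frontier[OF f] sq_sqrt[OF yz(2)] by (simp add: W_def power_mult_distrib)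
      then show False using boundary_comparison[OF f yz(2) nm] uP by (simp add: P_def)
    qed
    moreover have "z \<notin> frontier \<Omega>"
    proof
      assume f: "z \<in> frontier \<Omega>"
      then have "(W y z)\<^sup>2 = \<nu>\<^sup>2 * u y" using zero_frontier[OF f] sq_sqrt[OF yz(1)] by (simp add: W_def power_mult_distrib)
      then show False using boundary_comparison[OF f yz(1) nm(2,1)] nm(3) uP by (simp add: P_def add.commute)
    qed
    ultimately show ?thesis using closure_cases yz by blast
  qed

  define K0 where "K0 = fst ` Z \<union> snd ` Z \<union> (\<lambda>p. P (fst p) (snd p)) ` Z"
  have cK0: "compact K0" unfolding K0_def
    by (intro compact_Un compact_continuous_image cZ cP continuous_intros)
  have K0O: "K0 \<subseteq> \<Omega>" unfolding K0_def using ZO PO by fastforce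
  obtain \<rho> where \<rho>: "\<rho> > 0" "(\<Union>x\<in>K0. cball x \<rho>) \<subseteq> \<Omega>"
    using compact_subset_open_imp_cball_epsilon_subset[OF cK0 open_domain K0O] by blast
  \<comment> \<open>A compact neighbourhood of all optimal points. The Lipschitz constant \<Lambda>
    and the lower bound \<open>m\<close> of \<open>w\<close> on it are fixed before
    \<epsilon>.\<close>
  define K where "K = {x + v |x v. x \<in> K0 \<and> v \<in> cball 0 \<rho>}"
  have cK: "compact K" unfolding K_def by (intro compact_sums cK0 compact_cball)
  have K_iff: "cball x \<rho> \<subseteq> K" if "x \<in> K0" for x
  proof
    fix y assume "y \<in> cball x \<rho>"
    then show "y \<in> K" unfolding K_def using that
      by (intro CollectI exI[of _ x] exI[of _ "y - x"]) (auto simp: dist_norm norm_minus_commute)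
  qed
  have KO: "K \<subseteq> \<Omega>"
  proof
    fix y assume "y \<in> K"
    then obtain x v where "x \<in> K0" "v \<in> cball 0 \<rho>" "y = x + v" unfolding K_def by blast
    then have "y \<in> cball x \<rho>" by (simp add: dist_norm)
    then show "y \<in> \<Omega>" using \<rho>(2) \<open>x \<in> K0\<close> by blast
  qed
  obtain \<Lambda> where \<Lambda>: "\<Lambda> \<ge> 0" "\<And>x y. \<lbrakk>x \<in> K; y \<in> K\<rbrakk> \<Longrightarrow> \<bar>w x - w y\<bar> \<le> \<Lambda> * norm (x - y)"
    using lipschitz_sqrt[OF cK KO] by blast
  have "\<exists>m>0. \<forall>x\<in>K. m \<le> w x"
  proof (cases "K = {}")
    case False
    have "continuous_on K w" using KO cl by (intro continuous_sqrt) blast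
    then obtain t where "t \<in> K" "\<And>x. x \<in> K \<Longrightarrow> w t \<le> w x" using continuous_attains_inf[OF cK False] by blast
    moreover have "w t > 0" using pos KO \<open>t \<in> K\<close> by (simp add: subset_eq)
    ultimately show ?thesis by blast
  qed (auto intro: exI[of _ 1])
  then obtain m where m: "m > 0" "\<And>x. x \<in> K \<Longrightarrow> m \<le> w x" by blast
  define C where "C = 3 * \<Lambda> * N"
  have C: "C \<ge> 0" using \<Lambda> N by (simp add: C_def)

  have "uniformly_continuous_on (closure \<Omega>) u"
    by (intro compact_uniformly_continuous continuous_closure compact_closure_domain)
  moreover have "c / (2 * \<theta>) > 0" using c \<theta> by simp
  ultimately obtain \<delta> where \<delta>: "\<delta> > 0" "\<And>x x'. \<lbrakk>x \<in> closure \<Omega>; x' \<in> closure \<Omega>; dist x' x < \<delta>\<rbrakk> \<Longrightarrow> dist (u x') (u x) < c / (2 * \<theta>)"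
    unfolding uniformly_continuous_on_def by blast
  obtain \<epsilon>0 where \<epsilon>0: "\<epsilon>0 > 0" and contr: "\<And>\<epsilon> b1 d1 e1 b2 d2 e2. \<lbrakk>0 < \<epsilon> \<and> \<epsilon> < \<epsilon>0 \<and> C * \<epsilon> < m;
     m \<le> b1 \<and> b1 \<le> N \<and> 0 \<le> d1 \<and> d1 \<le> C * \<epsilon> \<and> 0 \<le> e1 \<and> e1 \<le> C * \<epsilon>;
     m \<le> b2 \<and> b2 \<le> N \<and> 0 \<le> d2 \<and> d2 \<le> C * \<epsilon> \<and> 0 \<le> e2 \<and> e2 \<le> C * \<epsilon>;
     b1\<^sup>2 \<le> parabola 1 \<epsilon> b1 (b1 + d1) (b1 - e1);
     b2\<^sup>2 \<le> parabola 1 \<epsilon> b2 (b2 + d2) (b2 - e2)\<rbrakk> \<Longrightarrow>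
     let b = \<nu> * b1 + \<mu> * b2; d = \<nu> * d1 + \<mu> * d2; e = \<nu> * e1 + \<mu> * e2 in
     b\<^sup>2 < parabola \<theta> \<epsilon> b (b - e) (b + d)"
    using discrete_contradiction[OF m(1) \<theta>(1) nm, of C N] by blast
  \<comment> \<open>The four bounds serve, in order, the discrete contradiction, staying in
    \<open>K\<close>, the modulus of continuity of \<open>u\<close>, and
    \<open>C * \<epsilon> < m / 2\<close>.\<close>
  define \<epsilon> where "\<epsilon> = min (\<epsilon>0 / 2) (min (\<rho> / (4 * N)) (min (\<delta> / (4 * N)) (m / (4 * (C + 1)))))"
  have \<epsilon>: "\<epsilon> > 0" using \<epsilon>0 \<rho> \<delta> m C N by (simp add: \<epsilon>_def)
  have \<epsilon>_le: "\<epsilon> \<le> \<epsilon>0 / 2" "\<epsilon> \<le> \<rho> / (4 * N)" "\<epsilon> \<le> \<delta> / (4 * N)" "\<epsilon> \<le> m / (4 * (C + 1))"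
    by (simp_all only: \<epsilon>_def min_le_iff_disj order_refl simp_thms)
  have \<epsilon>N: "\<epsilon> * N > 0" "4 * (\<epsilon> * N) \<le> \<rho>" "4 * (\<epsilon> * N) \<le> \<delta>" using \<epsilon> \<epsilon>_le N by (simp_all add: field_simps)
  have "4 * (\<epsilon> * (C + 1)) \<le> m" using \<epsilon>_le(4) C by (simp add: field_simps)
  then have C\<epsilon>: "C * \<epsilon> < m / 2" using \<epsilon> C m by (simp add: algebra_simps)
  have \<epsilon>lt: "\<epsilon> < \<epsilon>0" using \<epsilon>_le(1) \<epsilon>0 by simp

  define T where "T = (closure \<Omega> \<times> closure \<Omega> \<times> closure \<Omega>) \<inter> {p. norm (snd (snd p) - P (fst p) (fst (snd p))) \<le> 2 * (\<epsilon> * W (fst p) (fst (snd p)))}"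
  have cc: "compact (closure \<Omega> \<times> closure \<Omega> \<times> closure \<Omega>)" by (intro compact_Times compact_closure_domain)
  define gap where "gap p = 2 * (\<epsilon> * W (fst p) (fst (snd p))) - norm (snd (snd p) - P (fst p) (fst (snd p)))" for p
  have cw1: "continuous_on (closure \<Omega> \<times> closure \<Omega> \<times> closure \<Omega>) (\<lambda>p. W (fst p) (fst (snd p)))"
    unfolding W_def by (intro continuous_intros continuous_on_compose2[OF continuous_sqrt[OF order_refl]]) auto
  have "continuous_on (closure \<Omega> \<times> closure \<Omega> \<times> closure \<Omega>) gap"
    unfolding gap_def P_def by (intro continuous_intros cw1)
  then have "closed ((closure \<Omega> \<times> closure \<Omega> \<times> closure \<Omega>) \<inter> gap -` {0..})"
    by (intro continuous_closed_preimage) (auto intro: closed_Times)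
  moreover have "T = (closure \<Omega> \<times> closure \<Omega> \<times> closure \<Omega>) \<inter> gap -` {0..}" by (auto simp: T_def gap_def)
  ultimately have cT: "compact T" using compact_Int_closed[OF cc, of T] by (simp add: T_def)
  define \<Phi> where "\<Phi> p = (W (fst p) (fst (snd p)))\<^sup>2 - \<theta> * u (snd (snd p))" for p
  have "continuous_on (closure \<Omega> \<times> closure \<Omega> \<times> closure \<Omega>) \<Phi>" unfolding \<Phi>_def
    by (intro continuous_intros cw1 continuous_on_compose2[OF continuous_closure]) auto
  then have "continuous_on T \<Phi>" by (rule continuous_on_subset) (auto simp: T_def)
  moreover have inT: "(y, z, x) \<in> T" if "y \<in> closure \<Omega>" "z \<in> closure \<Omega>" "x \<in> closure \<Omega>" "norm (x - P y z) \<le> 2 * (\<epsilon> * W y z)" for y z x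
    using that by (simp add: T_def)
  have c0: "y0 \<in> closure \<Omega>" "z0 \<in> closure \<Omega>" using y0 z0 cl by auto
  have start: "norm (P y0 z0 - P y0 z0) \<le> 2 * (\<epsilon> * W y0 z0)" using W0[OF c0] \<epsilon> by simp
  then have "T \<noteq> {}" using inT[OF c0 P0] by blast
  ultimately obtain p where p: "p \<in> T" "\<And>q. q \<in> T \<Longrightarrow> \<Phi> q \<le> \<Phi> p"
    using continuous_attains_sup[OF cT] by blast
  obtain y1 z1 x1 where p_eq: "p = (y1, z1, x1)" by (cases p)
  have c1: "y1 \<in> closure \<Omega>" "z1 \<in> closure \<Omega>" "x1 \<in> closure \<Omega>" and con: "norm (x1 - P y1 z1) \<le> 2 * (\<epsilon> * W y1 z1)"
    using p(1) by (auto simp: T_def p_eq)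
  define b where "b = W y1 z1"
  have mx: "(W y z)\<^sup>2 - \<theta> * u x \<le> b\<^sup>2 - \<theta> * u x1"
    if "y \<in> closure \<Omega>" "z \<in> closure \<Omega>" "x \<in> closure \<Omega>" "norm (x - P y z) \<le> 2 * (\<epsilon> * W y z)" for y z x
    using p(2)[OF inT[OF that]] by (simp add: p_eq \<Phi>_def b_def)
  have "c \<le> b\<^sup>2 - \<theta> * u x1" using mx[OF c0 P0 start] by (simp add: c_def)
  moreover have "2 * (\<epsilon> * b) \<le> 2 * (\<epsilon> * N)" using WN[OF c1(1,2)] \<epsilon> by (simp add: b_def)
  then have b2N: "norm (x1 - P y1 z1) \<le> 2 * (\<epsilon> * N)" using con by (simp add: b_def)
  have "dist (u x1) (u (P y1 z1)) < c / (2 * \<theta>)" 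
    using b2N \<epsilon>N by (intro \<delta>(2) Pcl c1) (simp add: dist_norm)
  then have "u (P y1 z1) < u x1 + c / (2 * \<theta>)" by (simp add: dist_real_def)
  then have "\<theta> * u (P y1 z1) \<le> \<theta> * (u x1 + c / (2 * \<theta>))" using \<theta> by simp
  then have "\<theta> * u (P y1 z1) \<le> \<theta> * u x1 + c / 2" using \<theta> by (simp add: distrib_left)
  \<comment> \<open>By uniform continuity, moving from \<open>x1\<close> to \<open>P y1 z1\<close>
    lost at most \<open>c / 2\<close>, so the optimal pair stays away from the boundary.\<close>
  ultimately have inZ: "(y1, z1) \<in> Z" using c1 by (simp add: Z_def b_def)
  then have K0s: "y1 \<in> K0" "z1 \<in> K0" "P y1 z1 \<in> K0" unfolding K0_def by force+
  have O1: "y1 \<in> \<Omega>" "z1 \<in> \<Omega>" using K0s K0O by auto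
  have Ks: "y1 \<in> K" "z1 \<in> K" using K0s K_iff \<rho>(1) by fastforce+
  have cb: "cball q (3 * (\<epsilon> * N)) \<subseteq> K" if "q \<in> K0" for q
  proof -
    have "cball q (3 * (\<epsilon> * N)) \<subseteq> cball q \<rho>" using \<epsilon>N by (intro subset_cball) linarith
    then show ?thesis using K_iff[OF that] by blast
  qed
  have "x1 \<in> cball (P y1 z1) (3 * (\<epsilon> * N))" using b2N \<epsilon>N by (simp add: dist_norm norm_minus_commute)
  then have x1O: "x1 \<in> \<Omega>" using cb[OF K0s(3)] KO by blast
  have wy1: "w y1 > 0" "w z1 > 0" using pos O1 by auto
  have b: "b > 0" "\<epsilon> * b > 0" unfolding b_def W_def
    by (intro add_pos_pos mult_pos_pos nm wy1 \<epsilon>)+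
  have tight: "norm (x1 - P y1 z1) = 2 * (\<epsilon> * b)"
  proof (rule constrained_min_on_sphere[OF x1O])
    show "norm (x1 - P y1 z1) \<le> 2 * (\<epsilon> * b)" using con by (simp add: b_def)
    show "u x1 \<le> u x" if "x \<in> closure \<Omega>" "norm (x - P y1 z1) \<le> 2 * (\<epsilon> * b)" for x
    proof -
      have "\<theta> * u x1 \<le> \<theta> * u x" using mx[OF c1(1,2) that(1)] that(2) by (simp add: b_def)
      then show ?thesis using \<theta> by simp
    qed
  qed
  define e where "e = (1 / (2 * (\<epsilon> * b))) *\<^sub>R (x1 - P y1 z1)"
  have e: "norm e = 1" using tight b \<epsilon> by (simp add: e_def)
  have x1e: "x1 = P y1 z1 + (2 * (\<epsilon> * b)) *\<^sub>R e" using b \<epsilon> by (simp add: e_def)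
  \<comment> \<open>Each point moves in proportion to its own value of \<open>w\<close>, so that
    \<open>x' = P y' z'\<close> moves by \<open>\<epsilon> * b\<close>, exactly halfway from
    \<open>P y1 z1\<close> to \<open>x1\<close>.\<close>
  define y' where "y' = y1 + (\<epsilon> * w y1) *\<^sub>R e"
  define z' where "z' = z1 + (\<epsilon> * w z1) *\<^sub>R e"
  define x' where "x' = P y' z'"
  have x': "x' = P y1 z1 + (\<epsilon> * b) *\<^sub>R e"
    by (simp add: x'_def y'_def z'_def P_def b_def W_def algebra_simps)
  have x1x': "x1 - x' = (\<epsilon> * b) *\<^sub>R e" by (simp add: x1e x' flip: scaleR_diff_left)
  have wb: "\<epsilon> * w q \<le> \<epsilon> * N" if "q \<in> closure \<Omega>" for q using N(2)[OF that] \<epsilon> by simp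
  have bN: "\<epsilon> * b \<le> \<epsilon> * N" using WN[OF c1(1,2)] \<epsilon> by (simp add: b_def)
  have y'K: "y' \<in> K"
  proof -
    have "dist y1 y' = \<epsilon> * w y1" using e \<epsilon> w0[OF c1(1)] by (simp add: y'_def dist_norm)
    then have "y' \<in> cball y1 (3 * (\<epsilon> * N))" using wb[OF c1(1)] \<epsilon>N(1) unfolding mem_cball by linarith
    then show ?thesis using cb[OF K0s(1)] by blast
  qed
  have z'K: "z' \<in> K"
  proof -
    have "dist z1 z' = \<epsilon> * w z1" using e \<epsilon> w0[OF c1(2)] by (simp add: z'_def dist_norm)
    then have "z' \<in> cball z1 (3 * (\<epsilon> * N))" using wb[OF c1(2)] \<epsilon>N(1) unfolding mem_cball by linarith
    then show ?thesis using cb[OF K0s(2)] by blast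
  qed
  have O': "y' \<in> \<Omega>" "z' \<in> \<Omega>" "y' \<in> closure \<Omega>" "z' \<in> closure \<Omega>" using y'K z'K KO cl by auto
  have xO': "x' \<in> \<Omega>" "x' \<in> closure \<Omega>" using PO[OF O'(1,2)] cl by (auto simp: x'_def)

  \<comment> \<open>Moving \<open>y1\<close> to \<open>y'\<close> brings \<open>P\<close> closer to
    \<open>x1\<close>. A larger value at \<open>y'\<close> would also widen the constraint, giving
    an admissible triple with a strictly larger objective.\<close>
  have wy': "w y' \<le> w y1"
  proof (rule ccontr)
    assume n: "\<not> ?thesis"
    have "x1 - P y' z1 = (2 * (\<epsilon> * b) - \<nu> * (\<epsilon> * w y1)) *\<^sub>R e"
      by (simp add: x1e P_def y'_def algebra_simps)
    moreover have "2 * (\<epsilon> * b) - \<nu> * (\<epsilon> * w y1) \<ge> 0" using nm \<epsilon> wy1 by (simp add: b_def W_def algebra_simps)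
    ultimately have "norm (x1 - P y' z1) = 2 * (\<epsilon> * b) - \<nu> * (\<epsilon> * w y1)" using e by simp
    also have "\<dots> \<le> 2 * (\<epsilon> * b)" using nm \<epsilon> wy1 by simp
    also have bW: "b < W y' z1" using n nm by (simp add: b_def W_def)
    then have "2 * (\<epsilon> * b) \<le> 2 * (\<epsilon> * W y' z1)" using \<epsilon> by simp
    finally have "(W y' z1)\<^sup>2 \<le> b\<^sup>2" using mx[OF O'(3) c1(2,3)] by simp
    then show False using bW b by (simp add: power2_le_iff_abs_le)
  qed
  have wz': "w z' \<le> w z1"
  proof (rule ccontr)
    assume n: "\<not> ?thesis"
    have "x1 - P y1 z' = (2 * (\<epsilon> * b) - \<mu> * (\<epsilon> * w z1)) *\<^sub>R e"
      by (simp add: x1e P_def z'_def algebra_simps)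
    moreover have "2 * (\<epsilon> * b) - \<mu> * (\<epsilon> * w z1) \<ge> 0" using nm \<epsilon> wy1 by (simp add: b_def W_def algebra_simps)
    ultimately have "norm (x1 - P y1 z') = 2 * (\<epsilon> * b) - \<mu> * (\<epsilon> * w z1)" using e by simp
    also have "\<dots> \<le> 2 * (\<epsilon> * b)" using nm \<epsilon> wy1 by simp
    also have bW: "b < W y1 z'" using n nm by (simp add: b_def W_def)
    then have "2 * (\<epsilon> * b) \<le> 2 * (\<epsilon> * W y1 z')" using \<epsilon> by simp
    finally have "(W y1 z')\<^sup>2 \<le> b\<^sup>2" using mx[OF c1(1) O'(4) c1(3)] by simp
    then show False using bW b by (simp add: power2_le_iff_abs_le)
  qed

  obtain d1 y2 where d1: "0 \<le> d1" "d1 \<le> C * \<epsilon>" "w y1 - w y' \<le> C * \<epsilon>"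
    "y2 \<in> closure \<Omega>" "norm (y2 - y') \<le> 2 * (\<epsilon> * w y2)" "w y2 = w y1 + d1"
    "(w y1)\<^sup>2 \<le> parabola 1 \<epsilon> (w y1) (w y1 + d1) (w y')"
    using endpoint_estimate[OF O1(1) \<epsilon> e N(2) cb[OF K0s(1)] KO \<Lambda> y'_def wy'] unfolding C_def by blast
  obtain d2 z2 where d2: "0 \<le> d2" "d2 \<le> C * \<epsilon>" "w z1 - w z' \<le> C * \<epsilon>"
    "z2 \<in> closure \<Omega>" "norm (z2 - z') \<le> 2 * (\<epsilon> * w z2)" "w z2 = w z1 + d2"
    "(w z1)\<^sup>2 \<le> parabola 1 \<epsilon> (w z1) (w z1 + d2) (w z')"
    using endpoint_estimate[OF O1(2) \<epsilon> e N(2) cb[OF K0s(2)] KO \<Lambda> z'_def wz'] unfolding C_def by blast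
  define d where "d = \<nu> * d1 + \<mu> * d2"
  define \<eta> where "\<eta> = \<nu> * (w y1 - w y') + \<mu> * (w z1 - w z')"
  have Wd: "W y2 z2 = b + d" by (simp add: W_def b_def d_def d1(6) d2(6) algebra_simps)
  have W\<eta>: "W y' z' = b - \<eta>" by (simp add: W_def b_def \<eta>_def algebra_simps)
  have bm: "m \<le> b" using convex_bound_le[of "- w y1" "- m" "- w z1" \<nu> \<mu>] m(2)[OF Ks(1)] m(2)[OF Ks(2)] nm
    by (simp add: b_def W_def)
  have "\<eta> \<le> C * \<epsilon>" unfolding \<eta>_def using convex_bound_le[OF d1(3) d2(3)] nm by simp
  then have \<eta>: "2 * (b - \<eta>) > b" using C\<epsilon> bm by simp
  \<comment> \<open>The averaged endpoint inequalities already force this strict bound; what follows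
    derives the opposite inequality from the maximality at \<open>x1\<close>.\<close>
  have strict: "b\<^sup>2 < parabola \<theta> \<epsilon> b (b - \<eta>) (b + d)"
    using contr[of \<epsilon> "w y1" d1 "w y1 - w y'" "w z1" d2 "w z1 - w z'"]
      \<epsilon> \<epsilon>lt C\<epsilon> m Ks N(2)[OF c1(1)] N(2)[OF c1(2)] d1 d2 wy' wz'
    unfolding b_def W_def d_def \<eta>_def Let_def by simp

  \<comment> \<open>The triple \<open>(y2, z2, x')\<close> is admissible because the radii
    \<open>2 * \<epsilon> * w y2\<close> and \<open>2 * \<epsilon> * w z2\<close> average to the
    radius for \<open>W y2 z2\<close>.\<close>
  have "norm (x' - P y2 z2) \<le> 2 * (\<epsilon> * W y2 z2)"
  proof -
    have "x' - P y2 z2 = \<nu> *\<^sub>R (y' - y2) + \<mu> *\<^sub>R (z' - z2)" by (simp add: x'_def P_def algebra_simps)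
    then have "norm (x' - P y2 z2) \<le> \<nu> * norm (y' - y2) + \<mu> * norm (z' - z2)"
      using norm_triangle_ineq[of "\<nu> *\<^sub>R (y' - y2)" "\<mu> *\<^sub>R (z' - z2)"] nm by simp
    also have "\<dots> \<le> \<nu> * (2 * (\<epsilon> * w y2)) + \<mu> * (2 * (\<epsilon> * w z2))"
      using d1(5) d2(5) nm by (intro add_mono mult_left_mono) (auto simp: norm_minus_commute)
    finally show ?thesis by (simp add: W_def algebra_simps)
  qed
  from mx[OF d1(4) d2(4) xO'(2) this] have up: "(b + d)\<^sup>2 - b\<^sup>2 + \<theta> * u x1 \<le> \<theta> * u x'" by (simp add: Wd)

  \<comment> \<open>This is the radius allowed for the pair \<open>(y', z')\<close>, since
    \<open>W y' z' = b - \<eta>\<close>. Hence every point of the ball about \<open>x'\<close>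
    yields an admissible triple with that pair.\<close>
  define R where "R = 2 * (\<epsilon> * (b - \<eta>))"
  have R: "R > 0" "\<epsilon> * b \<le> R" using \<eta> \<epsilon> b by (simp_all add: R_def)
  have \<eta>0: "\<eta> \<ge> 0" using wy' wz' nm by (simp add: \<eta>_def)
  have RN: "R \<le> 2 * (\<epsilon> * N)" 
  proof -
    have "\<epsilon> * (b - \<eta>) \<le> \<epsilon> * b" using \<eta>0 \<epsilon> by simp
    then show ?thesis using bN by (simp add: R_def)
  qed
  have sub: "cball x' R \<subseteq> \<Omega>"
  proof
    fix x assume "x \<in> cball x' R"
    then have "dist (P y1 z1) x \<le> \<epsilon> * b + R"
      using dist_triangle[of "P y1 z1" x x'] e b by (simp add: x' dist_norm)
    then have "x \<in> cball (P y1 z1) (3 * (\<epsilon> * N))" using RN bN by simp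
    then show "x \<in> \<Omega>" using cb[OF K0s(3)] KO by blast
  qed
  have "continuous_on (cball x' R) u" using sub cl continuous_closure by (meson continuous_on_subset order_trans)
  moreover have "cball x' R \<noteq> {}" using R by simp
  ultimately obtain x3 where x3: "x3 \<in> cball x' R" "\<And>x. x \<in> cball x' R \<Longrightarrow> u x3 \<le> u x"
    using continuous_attains_inf[OF compact_cball] by blast
  have "norm (x3 - P y' z') \<le> 2 * (\<epsilon> * W y' z')" using x3(1) by (simp add: R_def W\<eta> x'_def dist_norm norm_minus_commute)
  moreover have "x3 \<in> closure \<Omega>" using x3(1) sub cl by blast
  ultimately have "(W y' z')\<^sup>2 - \<theta> * u x3 \<le> b\<^sup>2 - \<theta> * u x1" by (intro mx O')
  then have lo: "(b - \<eta>)\<^sup>2 - b\<^sup>2 + \<theta> * u x1 \<le> \<theta> * u x3" by (simp add: W\<eta>)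
  define t where "t = b / (2 * (b - \<eta>))"
  have t: "0 \<le> t" "t \<le> 1" using \<eta> b by (simp_all add: t_def)
  have "norm (x1 - x') = \<epsilon> * b" using x1x' e b by simp
  then have "u x1 \<ge> (1 - \<epsilon> * b / R) * u x' + \<epsilon> * b / R * u x3 + \<epsilon> * b * (R - \<epsilon> * b) / 2"
    by (intro super_comparison[OF open_domain viscosity sub x3(2) R(1)]) (use R in auto)
  moreover have "\<epsilon> * b / R = t" using \<epsilon> by (simp add: R_def t_def)
  moreover have "\<epsilon> * b * (R - \<epsilon> * b) / 2 = \<epsilon>\<^sup>2 * b * (2 * (b - \<eta>) - b) / 2"
    by (simp add: R_def power2_eq_square algebra_simps)
  ultimately have "(1 - t) * u x' + t * u x3 + \<epsilon>\<^sup>2 * b * (2 * (b - \<eta>) - b) / 2 \<le> u x1" by simp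
  then have "\<theta> * ((1 - t) * u x' + t * u x3 + \<epsilon>\<^sup>2 * b * (2 * (b - \<eta>) - b) / 2) \<le> \<theta> * u x1"
    using \<theta> by (intro mult_left_mono) auto
  then have "(1 - t) * (\<theta> * u x') + t * (\<theta> * u x3) + \<theta> * (\<epsilon>\<^sup>2 * b * (2 * (b - \<eta>) - b) / 2) \<le> \<theta> * u x1"
    by (simp add: algebra_simps)
  \<comment> \<open>Weighted with \<open>1 - t\<close> and \<open>t\<close>, the two competitor
    bounds replace \<open>u x'\<close> and \<open>u x3\<close> by squares of \<open>W\<close>;
    \<open>\<theta> * u x1\<close> then cancels.\<close>
  moreover have "(1 - t) * ((b + d)\<^sup>2 - b\<^sup>2 + \<theta> * u x1) + t * ((b - \<eta>)\<^sup>2 - b\<^sup>2 + \<theta> * u x1) \<le> (1 - t) * (\<theta> * u x') + t * (\<theta> * u x3)"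
    using up lo t by (intro add_mono mult_left_mono) auto
  moreover have "(1 - t) * ((b + d)\<^sup>2 - b\<^sup>2 + \<theta> * u x1) + t * ((b - \<eta>)\<^sup>2 - b\<^sup>2 + \<theta> * u x1)
    = (1 - t) * (b + d)\<^sup>2 + t * (b - \<eta>)\<^sup>2 - b\<^sup>2 + \<theta> * u x1" by (simp add: algebra_simps)
  ultimately show False using strict unfolding t_def[symmetric] by linarith
qed

section \<open>Semiconcavity of the solution and proof of (b)\<close>

lemma locally_semiconcave: "locally_semiconcave_on \<Omega> u"
  unfolding locally_semiconcave_on_def
proof (intro allI impI, elim conjE)
  fix K assume K: "compact K" "K \<subseteq> \<Omega>"
  have hull: "compact (convex hull K)" "convex hull K \<subseteq> \<Omega>"
    using K by (auto intro: compact_convex_hull hull_minimal[of K \<Omega> convex, OF _ convex_domain, THEN subsetD])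
  obtain \<Lambda> where \<Lambda>: "\<Lambda> \<ge> 0" "\<And>x y. \<lbrakk>x \<in> K; y \<in> K\<rbrakk> \<Longrightarrow> \<bar>w x - w y\<bar> \<le> \<Lambda> * norm (x - y)"
    using lipschitz_sqrt[OF K] by blast
  have cl: "\<Omega> \<subseteq> closure \<Omega>" by (rule closure_subset)
  have "u (t *\<^sub>R x + (1 - t) *\<^sub>R y) \<ge> t * u x + (1 - t) * u y - 2 * \<Lambda>\<^sup>2 * (t * (1 - t) / 2) * (norm (x - y))\<^sup>2"
    if xy: "closed_segment x y \<subseteq> K" and t: "t \<in> {0..1}" for x y and t :: real
  proof -
    have xK: "x \<in> K" "y \<in> K" using xy by auto
    then have x: "x \<in> \<Omega>" "y \<in> \<Omega>" "x \<in> closure \<Omega>" "y \<in> closure \<Omega>" using K cl by auto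
    consider "t = 0" | "t = 1" | "0 < t" "t < 1" using t by force
    then show ?thesis
    proof cases
      case 3
      define q where "q = t *\<^sub>R x + (1 - t) *\<^sub>R y"
      have "q \<in> \<Omega>" unfolding q_def using convexD[OF convex_domain x(1,2)] 3 by simp
      then have q: "q \<in> closure \<Omega>" using cl by blast
      have "t * w x + (1 - t) * w y \<le> w q" unfolding q_def by (rule sqrt_concave) (use x 3 in auto)
      moreover have "0 \<le> t * w x + (1 - t) * w y" using 3 nonneg x by simp
      ultimately have sq: "(t * w x + (1 - t) * w y)\<^sup>2 \<le> u q" using sq_sqrt[OF q] by (metis power_mono)
      \<comment> \<open>The square of an average falls short of the average of the squares by
        \<open>t * (1 - t) * (a - b)^2\<close>. For \<open>a = w x\<close> and
        \<open>b = w y\<close> the Lipschitz bound turns this into the semiconcavity error with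
        constant \<open>2 * \<Lambda>^2\<close>.\<close>
      have "(t * a + (1 - t) * b)\<^sup>2 = t * a\<^sup>2 + (1 - t) * b\<^sup>2 - t * (1 - t) * (a - b)\<^sup>2" for a b :: real
        by (simp add: algebra_simps power2_eq_square)
      from this[of "w x" "w y"] have eq: "(t * w x + (1 - t) * w y)\<^sup>2 = t * u x + (1 - t) * u y - t * (1 - t) * (w x - w y)\<^sup>2"
        unfolding sq_sqrt[OF x(3)] sq_sqrt[OF x(4)] .
      have "(w x - w y)\<^sup>2 \<le> (\<Lambda> * norm (x - y))\<^sup>2" using power_mono[OF \<Lambda>(2)[OF xK], of 2] by simp
      then have "t * (1 - t) * (w x - w y)\<^sup>2 \<le> t * (1 - t) * (\<Lambda> * norm (x - y))\<^sup>2"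
        using 3 by (intro mult_left_mono) auto
      then have "t * u x + (1 - t) * u y - t * (1 - t) * (\<Lambda> * norm (x - y))\<^sup>2 \<le> u q" using sq eq by linarith
      then show ?thesis unfolding q_def[symmetric] by (simp add: power_mult_distrib mult_ac)
    qed auto
  qed
  then show "\<exists>C. semiconcave_on C K u" unfolding semiconcave_on_def by blast
qed

lemma C1_solution: "C1_on \<Omega> u"
  using locally_semiconcave_viscosity_C1[OF open_domain viscosity locally_semiconcave] .

end

theorem theorem16:
  shows "(\<forall>(\<Omega> :: (real^'n) set) f u.
            open \<Omega> \<and> continuous_on (\<Omega> \<times> UNIV) (\<lambda>(x, t). f x t) \<and>
            viscosity_solution \<Omega> f u \<and> locally_semiconcave_on \<Omega> u \<longrightarrow>
            (\<forall>x\<in>\<Omega>. u differentiable (at x)) \<and> C1_on \<Omega> u) \<and>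
         (\<forall>(\<Omega> :: (real^'n) set) u.
            open \<Omega> \<and> bounded \<Omega> \<and> convex \<Omega> \<and> dirichlet_solution \<Omega> u \<longrightarrow>
            C1_on \<Omega> u)"
proof (intro conjI allI impI; elim conjE)
  fix \<Omega> :: "(real^'n) set" and f u
  assume "open \<Omega>" "viscosity_solution \<Omega> f u" "locally_semiconcave_on \<Omega> u"
  then have "C1_on \<Omega> u" by (rule locally_semiconcave_viscosity_C1)
  then show "\<forall>x\<in>\<Omega>. u differentiable (at x)" "C1_on \<Omega> u" unfolding C1_on_def by blast+
next
  fix \<Omega> :: "(real^'n) set" and u
  assume "open \<Omega>" "bounded \<Omega>" "convex \<Omega>" "dirichlet_solution \<Omega> u"
  then interpret dirichlet_problem \<Omega> u by unfold_locales
  show "C1_on \<Omega> u" by (rule C1_solution)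
qed

end
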